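(* Fix $c>0$ and $\eta\in[0,1)$ satisfying $c<\overline c(\eta)$, and let $\zeta$ be the unique solution in $[0,1]$ of $$(1-\zeta)\left(\frac{W(2\zeta c^2)}{2\zeta c^2}\right)^{3/2}=\eta .$$ If $p=p(n)=(1+o(1))\,c/\sqrt n$ and $G=G_n$ is distributed as $G(n,p)$ conditioned on the event $\{X\le\eta\,\mathbb E_pX\}$, then with probability $1$, $$\lim_{n\to\infty}\frac1{qn^2}\,\|A_{G}-qJ\|_\square=0,\qquad\text{where } q=q(n)=\sqrt{\frac{W(2\zeta c^2)}{2\zeta}}\cdot\frac1{\sqrt n}.$$
   Context: $G(n,p)$ is the Erdős–Rényi random graph on $n$ labeled vertices, $X$ its number of triangles and $\mathbb E_p$ expectation for $G(n,p)$. $A_G$ is the adjacency matrix of $G$ and $J=J_n$ is the $n\times n$ all-ones matrix. For $A\in\mathbb R^{n\times n}$ the cut norm is $\|A\|_\square=\sup_{x,y\in\{0,1\}^n}|x^TAy|$. $W$ is the Lambert-W function, the inverse of $x\mapsto xe^x$ on the nonnegative reals, with $W(x)/x$ taken to be $1$ at $x=0$. Define $$\eta^\ast=\left(\frac{W(2/e)}{2/e}\right)^{3/2},\qquad \overline c(\eta)=\begin{cases}\dfrac{1}{\sqrt{e(1-\eta/\eta^\ast)}} & \text{if }\eta<\eta^\ast,\\ +\infty & \text{if }\eta\ge\eta^\ast.\end{cases}$$ The almost-sure statement refers to a sequence $(G_n)_{n\ge1}$ of random graphs with the stated marginal distributions, defined on a common probability space. *)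

theory Defs
  imports
    "HOL-Probability.Probability"
    "HOL-Library.Ramsey"
    "HOL-Library.Landau_Symbols"
    "Jordan_Normal_Form.Matrix"
begin

subsection \<open>Lambert W function and the threshold\<close>

definition Lambert_W :: "real \<Rightarrow> real" where
  "Lambert_W x = (THE w. 0 \<le> w \<and> w * exp w = x)"

text \<open>The quotient W(x)/x, with its limiting value 1 at x = 0.\<close>

definition Lambert_W_quot :: "real \<Rightarrow> real" where
  "Lambert_W_quot x = (if x = 0 then 1 else Lambert_W x / x)"

definition eta_star :: real where
  "eta_star = Lambert_W_quot (2 / exp 1) powr (3/2)"

definition c_bar :: "real \<Rightarrow> ereal" where
  "c_bar \<eta> = (if \<eta> < eta_star then ereal (1 / sqrt (exp 1 * (1 - \<eta> / eta_star))) else \<infinity>)"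

definition zeta_solution :: "real \<Rightarrow> real \<Rightarrow> real \<Rightarrow> bool" where
  "zeta_solution c \<eta> \<zeta> \<longleftrightarrow>
     \<zeta> \<in> {0..1} \<and> (1 - \<zeta>) * Lambert_W_quot (2 * \<zeta> * c\<^sup>2) powr (3/2) = \<eta>"

subsection \<open>Random graphs\<close>

text \<open>
  A simple graph on the labelled vertices {0,...,n-1} is represented by its edge set, a subset of
  \<^term>\<open>nsets {..<n} 2\<close> (the 2-element subsets of the vertex set).
\<close>

definition gnp :: "nat \<Rightarrow> real \<Rightarrow> nat set set pmf" where
  "gnp n p = map_pmf (\<lambda>f. {e \<in> nsets {..<n} 2. f e})
               (Pi_pmf (nsets {..<n} 2) False (\<lambda>_. bernoulli_pmf p))"

definition num_triangles :: "nat set set \<Rightarrow> nat" where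
  "num_triangles E = card {T. card T = 3 \<and> nsets T 2 \<subseteq> E}"

definition lower_tail :: "nat \<Rightarrow> real \<Rightarrow> real \<Rightarrow> nat set set set" where
  "lower_tail n p \<eta> =
     {E. real (num_triangles E) \<le>
           \<eta> * measure_pmf.expectation (gnp n p) (\<lambda>E'. real (num_triangles E'))}"

subsection \<open>Matrices\<close>

definition adj_mat :: "nat \<Rightarrow> nat set set \<Rightarrow> real mat" where
  "adj_mat n E = mat n n (\<lambda>(i, j). if {i, j} \<in> E then 1 else 0)"

definition all_ones_mat :: "nat \<Rightarrow> real mat" where
  "all_ones_mat n = mat n n (\<lambda>_. 1)"

definition zero_one_vecs :: "nat \<Rightarrow> real Matrix.vec set" where
  "zero_one_vecs n = {x \<in> carrier_vec n. set\<^sub>v x \<subseteq> {0, 1}}"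

definition cut_norm :: "real mat \<Rightarrow> real" where
  "cut_norm A = (SUP (x, y) \<in> zero_one_vecs (dim_row A) \<times> zero_one_vecs (dim_col A).
                   \<bar>scalar_prod x (A *\<^sub>v y)\<bar>)"

end

theory Submission
  imports Defs "HOL-Real_Asymp.Real_Asymp"
begin

text \<open>
  Penalising every triangle by a factor 1 - z turns the lower tail into a Gibbs measure on the edge set
  of the complete graph. There the odds of an edge e are the activity times the expectation of
  (1 - z) to the number of pairs of present edges closing a triangle with e. Expanding this
  expectation over the roughly n such pairs, one pair at a time, expresses the marginal of e through
  marginals of models in which boundedly many edges have been conditioned on. With x denoting the
  marginal times the square root of n, the recursion becomes x = c exp (- z x^2) in the limit, and
  since x never exceeds c it is a contraction as soon as 2 z c^2 < 1. The hypothesis on c is precisely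
  z c^2 < 1/e, which is stronger. Hence all edge marginals are asymptotically equal, uniformly under
  small perturbations of z and of the activities.

  Tilting the activities along a cut therefore shows that the number of edges in a cut deviates by
  the order of n^(3/2) with probability at most exp (- const n^(3/2)); there are only 4^n cuts.
  Tilting z shows that the triangle count concentrates, which compares the Gibbs measure with the
  conditioned random graph at a cost exp (o(n^(3/2))). Borel-Cantelli concludes.
\<close>

section \<open>Gibbs measures on hypergraphs\<close>

text \<open>The obstacle: once two edges of a triangle have been conditioned to be present, the
  third carries a direct penalty 1 - z, so its marginal is off by a constant factor. Such edges are
  kept in an exceptional set of at most k elements. As two edges lie in at most one common triangle,
  one more conditioning leads from k to at most 2k + 1, and one round of the recursion, which
  conditions twice, from k to 4k + 3. For a fixed number of rounds this is bounded, against n - 2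
  triangles through every edge; so the number of rounds is chosen before n tends to infinity. The
  Lambert function enters because x = c exp (- z x^2) says that 2 z x^2 = W (2 z c^2). A triangle is
  then present with probability about (1 - z) x^3 n^(-3/2), the factor 1 - z being its own penalty,
  and equating (1 - z) x^3 with \<eta> c^3 is the equation for \<zeta>.\<close>

text \<open>
  The random set is the union of A and U, where the vertices in A have been conditioned to be present
  and U is drawn; removing a vertex is expressed by giving it activity 0.
\<close>

definition gwt :: "real \<Rightarrow> ('v \<Rightarrow> real) \<Rightarrow> 'v set \<Rightarrow> 'v set set \<Rightarrow> 'v set \<Rightarrow> real" where
  "gwt z lam A H U = (\<Prod>v\<in>U. lam v) * (1 - z) ^ card {h \<in> H. h \<subseteq> U \<union> A}"

definition gsum :: "'v set \<Rightarrow> real \<Rightarrow> ('v \<Rightarrow> real) \<Rightarrow> 'v set \<Rightarrow> 'v set set \<Rightarrow> ('v set \<Rightarrow> real) \<Rightarrow> real" where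
  "gsum E z lam A H f = (\<Sum>U\<in>Pow E. f U * gwt z lam A H U)"

definition gprob :: "'v set \<Rightarrow> real \<Rightarrow> ('v \<Rightarrow> real) \<Rightarrow> 'v set \<Rightarrow> 'v set set \<Rightarrow> ('v set \<Rightarrow> bool) \<Rightarrow> real" where
  "gprob E z lam A H Q = gsum E z lam A H (\<lambda>U. of_bool (Q U)) / gsum E z lam A H (\<lambda>_. 1)"

locale gibbs =
  fixes E :: "'v set" and z :: real
  assumes finite_E: "finite E" and z01: "0 \<le> z" "z \<le> 1"
begin

abbreviation "S \<equiv> gsum E z"
abbreviation "Z lam A H \<equiv> gsum E z lam A H (\<lambda>_. 1)"
abbreviation "P \<equiv> gprob E z"
abbreviation "marg lam A H e \<equiv> gprob E z lam A H (\<lambda>U. e \<in> U)"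

lemma gwt_nonneg: "(\<And>v. v \<in> E \<Longrightarrow> 0 \<le> lam v) \<Longrightarrow> U \<subseteq> E \<Longrightarrow> 0 \<le> gwt z lam A H U"
  unfolding gwt_def using z01 by (intro mult_nonneg_nonneg prod_nonneg) auto

lemma gsum_mono:
  assumes "\<And>v. v \<in> E \<Longrightarrow> 0 \<le> lam v" "\<And>U. U \<subseteq> E \<Longrightarrow> f U \<le> g U"
  shows "S lam A H f \<le> S lam A H g"
  unfolding gsum_def
  by (intro sum_mono mult_right_mono) (use assms gwt_nonneg in auto)

lemma gsum_nonneg:
  assumes "\<And>v. v \<in> E \<Longrightarrow> 0 \<le> lam v" "\<And>U. U \<subseteq> E \<Longrightarrow> 0 \<le> f U"
  shows "0 \<le> S lam A H f"
  unfolding gsum_def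
  by (intro sum_nonneg mult_nonneg_nonneg) (use assms gwt_nonneg in auto)

text \<open>Conditioning on the presence of \<open>e\<close>: moving \<open>e\<close> into
  \<open>A\<close> keeps it visible to the hyperedges, its activity comes out as a factor, and
  activity 0 makes every remaining set that contains \<open>e\<close> weightless, so the sum may
  again run over all of \<open>Pow E\<close>.\<close>

lemma gsum_mem:
  assumes e: "e \<in> E" "e \<notin> A"
  shows "S lam A H (\<lambda>U. of_bool (e \<in> U) * f U)
       = lam e * S (lam(e := 0)) (insert e A) H (\<lambda>U. f (insert e U))"
proof -
  let ?E = "E - {e}"
  have PE: "Pow E = Pow ?E \<union> insert e ` Pow ?E"
    using e Pow_insert[of e ?E] by (simp add: insert_absorb)
  have fin: "finite ?E" using finite_E by auto
  have inj: "inj_on (insert e) (Pow ?E)"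
    by (auto simp: inj_on_def insert_eq_iff)
  have "S lam A H (\<lambda>U. of_bool (e \<in> U) * f U)
     = (\<Sum>U\<in>insert e ` Pow ?E. f U * gwt z lam A H U)"
    unfolding gsum_def by (rule sum.mono_neutral_cong_right) (use finite_E PE in auto)
  also have "\<dots> = (\<Sum>U\<in>Pow ?E. f (insert e U) * gwt z lam A H (insert e U))"
    by (subst sum.reindex[OF inj]) simp
  also have "\<dots> = (\<Sum>U\<in>Pow ?E. lam e * (f (insert e U) * gwt z (lam(e := 0)) (insert e A) H U))"
  proof (rule sum.cong[OF refl])
    fix U assume U: "U \<in> Pow ?E"
    then have fU: "finite U" "e \<notin> U" using fin finite_subset by auto
    have p: "(\<Prod>v\<in>insert e U. lam v) = lam e * (\<Prod>v\<in>U. (lam(e := 0)) v)"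
    proof -
      have "(\<Prod>v\<in>U. lam v) = (\<Prod>v\<in>U. (lam(e := 0)) v)"
        by (rule prod.cong) (use fU in auto)
      then show ?thesis using fU by simp
    qed
    show "f (insert e U) * gwt z lam A H (insert e U)
      = lam e * (f (insert e U) * gwt z (lam(e := 0)) (insert e A) H U)"
      unfolding gwt_def p by simp
  qed
  also have "\<dots> = lam e * (\<Sum>U\<in>Pow ?E. (f (insert e U) * gwt z (lam(e := 0)) (insert e A) H U))"
    by (simp add: sum_distrib_left)
  also have "(\<Sum>U\<in>Pow ?E. (f (insert e U) * gwt z (lam(e := 0)) (insert e A) H U))
    = S (lam(e := 0)) (insert e A) H (\<lambda>U. f (insert e U))"
    unfolding gsum_def
  proof (rule sum.mono_neutral_left)
    show "\<forall>U\<in>Pow E - Pow (E - {e}). f (insert e U) * gwt z (lam(e := 0)) (insert e A) H U = 0"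
    proof
      fix U assume U: "U \<in> Pow E - Pow (E - {e})"
      then have "finite U" "e \<in> U" using finite_E finite_subset by auto
      then have "(\<Prod>v\<in>U. (lam(e := 0)) v) = 0" by (intro prod_zero) auto
      then show "f (insert e U) * gwt z (lam(e := 0)) (insert e A) H U = 0"
        by (simp add: gwt_def)
    qed
  qed (use finite_E in auto)
  finally show ?thesis .
qed

lemma gsum_split:
  assumes e: "e \<in> E"
  shows "S lam A H f = S (lam(e := 0)) A H f + S lam A H (\<lambda>U. of_bool (e \<in> U) * f U)"
  unfolding gsum_def sum.distrib[symmetric]
proof (rule sum.cong[OF refl])
  fix U assume "U \<in> Pow E"
  then have fU: "finite U" using finite_E finite_subset by auto
  show "f U * gwt z lam A H U = f U * gwt z (lam(e := 0)) A H U
      + of_bool (e \<in> U) * f U * gwt z lam A H U"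
  proof (cases "e \<in> U")
    case True
    then have "(\<Prod>v\<in>U. (lam(e := 0)) v) = 0" using fU by (intro prod_zero) auto
    then show ?thesis using True by (simp add: gwt_def)
  next
    case False
    then have "(\<Prod>v\<in>U. (lam(e := 0)) v) = (\<Prod>v\<in>U. lam v)"
      by (intro prod.cong) auto
    then show ?thesis using False by (simp add: gwt_def)
  qed
qed

text \<open>With activity 0 only sets avoiding \<open>e\<close> count. Hyperedges avoiding
  \<open>e\<close> do not notice whether \<open>e\<close> is in \<open>A\<close>, and those through
  \<open>e\<close> are never contained in \<open>U \<union> A\<close>. Thus removing
  \<open>e\<close> and conditioning on \<open>e\<close> become models over the same \<open>A\<close>
  that differ only in their hyperedges.\<close>

lemma gsum_insert_A:
  assumes e: "e \<in> E" "e \<notin> A" and l0: "lam e = 0"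
  shows "S lam (insert e A) {h \<in> H. e \<notin> h} f = S lam A H f"
  unfolding gsum_def
proof (rule sum.cong[OF refl])
  fix U assume "U \<in> Pow E"
  then have fU: "finite U" using finite_E finite_subset by auto
  show "f U * gwt z lam (insert e A) {h \<in> H. e \<notin> h} U = f U * gwt z lam A H U"
  proof (cases "e \<in> U")
    case True
    then have "(\<Prod>v\<in>U. lam v) = 0" using fU l0 by (intro prod_zero) auto
    then show ?thesis by (simp add: gwt_def)
  next
    case False
    then have "{h \<in> {h \<in> H. e \<notin> h}. h \<subseteq> U \<union> insert e A} = {h \<in> H. h \<subseteq> U \<union> A}"
      using e by auto
    then show ?thesis by (simp add: gwt_def)
  qed
qed

lemma gsum_insert_H:
  assumes "finite H" "h \<notin> H"
  shows "S lam A (insert h H) f = S lam A H (\<lambda>U. f U * (1 - z * of_bool (h \<subseteq> U \<union> A)))"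
  unfolding gsum_def
proof (rule sum.cong[OF refl])
  fix U assume "U \<in> Pow E"
  have "{h' \<in> insert h H. h' \<subseteq> U \<union> A} =
    (if h \<subseteq> U \<union> A then insert h {h' \<in> H. h' \<subseteq> U \<union> A} else {h' \<in> H. h' \<subseteq> U \<union> A})" by auto
  then show "f U * gwt z lam A (insert h H) U
    = f U * (1 - z * of_bool (h \<subseteq> U \<union> A)) * gwt z lam A H U"
    using assms by (simp add: gwt_def)
qed

lemma gsum_diff: "S lam A H (\<lambda>U. f U - g U) = S lam A H f - S lam A H g"
  by (simp add: gsum_def left_diff_distrib sum_subtractf)

lemma gsum_cmult: "S lam A H (\<lambda>U. a * f U) = a * S lam A H f"
  by (simp add: gsum_def sum_distrib_left mult.assoc)

lemma gsum_cong:
  "(\<And>U. U \<subseteq> E \<Longrightarrow> f U = g U) \<Longrightarrow> S lam A H f = S lam A H g"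
  by (auto simp: gsum_def intro!: sum.cong)

lemma Z_ge_1:
  assumes "\<And>v. v \<in> E \<Longrightarrow> 0 \<le> lam v" "\<And>h. h \<in> H \<Longrightarrow> \<not> h \<subseteq> A"
  shows "1 \<le> Z lam A H"
proof -
  have "{h \<in> H. h \<subseteq> A} = {}" using assms(2) by auto
  then have "gwt z lam A H {} = 1" unfolding gwt_def Un_empty_left by (simp only: card.empty) simp
  moreover have "1 * gwt z lam A H {} \<le> Z lam A H"
    unfolding gsum_def
    by (rule member_le_sum) (use finite_E gwt_nonneg[OF assms(1)] in auto)
  ultimately show ?thesis by simp
qed

lemma Z_insert_H:
  assumes "finite H" "h \<notin> H" "Z lam A H > 0"
  shows "Z lam A (insert h H) = Z lam A H * (1 - z * P lam A H (\<lambda>U. h \<subseteq> U \<union> A))"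
proof -
  have "Z lam A (insert h H) = Z lam A H - z * S lam A H (\<lambda>U. of_bool (h \<subseteq> U \<union> A))"
    by (subst gsum_insert_H[OF assms(1,2)]) (simp add: gsum_diff gsum_cmult)
  then show ?thesis using assms(3) by (simp add: gprob_def right_diff_distrib)
qed

lemma gprob_nonneg:
  assumes "\<And>v. v \<in> E \<Longrightarrow> 0 \<le> lam v"
  shows "0 \<le> P lam A H Q"
  unfolding gprob_def by (intro divide_nonneg_nonneg gsum_nonneg assms) auto

lemma gprob_mono:
  assumes "\<And>v. v \<in> E \<Longrightarrow> 0 \<le> lam v" "\<And>U. U \<subseteq> E \<Longrightarrow> Q U \<Longrightarrow> R U"
  shows "P lam A H Q \<le> P lam A H R"
  unfolding gprob_def by (intro divide_right_mono gsum_nonneg gsum_mono assms) (use assms in auto)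

lemma gprob_le_1:
  assumes "\<And>v. v \<in> E \<Longrightarrow> 0 \<le> lam v"
  shows "P lam A H Q \<le> 1"
proof -
  have "S lam A H (\<lambda>U. of_bool (Q U)) \<le> Z lam A H" by (intro gsum_mono assms) auto
  moreover have "0 \<le> Z lam A H" by (intro gsum_nonneg assms) auto
  ultimately show ?thesis by (auto simp: gprob_def divide_le_eq)
qed

lemma gsum_mem_1:
  assumes "e \<in> E" "e \<notin> A"
  shows "S lam A H (\<lambda>U. of_bool (e \<in> U)) = lam e * Z (lam(e := 0)) (insert e A) H"
  using gsum_mem[OF assms, of lam H "\<lambda>_. 1"] by simp

lemma Z_antimono_H:
  assumes "\<And>v. v \<in> E \<Longrightarrow> 0 \<le> lam v" "finite H" "H' \<subseteq> H"
  shows "Z lam A H \<le> Z lam A H'"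
  unfolding gsum_def
proof (intro sum_mono mult_left_mono)
  fix U assume U: "U \<in> Pow E"
  have "card {h \<in> H'. h \<subseteq> U \<union> A} \<le> card {h \<in> H. h \<subseteq> U \<union> A}"
    by (rule card_mono) (use assms in auto)
  then show "gwt z lam A H U \<le> gwt z lam A H' U"
    unfolding gwt_def by (intro mult_left_mono power_decreasing prod_nonneg) (use z01 assms(1) U in auto)
qed auto

lemma Z_remove:
  assumes "e \<in> E" "e \<notin> A"
  shows "Z lam A H = Z (lam(e := 0)) (insert e A) {h \<in> H. e \<notin> h}
     + lam e * Z (lam(e := 0)) (insert e A) H"
  using gsum_split[OF assms(1), of lam A H "\<lambda>_. 1"] gsum_mem_1[OF assms, of lam H]
    gsum_insert_A[OF assms, of "lam(e := 0)" H "\<lambda>_. 1"] by simp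

text \<open>The hyperedges through \<open>e\<close> only penalise its presence, so the odds of
  \<open>e\<close> are at most its activity, and a probability is at most its odds.\<close>

lemma marg_le:
  assumes "\<And>v. v \<in> E \<Longrightarrow> 0 \<le> lam v" "finite H" "e \<in> E" "e \<notin> A"
  shows "marg lam A H e \<le> lam e"
proof -
  have l0: "\<And>v. v \<in> E \<Longrightarrow> 0 \<le> (lam(e := 0)) v" using assms(1) by auto
  have "Z (lam(e := 0)) (insert e A) H \<le> Z (lam(e := 0)) (insert e A) {h \<in> H. e \<notin> h}"
    by (rule Z_antimono_H[OF l0 assms(2)]) auto
  moreover have "0 \<le> lam e * Z (lam(e := 0)) (insert e A) H"
    by (intro mult_nonneg_nonneg gsum_nonneg l0) (use assms in auto)
  ultimately have "Z (lam(e := 0)) (insert e A) H \<le> Z lam A H"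
    using Z_remove[OF assms(3,4), of lam H] by simp
  then have "lam e * Z (lam(e := 0)) (insert e A) H \<le> lam e * Z lam A H"
    using assms by (intro mult_left_mono) auto
  moreover have "0 \<le> Z lam A H" by (intro gsum_nonneg assms) auto
  ultimately show ?thesis unfolding gprob_def gsum_mem_1[OF assms(3,4)]
    using assms(1,3) by (auto simp: divide_le_eq)
qed

text \<open>\<open>R\<close> is the odds of \<open>e\<close>: the quotient of partition functions is
  the expected penalty from the hyperedges through \<open>e\<close>, taken in the model that has
  only the other hyperedges.\<close>

lemma marg_ratio:
  assumes "\<And>v. v \<in> E \<Longrightarrow> 0 \<le> lam v" "e \<in> E" "e \<notin> A"
    and pos: "Z (lam(e := 0)) (insert e A) {h \<in> H. e \<notin> h} > 0"
    and R: "R = lam e * (Z (lam(e := 0)) (insert e A) H / Z (lam(e := 0)) (insert e A) {h \<in> H. e \<notin> h})"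
  shows "marg lam A H e = R / (1 + R)"
proof -
  define a where "a = Z (lam(e := 0)) (insert e A) H"
  define b where "b = Z (lam(e := 0)) (insert e A) {h \<in> H. e \<notin> h}"
  have l0: "\<And>v. v \<in> E \<Longrightarrow> 0 \<le> (lam(e := 0)) v" using assms(1) by auto
  have a: "0 \<le> a" unfolding a_def by (intro gsum_nonneg l0) auto
  have l: "0 \<le> lam e" using assms by auto
  have b: "b > 0" using pos b_def by simp
  have "marg lam A H e = lam e * a / (b + lam e * a)"
    unfolding gprob_def gsum_mem_1[OF assms(2,3)] Z_remove[OF assms(2,3), of lam H] a_def b_def by simp
  also have "\<dots> = R / (1 + R)"
    unfolding R a_def[symmetric] b_def[symmetric] using a b l
    by (simp add: divide_simps add_nonneg_eq_0_iff add_pos_nonneg)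
  finally show ?thesis .
qed

text \<open>Chain rule. By \<open>gsum_mem\<close>, conditioning on \<open>f\<close> yields a model
  of the same family, so joint probabilities become products of marginals of different
  models.\<close>

lemma gprob_pair:
  assumes f: "f \<in> E" "f \<notin> A" "g \<noteq> f"
    and pos: "Z (lam(f := 0)) (insert f A) H > 0"
  shows "P lam A H (\<lambda>U. f \<in> U \<and> g \<in> U) = marg lam A H f * marg (lam(f := 0)) (insert f A) H g"
proof -
  have "S lam A H (\<lambda>U. of_bool (f \<in> U \<and> g \<in> U)) = S lam A H (\<lambda>U. of_bool (f \<in> U) * of_bool (g \<in> U))"
    by (rule gsum_cong) auto
  also have "\<dots> = lam f * S (lam(f := 0)) (insert f A) H (\<lambda>U. of_bool (g \<in> insert f U))"
    by (rule gsum_mem[OF assms(1,2)])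
  also have "\<dots> = lam f * S (lam(f := 0)) (insert f A) H (\<lambda>U. of_bool (g \<in> U))"
    using assms(3) by simp
  finally show ?thesis unfolding gprob_def gsum_mem_1[OF assms(1,2)] using pos by simp
qed

lemma gprob_triple:
  assumes e: "e \<in> E" "e \<notin> A" "f \<noteq> e" "g \<noteq> e"
    and pos: "Z (lam(e := 0)) (insert e A) H > 0"
  shows "P lam A H (\<lambda>U. e \<in> U \<and> f \<in> U \<and> g \<in> U)
       = marg lam A H e * P (lam(e := 0)) (insert e A) H (\<lambda>U. f \<in> U \<and> g \<in> U)"
proof -
  have "S lam A H (\<lambda>U. of_bool (e \<in> U \<and> f \<in> U \<and> g \<in> U)) = S lam A H (\<lambda>U. of_bool (e \<in> U) * of_bool (f \<in> U \<and> g \<in> U))"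
    by (rule gsum_cong) auto
  also have "\<dots> = lam e * S (lam(e := 0)) (insert e A) H (\<lambda>U. of_bool (f \<in> insert e U \<and> g \<in> insert e U))"
    by (rule gsum_mem[OF assms(1,2)])
  also have "\<dots> = lam e * S (lam(e := 0)) (insert e A) H (\<lambda>U. of_bool (f \<in> U \<and> g \<in> U))"
    using assms(3,4) by simp
  finally show ?thesis unfolding gprob_def gsum_mem_1[OF assms(1,2)] using pos by simp
qed

text \<open>By \<open>Z_insert_H\<close>, each new hyperedge multiplies the partition function by 1
  minus z times its probability under the hyperedges inserted so far. The induction prescribes no
  order of insertion, so the bounds \<open>a\<close> and \<open>b\<close> are required at every
  intermediate set \<open>K'\<close>.\<close>

lemma Z_telescope:
  assumes l: "\<And>v. v \<in> E \<Longrightarrow> 0 \<le> lam v" and fin: "finite H0" "finite K" and disj: "H0 \<inter> K = {}"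
    and pos: "\<And>K'. K' \<subseteq> K \<Longrightarrow> Z lam A (H0 \<union> K') > 0"
    and lo: "\<And>K' h. K' \<subseteq> K \<Longrightarrow> h \<in> K - K' \<Longrightarrow> a h \<le> P lam A (H0 \<union> K') (\<lambda>U. h \<subseteq> U \<union> A)"
    and hi: "\<And>K' h. K' \<subseteq> K \<Longrightarrow> h \<in> K - K' \<Longrightarrow> P lam A (H0 \<union> K') (\<lambda>U. h \<subseteq> U \<union> A) \<le> b h"
    and ab: "\<And>h. h \<in> K \<Longrightarrow> a h \<le> 1 \<and> 0 \<le> b h \<and> b h \<le> 1"
  shows "(\<Prod>h\<in>K. 1 - z * b h) \<le> Z lam A (H0 \<union> K) / Z lam A H0"
    and "Z lam A (H0 \<union> K) / Z lam A H0 \<le> (\<Prod>h\<in>K. 1 - z * a h)"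
proof -
  have Z0: "Z lam A H0 > 0" using pos[of "{}"] by simp
  have "(\<Prod>h\<in>K'. 1 - z * b h) \<le> Z lam A (H0 \<union> K') / Z lam A H0 \<and>
     Z lam A (H0 \<union> K') / Z lam A H0 \<le> (\<Prod>h\<in>K'. 1 - z * a h)" if "K' \<subseteq> K" for K'
  proof -
    have "finite K'" using that fin finite_subset by auto
    then show ?thesis using that
    proof (induction K' rule: finite_induct)
      case empty
      then show ?case using Z0 by simp
    next
      case (insert h K')
      have h: "h \<in> K - K'" "K' \<subseteq> K" using insert by auto
      let ?p = "P lam A (H0 \<union> K') (\<lambda>U. h \<subseteq> U \<union> A)"
      have eq: "Z lam A (H0 \<union> insert h K') = Z lam A (H0 \<union> K') * (1 - z * ?p)"
        using Z_insert_H[of "H0 \<union> K'" h lam A] insert fin disj pos[OF h(2)] h by auto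
      have p: "a h \<le> ?p" "?p \<le> b h" using lo[OF h(2,1)] hi[OF h(2,1)] by auto
      have p01: "0 \<le> ?p" "?p \<le> 1" using gprob_nonneg[OF l] gprob_le_1[OF l] by auto
      have bnd: "1 - z * b h \<le> 1 - z * ?p" "1 - z * ?p \<le> 1 - z * a h" "0 \<le> 1 - z * b h"
        using p z01 ab[of h] h mult_mono[of z 1 "b h" 1] by (auto intro: mult_left_mono)
      have IH: "(\<Prod>h\<in>K'. 1 - z * b h) \<le> Z lam A (H0 \<union> K') / Z lam A H0"
         "Z lam A (H0 \<union> K') / Z lam A H0 \<le> (\<Prod>h\<in>K'. 1 - z * a h)"
        using insert by auto
      have nn: "0 \<le> Z lam A (H0 \<union> K') / Z lam A H0" using pos[OF h(2)] Z0 by simp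
      have "(1 - z * b h) * (\<Prod>h\<in>K'. 1 - z * b h) \<le> (1 - z * ?p) * (Z lam A (H0 \<union> K') / Z lam A H0)"
        by (rule mult_mono'[OF bnd(1) IH(1) bnd(3)])
           (intro prod_nonneg, use insert.prems ab z01 mult_mono[of z 1 "b _" 1] in force)
      moreover have "(1 - z * ?p) * (Z lam A (H0 \<union> K') / Z lam A H0) \<le> (1 - z * a h) * (\<Prod>h\<in>K'. 1 - z * a h)"
        by (rule mult_mono'[OF bnd(2) IH(2) _ nn]) (use bnd in linarith)
      ultimately show ?case using insert eq by (simp add: mult.commute)
    qed
  qed
  then show "(\<Prod>h\<in>K. 1 - z * b h) \<le> Z lam A (H0 \<union> K) / Z lam A H0"
    and "Z lam A (H0 \<union> K) / Z lam A H0 \<le> (\<Prod>h\<in>K. 1 - z * a h)" by auto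
qed

end

section \<open>The recursion for marginals in linear 3-uniform hypergraphs\<close>

text \<open>The vertices will be the edges of the complete graph and the hyperedges its triangles,
  with \<open>m = n - 2\<close>. Linearity, that is \<open>tri_lin\<close>, is what limits the side
  effects of conditioning.\<close>

locale linear_gibbs = gibbs +
  fixes Tri :: "'a set set" and m :: nat
  assumes tri_sub: "h \<in> Tri \<Longrightarrow> h \<subseteq> E"
    and tri_card: "h \<in> Tri \<Longrightarrow> card h = 3"
    and tri_lin: "h \<in> Tri \<Longrightarrow> h' \<in> Tri \<Longrightarrow> x \<noteq> y \<Longrightarrow> {x, y} \<subseteq> h \<Longrightarrow> {x, y} \<subseteq> h' \<Longrightarrow> h = h'"
    and tri_deg: "e \<in> E \<Longrightarrow> card {h \<in> Tri. e \<in> h} = m"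
begin

lemma finite_Tri: "finite Tri"
  using finite_subset[of Tri "Pow E"] tri_sub finite_E by auto

text \<open>
  The class of conditioned models met in the recursion: the vertices in A have been conditioned to be
  present, and D contains them together with all vertices whose activity or surrounding hyperedges
  may be atypical.  The last condition puts into D the vertices x that carry a direct penalty
  because the rest of some hyperedge through x is already present.
\<close>

definition adm :: "real \<Rightarrow> real \<Rightarrow> nat \<Rightarrow> ('a \<Rightarrow> real) \<Rightarrow> 'a set \<Rightarrow> 'a set set \<Rightarrow> 'a set \<Rightarrow> bool" where
  "adm l u k lam A H D \<longleftrightarrow> A \<subseteq> D \<and> D \<subseteq> E \<and> card D \<le> k \<and> H \<subseteq> Tri \<and>
     (\<forall>v\<in>E. 0 \<le> lam v \<and> lam v \<le> u) \<and> (\<forall>v\<in>E - D. l \<le> lam v) \<and>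
     (\<forall>v\<in>E - D. card {h \<in> Tri - H. v \<in> h} \<le> k) \<and>
     (\<forall>h\<in>H. \<not> h \<subseteq> A) \<and> (\<forall>h\<in>H. \<forall>x\<in>h. h \<subseteq> insert x A \<longrightarrow> x \<in> D)"

text \<open>The exceptional set after conditioning on \<open>e\<close>: it absorbs every
  \<open>x\<close> that would now carry a direct penalty, which restores the last condition of
  \<open>adm\<close>.\<close>

definition forced :: "'a \<Rightarrow> 'a set \<Rightarrow> 'a set set \<Rightarrow> 'a set \<Rightarrow> 'a set" where
  "forced e A H D = insert e (D \<union> {x. \<exists>h\<in>H. x \<in> h \<and> h \<subseteq> insert x (insert e A)})"

lemma adm_mono: "adm l u k lam A H D \<Longrightarrow> k \<le> k' \<Longrightarrow> adm l u k' lam A H D"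
  unfolding adm_def by (meson le_trans)

lemma card_tri_pair:
  assumes "x \<noteq> y"
  shows "card {h \<in> Tri. x \<in> h \<and> y \<in> h} \<le> 1"
proof (rule card_le_Suc0_iff_eq[THEN iffD2, simplified One_nat_def[symmetric]])
  show "finite {h \<in> Tri. x \<in> h \<and> y \<in> h}" using finite_Tri by auto
  show "\<forall>h\<in>{h \<in> Tri. x \<in> h \<and> y \<in> h}. \<forall>h'\<in>{h \<in> Tri. x \<in> h \<and> y \<in> h}. h = h'"
    using tri_lin[OF _ _ assms] by auto
qed

text \<open>By linearity each element of \<open>D\<close> lies in at most one of the hyperedges
  through \<open>e\<close>, so the exceptional set spoils at most as many of them as it has
  elements.\<close>

lemma card_tri_meeting:
  assumes "finite D" "e \<notin> D"
  shows "card {h \<in> Tri. e \<in> h \<and> h \<inter> D \<noteq> {}} \<le> card D"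
proof -
  have "{h \<in> Tri. e \<in> h \<and> h \<inter> D \<noteq> {}} = (\<Union>d\<in>D. {h \<in> Tri. e \<in> h \<and> d \<in> h})" by auto
  then have "card {h \<in> Tri. e \<in> h \<and> h \<inter> D \<noteq> {}} \<le> (\<Sum>d\<in>D. card {h \<in> Tri. e \<in> h \<and> d \<in> h})"
    using card_UN_le[OF assms(1)] by simp
  also have "\<dots> \<le> (\<Sum>d\<in>D. 1)"
    by (intro sum_mono card_tri_pair) (use assms in auto)
  finally show ?thesis by simp
qed

lemma adm_penalty: "adm l u k lam A H D \<Longrightarrow> h \<in> H \<Longrightarrow> x \<in> h \<Longrightarrow> h \<subseteq> insert x A \<Longrightarrow> x \<in> D"
  unfolding adm_def by blast

text \<open>A newly penalised \<open>x\<close> lies in a hyperedge \<open>{a, e, x}\<close> with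
  \<open>a\<close> in \<open>A\<close>, and by linearity \<open>a\<close> determines
  \<open>x\<close>. So besides \<open>e\<close> at most \<open>card A \<le> k\<close> vertices join
  \<open>D\<close>, and any other vertex loses at most the one hyperedge it shares with
  \<open>e\<close>. The set \<open>H'\<close> is left free because all intermediate stages of the
  telescoping are needed.\<close>

lemma adm_step:
  assumes adm: "adm l u k lam A H D" and e: "e \<in> E - D"
    and H': "H' \<subseteq> H" "{h \<in> H. e \<notin> h} \<subseteq> H'"
  shows "adm l u (2 * k + 1) (lam(e := 0)) (insert e A) H' (forced e A H' D)"
proof -
  note a = adm[unfolded adm_def]
  have finD: "finite D" using a finite_E finite_subset by auto
  have finA: "finite A" "card A \<le> k" using a finD finite_subset card_mono[OF finD, of A] by auto
  have HT: "H' \<subseteq> Tri" using a H' by auto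
  define X where "X = {x. \<exists>h\<in>H'. x \<in> h \<and> h \<subseteq> insert x (insert e A)} - insert e D"
  have F: "forced e A H' D = insert e D \<union> X" unfolding forced_def X_def by auto
  have Xsub: "X \<subseteq> E" using HT tri_sub unfolding X_def by auto
  have "\<exists>a\<in>A. {a, e, x} \<in> Tri \<and> a \<noteq> e \<and> x \<noteq> e \<and> a \<noteq> x" if xX: "x \<in> X" for x
  proof -
    obtain h where h: "h \<in> H'" "x \<in> h" "h \<subseteq> insert x (insert e A)" "x \<noteq> e" "x \<notin> D"
      using xX unfolding X_def by blast
    have hc: "card h = 3" "h \<in> Tri" using h HT tri_card by auto
    have "e \<in> h"
    proof (rule ccontr)
      assume "e \<notin> h"
      then have "h \<subseteq> insert x A" using h by blast
      then show False using adm_penalty[OF adm, of h x] h H' by blast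
    qed
    have "card (h - {x, e}) = 1" using hc h \<open>e \<in> h\<close> by (simp add: card_Diff_subset)
    then obtain b where b: "h - {x, e} = {b}" by (auto simp: card_1_singleton_iff)
    then have "h = {b, e, x}" "b \<in> A" "b \<noteq> e" "b \<noteq> x" using h \<open>e \<in> h\<close> by auto
    then show ?thesis using hc h by auto
  qed
  then obtain \<phi> where \<phi>: "\<And>x. x \<in> X \<Longrightarrow> \<phi> x \<in> A \<and> {\<phi> x, e, x} \<in> Tri \<and> \<phi> x \<noteq> e \<and> x \<noteq> e \<and> \<phi> x \<noteq> x"
    by metis
  have "inj_on \<phi> X"
  proof (rule inj_onI)
    fix x y assume xy: "x \<in> X" "y \<in> X" "\<phi> x = \<phi> y"
    have "{\<phi> x, e, x} = {\<phi> y, e, y}"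
      by (rule tri_lin[of _ _ "\<phi> x" e])
        (use \<phi>[OF xy(1)] \<phi>[OF xy(2)] xy(3) in \<open>simp_all add: insert_commute\<close>)
    then have "x = \<phi> y \<or> x = e \<or> x = y" by blast
    then show "x = y" using \<phi>[OF xy(1)] xy(3) by metis
  qed
  then have cX: "card X \<le> k"
    using card_inj_on_le[of \<phi> X A] \<phi> finA by force
  have "card (insert e D \<union> X) \<le> card (insert e D) + card X" by (rule card_Un_le)
  also have "card (insert e D) \<le> k + 1" using a finD by (simp add: card_insert_if)
  finally have c1: "card (forced e A H' D) \<le> 2 * k + 1" using cX F by simp
  have c2: "card {h \<in> Tri - H'. v \<in> h} \<le> 2 * k + 1" if v: "v \<in> E - forced e A H' D" for v
  proof -
    have ve: "e \<noteq> v" "v \<in> E - D" using v unfolding forced_def by auto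
    have "{h \<in> Tri - H'. v \<in> h} \<subseteq> {h \<in> Tri - H. v \<in> h} \<union> {h \<in> Tri. e \<in> h \<and> v \<in> h}"
      using H' by auto
    then have "card {h \<in> Tri - H'. v \<in> h} \<le> card ({h \<in> Tri - H. v \<in> h} \<union> {h \<in> Tri. e \<in> h \<and> v \<in> h})"
      by (rule card_mono[rotated]) (use finite_Tri in auto)
    also have "\<dots> \<le> card {h \<in> Tri - H. v \<in> h} + card {h \<in> Tri. e \<in> h \<and> v \<in> h}"
      by (rule card_Un_le)
    also have "\<dots> \<le> k + 1" by (rule add_mono) (use a ve card_tri_pair in auto)
    finally show ?thesis by simp
  qed
  have c3: "\<not> h \<subseteq> insert e A" if "h \<in> H'" for h
  proof
    assume hA: "h \<subseteq> insert e A"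
    have hH: "h \<in> H" using that H' by blast
    show False
    proof (cases "e \<in> h")
      case True
      then show False using adm_penalty[OF adm hH True hA] e by blast
    next
      case False
      then have "h \<subseteq> A" using hA by blast
      moreover have "\<forall>h\<in>H. \<not> h \<subseteq> A" using a by blast
      ultimately show False using hH by blast
    qed
  qed
  show ?thesis unfolding adm_def
  proof (intro conjI ballI impI)
    show "insert e A \<subseteq> forced e A H' D" using a unfolding forced_def by auto
    show "forced e A H' D \<subseteq> E" using F Xsub e a by auto
    show "card (forced e A H' D) \<le> 2 * k + 1" by (rule c1)
    show "H' \<subseteq> Tri" by (rule HT)
  next
    fix v assume "v \<in> E"
    then show "0 \<le> (lam(e := 0)) v" "(lam(e := 0)) v \<le> u" using a by (auto intro: order_trans)
  next
    fix v assume "v \<in> E - forced e A H' D"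
    then show "l \<le> (lam(e := 0)) v" using a unfolding forced_def by auto
  next
    fix h assume "h \<in> H'" then show "\<not> h \<subseteq> insert e A" by (rule c3)
  next
    fix h x assume "h \<in> H'" "x \<in> h" "h \<subseteq> insert x (insert e A)"
    then show "x \<in> forced e A H' D" unfolding forced_def by auto
  qed (rule c2)
qed

lemma adm_Z_pos: "adm l u k lam A H D \<Longrightarrow> 0 < Z lam A H"
  using Z_ge_1[of lam H A] unfolding adm_def by fastforce

lemma adm_nonneg: "adm l u k lam A H D \<Longrightarrow> v \<in> E \<Longrightarrow> 0 \<le> lam v"
  unfolding adm_def by auto

text \<open>The probability is the marginal of \<open>f\<close> after conditioning on
  \<open>e\<close>, times that of \<open>g\<close> after conditioning on \<open>e\<close> and
  \<open>f\<close>. Neither vertex is exceptional at its stage: a hyperedge newly responsible for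
  that would contain two of \<open>e\<close>, \<open>f\<close>, \<open>g\<close>, hence be
  \<open>{e, f, g}\<close> by linearity, which is not in \<open>H'\<close>. The two conditionings
  account for 2 (2k + 1) + 1 = 4k + 3.\<close>

lemma gprob_good_pair:
  assumes adm: "adm l u k lam A H D" and e: "e \<in> E - D"
    and H': "H' \<subseteq> H" "{h \<in> H. e \<notin> h} \<subseteq> H'"
    and h: "{e, f, g} \<in> Tri" "{e, f, g} \<notin> H'" "f \<notin> D" "g \<notin> D" "e \<noteq> f" "e \<noteq> g" "f \<noteq> g"
    and bd: "\<And>lam A H D x. adm l u (4 * k + 3) lam A H D \<Longrightarrow> x \<in> E - D \<Longrightarrow> a \<le> marg lam A H x \<and> marg lam A H x \<le> b"
    and ab: "0 \<le> a" "0 \<le> b"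
  shows "a\<^sup>2 \<le> P (lam(e := 0)) (insert e A) H' (\<lambda>U. f \<in> U \<and> g \<in> U)"
    and "P (lam(e := 0)) (insert e A) H' (\<lambda>U. f \<in> U \<and> g \<in> U) \<le> b\<^sup>2"
proof -
  note ad = adm[unfolded adm_def]
  have fE: "f \<in> E" "g \<in> E" using tri_sub h by auto
  have HT: "H' \<subseteq> Tri" using H' ad by auto
  have fA: "f \<notin> A" "g \<notin> A" using ad h by auto
  note s1 = adm_step[OF adm e H']
  have f1: "f \<notin> forced e A H' D"
  proof
    assume "f \<in> forced e A H' D"
    then obtain h' where h': "h' \<in> H'" "f \<in> h'" "h' \<subseteq> insert f (insert e A)"
      using h unfolding forced_def by auto
    have "e \<in> h'"
    proof (rule ccontr)
      assume "e \<notin> h'"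
      then have "h' \<subseteq> insert f A" using h' by blast
      then show False using adm_penalty[OF adm, of h' f] h' H' h by blast
    qed
    then have "h' = {e, f, g}" by (intro tri_lin[of _ _ e f]) (use h h' HT in auto)
    then show False using h' h by simp
  qed
  have g1: "g \<notin> forced e A H' D"
  proof
    assume "g \<in> forced e A H' D"
    then obtain h' where h': "h' \<in> H'" "g \<in> h'" "h' \<subseteq> insert g (insert e A)"
      using h unfolding forced_def by auto
    have "e \<in> h'"
    proof (rule ccontr)
      assume "e \<notin> h'"
      then have "h' \<subseteq> insert g A" using h' by blast
      then show False using adm_penalty[OF adm, of h' g] h' H' h by blast
    qed
    then have "h' = {e, f, g}" by (intro tri_lin[of _ _ e g]) (use h h' HT in auto)
    then show False using h' h by simp
  qed
  have s2: "adm l u (4 * k + 3) ((lam(e := 0))(f := 0)) (insert f (insert e A)) H'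
      (forced f (insert e A) H' (forced e A H' D))"
    using adm_step[OF s1, of f H'] f1 fE by (simp add: algebra_simps numeral_eq_Suc)
  have g2: "g \<notin> forced f (insert e A) H' (forced e A H' D)"
  proof
    assume "g \<in> forced f (insert e A) H' (forced e A H' D)"
    then obtain h' where h': "h' \<in> H'" "g \<in> h'" "h' \<subseteq> insert g (insert f (insert e A))"
      using h g1 unfolding forced_def[of f] by auto
    have "f \<in> h'"
    proof (rule ccontr)
      assume "f \<notin> h'"
      then have "h' \<subseteq> insert g (insert e A)" using h' by auto
      then show False using g1 h' unfolding forced_def by auto
    qed
    then have "h' = {e, f, g}" by (intro tri_lin[of _ _ f g]) (use h h' HT in auto)
    then show False using h' h by simp
  qed
  have s1': "adm l u (4 * k + 3) (lam(e := 0)) (insert e A) H' (forced e A H' D)"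
    by (rule adm_mono[OF s1]) simp
  have b1: "a \<le> marg (lam(e := 0)) (insert e A) H' f" "marg (lam(e := 0)) (insert e A) H' f \<le> b"
    using bd[OF s1', of f] f1 fE by auto
  have b2: "a \<le> marg ((lam(e := 0))(f := 0)) (insert f (insert e A)) H' g"
     "marg ((lam(e := 0))(f := 0)) (insert f (insert e A)) H' g \<le> b"
    using bd[OF s2, of g] g2 fE by auto
  have eq: "P (lam(e := 0)) (insert e A) H' (\<lambda>U. f \<in> U \<and> g \<in> U)
    = marg (lam(e := 0)) (insert e A) H' f * marg ((lam(e := 0))(f := 0)) (insert f (insert e A)) H' g"
    by (rule gprob_pair[OF fE(1) _ h(7)[symmetric] adm_Z_pos[OF s2]]) (use h fA in auto)
  show "a\<^sup>2 \<le> P (lam(e := 0)) (insert e A) H' (\<lambda>U. f \<in> U \<and> g \<in> U)"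
    unfolding eq power2_eq_square using b1 b2 ab by (intro mult_mono) auto
  show "P (lam(e := 0)) (insert e A) H' (\<lambda>U. f \<in> U \<and> g \<in> U) \<le> b\<^sup>2"
    unfolding eq power2_eq_square using b1 b2 ab by (intro mult_mono) auto
qed

lemma tri_cases:
  assumes "h \<in> Tri" "e \<in> h"
  obtains f g where "h = {e, f, g}" "e \<noteq> f" "e \<noteq> g" "f \<noteq> g"
proof -
  have "card (h - {e}) = 2" using assms tri_card by (simp add: card_Diff_subset)
  then obtain f g where "h - {e} = {f, g}" "f \<noteq> g" by (auto simp: card_2_iff)
  then show thesis using that[of f g] assms by auto
qed

text \<open>One round of the recursion. Of the \<open>m\<close> hyperedges through \<open>e\<close>,
  at most k are missing from \<open>H\<close> and at most k meet \<open>D\<close>; each of the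
  others contributes a factor between 1 - z b^2 and 1 - z a^2. For those meeting \<open>D\<close>
  the trivial probability bounds 0 and \<open>u\<close> are used.\<close>

lemma marg_recursion:
  assumes adm: "adm l u k lam A H D" and e: "e \<in> E - D"
    and l: "0 \<le> l" and u: "0 \<le> u" "u \<le> 1" and ab: "0 \<le> a" "a \<le> 1" "0 \<le> b" "b \<le> 1"
    and bd: "\<And>lam A H D x. adm l u (4 * k + 3) lam A H D \<Longrightarrow> x \<in> E - D \<Longrightarrow> a \<le> marg lam A H x \<and> marg lam A H x \<le> b"
  shows "marg lam A H e \<le> u * (1 - z * a\<^sup>2) ^ (m - 2 * k)"
    and "l * (1 - u) * ((1 - z * b\<^sup>2) ^ m * (1 - z * u) ^ k) \<le> marg lam A H e"
proof -
  note ad = adm[unfolded adm_def]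
  have finH: "finite H" using ad finite_Tri finite_subset by auto
  have finD: "finite D" "card D \<le> k" using ad finite_E finite_subset by auto
  have eA: "e \<notin> A" using ad e by auto
  define lam' where "lam' = lam(e := 0)"
  define A' where "A' = insert e A"
  define H0 where "H0 = {h \<in> H. e \<notin> h}"
  define K where "K = {h \<in> H. e \<in> h}"
  define G where "G = {h \<in> K. h \<inter> D = {}}"
  have HK: "H = H0 \<union> K" "H0 \<inter> K = {}" "finite H0" "finite K" "G \<subseteq> K" "finite G"
    using finH unfolding H0_def K_def G_def by auto
  have l0: "\<And>v. v \<in> E \<Longrightarrow> 0 \<le> lam' v" using ad unfolding lam'_def by auto
  have st: "adm l u (2 * k + 1) lam' A' (H0 \<union> K') (forced e A (H0 \<union> K') D)" if "K' \<subseteq> K" for K'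
    unfolding lam'_def A'_def by (rule adm_step[OF adm e]) (use that HK H0_def in auto)
  have pos: "Z lam' A' (H0 \<union> K') > 0" if "K' \<subseteq> K" for K'
    using adm_Z_pos[OF st[OF that]] .
  have good: "a\<^sup>2 \<le> P lam' A' (H0 \<union> K') (\<lambda>U. h \<subseteq> U \<union> A') \<and> P lam' A' (H0 \<union> K') (\<lambda>U. h \<subseteq> U \<union> A') \<le> b\<^sup>2"
    if K': "K' \<subseteq> K" and h: "h \<in> G - K'" for K' h
  proof -
    have hT: "h \<in> Tri" "e \<in> h" "h \<inter> D = {}" "h \<notin> H0" using h HK ad unfolding G_def K_def by auto
    obtain f g where fg: "h = {e, f, g}" "e \<noteq> f" "e \<noteq> g" "f \<noteq> g" using tri_cases[OF hT(1,2)] .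
    have "f \<notin> A" "g \<notin> A" using hT fg ad by auto
    then have eq: "(\<lambda>U. h \<subseteq> U \<union> A') = (\<lambda>U. f \<in> U \<and> g \<in> U)"
      unfolding fg(1) A'_def using fg by auto
    have s: "H0 \<union> K' \<subseteq> H" "{h \<in> H. e \<notin> h} \<subseteq> H0 \<union> K'" using K' HK H0_def by auto
    have i: "{e, f, g} \<in> Tri" "{e, f, g} \<notin> H0 \<union> K'" "f \<notin> D" "g \<notin> D" using hT h fg by auto
    have "a\<^sup>2 \<le> P lam' A' (H0 \<union> K') (\<lambda>U. f \<in> U \<and> g \<in> U)"
      unfolding lam'_def A'_def
      by (rule gprob_good_pair(1)[OF adm e s i fg(2-4) _ ab(1,3)]) (erule (1) bd)
    moreover have "P lam' A' (H0 \<union> K') (\<lambda>U. f \<in> U \<and> g \<in> U) \<le> b\<^sup>2"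
      unfolding lam'_def A'_def
      by (rule gprob_good_pair(2)[OF adm e s i fg(2-4) _ ab(1,3)]) (erule (1) bd)
    ultimately show ?thesis unfolding eq by simp
  qed
  have bad: "P lam' A' (H0 \<union> K') (\<lambda>U. h \<subseteq> U \<union> A') \<le> u"
    if K': "K' \<subseteq> K" and h: "h \<in> K - K'" for K' h
  proof -
    have hH: "h \<in> H" "e \<in> h" "h \<subseteq> E" using h tri_sub ad unfolding K_def by auto
    \<comment> \<open>Otherwise \<open>e\<close> itself would be in \<open>D\<close> by the last
      condition of \<open>adm\<close>. So some vertex of \<open>h\<close> is still random, and its
      activity bounds the probability.\<close>
    have "\<not> h \<subseteq> insert e A" using ad hH e by blast
    then obtain x where x: "x \<in> h" "x \<notin> A'" unfolding A'_def by auto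
    have "P lam' A' (H0 \<union> K') (\<lambda>U. h \<subseteq> U \<union> A') \<le> marg lam' A' (H0 \<union> K') x"
      by (rule gprob_mono[OF l0]) (use x in auto)
    also have "\<dots> \<le> lam' x" by (rule marg_le[OF l0]) (use x hH HK K' finite_subset in auto)
    also have "\<dots> \<le> u" using ad x hH u unfolding lam'_def by auto
    finally show ?thesis .
  qed
  define aa where "aa h = (if h \<in> G then a\<^sup>2 else 0)" for h
  define bb where "bb h = (if h \<in> G then b\<^sup>2 else u)" for h
  have a2: "a\<^sup>2 \<le> 1" "b\<^sup>2 \<le> 1" using ab by (auto simp: power_le_one)
  define \<rho> where "\<rho> = Z lam' A' H / Z lam' A' H0"
  have nn: "0 \<le> P lam' A' H' Q" for H' Q by (rule gprob_nonneg[OF l0])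
  have lo: "aa h \<le> P lam' A' (H0 \<union> K') (\<lambda>U. h \<subseteq> U \<union> A')" if "K' \<subseteq> K" "h \<in> K - K'" for K' h
    using good[OF that(1), of h] that nn unfolding aa_def by auto
  have hi: "P lam' A' (H0 \<union> K') (\<lambda>U. h \<subseteq> U \<union> A') \<le> bb h" if "K' \<subseteq> K" "h \<in> K - K'" for K' h
    using good[OF that(1), of h] bad[OF that] that unfolding bb_def by auto
  have aabb: "aa h \<le> 1 \<and> 0 \<le> bb h \<and> bb h \<le> 1" for h
    using a2 u unfolding aa_def bb_def by auto
  have r: "(\<Prod>h\<in>K. 1 - z * bb h) \<le> \<rho>" "\<rho> \<le> (\<Prod>h\<in>K. 1 - z * aa h)"
    using Z_telescope[OF l0 HK(3,4,2) pos lo hi aabb] unfolding \<rho>_def HK(1)[symmetric] by auto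
  have spl: "(\<Prod>h\<in>K. F h) = (\<Prod>h\<in>G. F h) * (\<Prod>h\<in>K - G. F h)" for F :: "'a set \<Rightarrow> real"
    using prod.subset_diff[of G K F] HK by (simp add: mult.commute)
  have pa: "(\<Prod>h\<in>K. 1 - z * aa h) = (1 - z * a\<^sup>2) ^ card G"
    unfolding spl aa_def by simp
  have pb: "(\<Prod>h\<in>K. 1 - z * bb h) = (1 - z * b\<^sup>2) ^ card G * (1 - z * u) ^ card (K - G)"
    unfolding spl bb_def by simp
  have "card K \<le> card {h \<in> Tri. e \<in> h}"
    by (rule card_mono) (use ad finite_Tri K_def in auto)
  then have cK: "card K \<le> m" using tri_deg[of e] e by simp
  then have cG: "card G \<le> m" using card_mono[OF HK(4,5)] by simp
  have cB0: "card {h \<in> Tri. e \<in> h \<and> h \<inter> D \<noteq> {}} \<le> k"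
    using card_tri_meeting[OF finD(1), of e] finD e by simp
  have "card (K - G) \<le> card {h \<in> Tri. e \<in> h \<and> h \<inter> D \<noteq> {}}"
    by (rule card_mono) (use ad finite_Tri K_def G_def in auto)
  then have cB: "card (K - G) \<le> k" using cB0 by simp
  have "{h \<in> Tri. e \<in> h} \<subseteq> G \<union> ({h \<in> Tri - H. e \<in> h} \<union> {h \<in> Tri. e \<in> h \<and> h \<inter> D \<noteq> {}})"
    unfolding G_def K_def by auto
  then have "card {h \<in> Tri. e \<in> h} \<le> card (G \<union> ({h \<in> Tri - H. e \<in> h} \<union> {h \<in> Tri. e \<in> h \<and> h \<inter> D \<noteq> {}}))"
    by (rule card_mono[rotated]) (use finite_Tri HK in auto)
  then have "m \<le> card G + (card {h \<in> Tri - H. e \<in> h} + card {h \<in> Tri. e \<in> h \<and> h \<inter> D \<noteq> {}})"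
    using card_Un_le[of G "{h \<in> Tri - H. e \<in> h} \<union> {h \<in> Tri. e \<in> h \<and> h \<inter> D \<noteq> {}}"]
      card_Un_le[of "{h \<in> Tri - H. e \<in> h}" "{h \<in> Tri. e \<in> h \<and> h \<inter> D \<noteq> {}}"] tri_deg[of e] e
    by simp
  moreover have "card {h \<in> Tri - H. e \<in> h} \<le> k" using ad e by blast
  ultimately have cG2: "m - 2 * k \<le> card G" using cB0 by linarith
  have za: "0 \<le> 1 - z * a\<^sup>2" "1 - z * a\<^sup>2 \<le> 1" "0 \<le> 1 - z * b\<^sup>2" "1 - z * b\<^sup>2 \<le> 1" "0 \<le> 1 - z * u" "1 - z * u \<le> 1"
    using z01 a2 u mult_mono[of z 1 "a\<^sup>2" 1] mult_mono[of z 1 "b\<^sup>2" 1] mult_mono[of z 1 u 1] by auto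
  define R where "R = lam e * \<rho>"
  have le: "l \<le> lam e" "lam e \<le> u" "0 \<le> lam e" using ad e by auto
  have \<rho>1: "\<rho> \<le> (1 - z * a\<^sup>2) ^ (m - 2 * k)"
    using r(2) pa power_decreasing[OF cG2 za(1,2)] by simp
  have "(1 - z * b\<^sup>2) ^ m * (1 - z * u) ^ k \<le> (1 - z * b\<^sup>2) ^ card G * (1 - z * u) ^ card (K - G)"
    by (intro mult_mono power_decreasing cG cB za) (use za in auto)
  then have \<rho>2: "(1 - z * b\<^sup>2) ^ m * (1 - z * u) ^ k \<le> \<rho>"
    using r(1) pb by simp
  have \<rho>0: "0 \<le> \<rho>" by (rule order_trans[OF _ \<rho>2]) (use za in auto)
  have \<rho>1': "\<rho> \<le> 1" using \<rho>1 power_le_one[OF za(1,2), of "m - 2 * k"] by simp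
  have mg: "marg lam A H e = R / (1 + R)"
    unfolding R_def \<rho>_def lam'_def A'_def H0_def
    by (rule marg_ratio[OF adm_nonneg[OF adm] _ eA _ refl])
       (use e pos[of "{}"] in \<open>auto simp: lam'_def A'_def H0_def\<close>)
  have R0: "0 \<le> R" "R \<le> u"
    unfolding R_def using le \<rho>0 \<rho>1' mult_mono[of "lam e" u \<rho> 1] u by auto
  have "R / (1 + R) \<le> R" using R0 by (simp add: divide_le_eq algebra_simps)
  also have "R \<le> u * (1 - z * a\<^sup>2) ^ (m - 2 * k)"
    unfolding R_def by (rule mult_mono[OF le(2) \<rho>1]) (use u \<rho>0 in auto)
  finally show "marg lam A H e \<le> u * (1 - z * a\<^sup>2) ^ (m - 2 * k)" using mg by simp
  have "l * ((1 - z * b\<^sup>2) ^ m * (1 - z * u) ^ k) \<le> R"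
    unfolding R_def by (rule mult_mono[OF le(1) \<rho>2]) (use le za in auto)
  \<comment> \<open>The factor \<open>1 - u\<close> pays for the passage from odds to probability: R
    / (1 + R) is at least (1 - R) R.\<close>
  then have "(1 - u) * (l * ((1 - z * b\<^sup>2) ^ m * (1 - z * u) ^ k)) \<le> (1 - u) * R"
    using u by (intro mult_left_mono) auto
  also have "(1 - u) * R \<le> (1 - R) * R" using R0 by (intro mult_right_mono) auto
  also have "(1 - R) * R \<le> R / (1 + R)"
  proof -
    have "(1 - R) * R * (1 + R) = R - R * R\<^sup>2" by (simp add: algebra_simps power2_eq_square)
    also have "\<dots> \<le> R" using R0 by simp
    finally show ?thesis using R0 by (simp add: le_divide_eq)
  qed
  finally show "l * (1 - u) * ((1 - z * b\<^sup>2) ^ m * (1 - z * u) ^ k) \<le> marg lam A H e"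
    using mg by (simp add: mult_ac)
qed

lemma marg_trivial:
  assumes "adm l u k lam A H D" "e \<in> E - D"
  shows "0 \<le> marg lam A H e" "marg lam A H e \<le> u"
proof -
  note ad = assms(1)[unfolded adm_def]
  show "0 \<le> marg lam A H e" by (rule gprob_nonneg[OF adm_nonneg[OF assms(1)]])
  have "marg lam A H e \<le> lam e"
    by (rule marg_le[OF adm_nonneg[OF assms(1)]]) (use ad assms(2) finite_Tri finite_subset in auto)
  then show "marg lam A H e \<le> u" using ad assms(2) by fastforce
qed

end

section \<open>Asymptotics of the marginals\<close>

lemma exp_neg_diff_le:
  fixes a b :: real
  assumes "0 \<le> a" "0 \<le> b"
  shows "\<bar>exp (- a) - exp (- b)\<bar> \<le> \<bar>a - b\<bar>"
proof -
  have *: "exp (- a) - exp (- b) \<le> b - a" if "0 \<le> a" "a \<le> b" for a b :: real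
  proof -
    have "exp (- a) - exp (- b) = exp (- a) * (1 - exp (- (b - a)))"
      by (simp add: algebra_simps flip: exp_add)
    also have "\<dots> \<le> 1 * (b - a)"
    proof (rule mult_mono)
      show "1 - exp (- (b - a)) \<le> b - a" using exp_ge_add_one_self[of "- (b - a)"] by linarith
    qed (use that in auto)
    finally show ?thesis by simp
  qed
  show ?thesis using *[of a b] *[of b a] assms by (cases "a \<le> b") auto
qed

text \<open>Alternating lower and upper bounds, starting from the trivial bounds 0 and c.\<close>

primrec marg_bds :: "real \<Rightarrow> real \<Rightarrow> nat \<Rightarrow> real \<times> real" where
  "marg_bds c \<zeta> 0 = (0, c)"
| "marg_bds c \<zeta> (Suc d) =
     (c * exp (- (\<zeta> * (snd (marg_bds c \<zeta> d))\<^sup>2)), c * exp (- (\<zeta> * (fst (marg_bds c \<zeta> d))\<^sup>2)))"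

lemma marg_bds_nonneg: "0 < c \<Longrightarrow> 0 \<le> fst (marg_bds c \<zeta> d) \<and> 0 \<le> snd (marg_bds c \<zeta> d)"
  by (induction d) auto

lemma marg_bds_le: "0 < c \<Longrightarrow> 0 \<le> \<zeta> \<Longrightarrow> fst (marg_bds c \<zeta> d) \<le> c \<and> snd (marg_bds c \<zeta> d) \<le> c"
  by (induction d) (auto simp: mult_le_cancel_left1)

text \<open>The function exp (- t) is 1-Lipschitz for nonnegative t, and x^2 - y^2 = (x + y) (x - y)
  with x + y \<le> 2 c; hence the constant.\<close>

lemma marg_map_contraction:
  fixes c \<zeta> x y :: real
  assumes "0 < c" "0 \<le> \<zeta>" "0 \<le> x" "x \<le> c" "0 \<le> y" "y \<le> c"
  shows "\<bar>c * exp (- (\<zeta> * x\<^sup>2)) - c * exp (- (\<zeta> * y\<^sup>2))\<bar> \<le> 2 * \<zeta> * c\<^sup>2 * \<bar>x - y\<bar>"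
proof -
  have "\<bar>c * exp (- (\<zeta> * x\<^sup>2)) - c * exp (- (\<zeta> * y\<^sup>2))\<bar> = c * \<bar>exp (- (\<zeta> * x\<^sup>2)) - exp (- (\<zeta> * y\<^sup>2))\<bar>"
    using assms by (simp add: abs_mult flip: right_diff_distrib)
  also have "\<dots> \<le> c * \<bar>\<zeta> * x\<^sup>2 - \<zeta> * y\<^sup>2\<bar>"
    using assms by (intro mult_left_mono exp_neg_diff_le) auto
  also have "\<zeta> * x\<^sup>2 - \<zeta> * y\<^sup>2 = \<zeta> * (x + y) * (x - y)" by (simp add: algebra_simps power2_eq_square)
  also have "\<bar>\<zeta> * (x + y) * (x - y)\<bar> = \<zeta> * (x + y) * \<bar>x - y\<bar>" using assms by (simp add: abs_mult)
  also have "\<zeta> * (x + y) * \<bar>x - y\<bar> \<le> \<zeta> * (2 * c) * \<bar>x - y\<bar>"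
    using assms by (intro mult_mono) auto
  finally show ?thesis using assms by (simp add: power2_eq_square mult_ac)
qed

text \<open>The map is decreasing, so each step exchanges the roles of the two bounds; the
  contraction applies to either, and both stay within
  \<open>c * (2 * \<zeta> * c\<^sup>2) ^ d\<close> of the fixed point.\<close>

lemma marg_bds_tendsto:
  fixes c \<zeta> q0 :: real
  assumes c: "0 < c" and z: "0 \<le> \<zeta>" "2 * \<zeta> * c\<^sup>2 < 1" and q: "0 \<le> q0" "q0 = c * exp (- (\<zeta> * q0\<^sup>2))"
  shows "(\<lambda>d. fst (marg_bds c \<zeta> d)) \<longlonglongrightarrow> q0" "(\<lambda>d. snd (marg_bds c \<zeta> d)) \<longlonglongrightarrow> q0"
proof -
  have "c * exp (- (\<zeta> * q0\<^sup>2)) \<le> c * 1" using c z by (intro mult_left_mono) auto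
  then have qc: "q0 \<le> c" using q by simp
  let ?k = "2 * \<zeta> * c\<^sup>2"
  have k: "0 \<le> ?k" using z by simp
  have "\<bar>fst (marg_bds c \<zeta> d) - q0\<bar> \<le> c * ?k ^ d \<and> \<bar>snd (marg_bds c \<zeta> d) - q0\<bar> \<le> c * ?k ^ d" for d
  proof (induction d)
    case 0
    then show ?case using c q qc by auto
  next
    case (Suc d)
    have b: "0 \<le> fst (marg_bds c \<zeta> d)" "0 \<le> snd (marg_bds c \<zeta> d)"
       "fst (marg_bds c \<zeta> d) \<le> c" "snd (marg_bds c \<zeta> d) \<le> c"
      using marg_bds_nonneg[OF c] marg_bds_le[OF c z(1)] by auto
    have "\<bar>c * exp (- (\<zeta> * (fst (marg_bds c \<zeta> d))\<^sup>2)) - c * exp (- (\<zeta> * q0\<^sup>2))\<bar> \<le> ?k * \<bar>fst (marg_bds c \<zeta> d) - q0\<bar>"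
      by (rule marg_map_contraction) (use c z b q qc in auto)
    also have "\<dots> \<le> ?k * (c * ?k ^ d)" using Suc k by (intro mult_left_mono) auto
    finally have 1: "\<bar>c * exp (- (\<zeta> * (fst (marg_bds c \<zeta> d))\<^sup>2)) - q0\<bar> \<le> c * ?k ^ Suc d"
      using q(2) by (simp add: mult_ac)
    have "\<bar>c * exp (- (\<zeta> * (snd (marg_bds c \<zeta> d))\<^sup>2)) - c * exp (- (\<zeta> * q0\<^sup>2))\<bar> \<le> ?k * \<bar>snd (marg_bds c \<zeta> d) - q0\<bar>"
      by (rule marg_map_contraction) (use c z b q qc in auto)
    also have "\<dots> \<le> ?k * (c * ?k ^ d)" using Suc k by (intro mult_left_mono) auto
    finally have 2: "\<bar>c * exp (- (\<zeta> * (snd (marg_bds c \<zeta> d))\<^sup>2)) - q0\<bar> \<le> c * ?k ^ Suc d"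
      using q(2) by (simp add: mult_ac)
    show ?case using 1 2 by simp
  qed
  moreover have lim: "(\<lambda>d. c * ?k ^ d) \<longlonglongrightarrow> 0"
    using tendsto_mult[OF tendsto_const[of c] LIMSEQ_power_zero[of ?k]] k z by simp
  ultimately have lims: "(\<lambda>d. fst (marg_bds c \<zeta> d) - q0) \<longlonglongrightarrow> 0" "(\<lambda>d. snd (marg_bds c \<zeta> d) - q0) \<longlonglongrightarrow> 0"
    by (intro Lim_null_comparison[OF _ lim] always_eventually allI; simp)+
  show "(\<lambda>d. fst (marg_bds c \<zeta> d)) \<longlonglongrightarrow> q0" by (rule LIM_zero_cancel[OF lims(1)])
  show "(\<lambda>d. snd (marg_bds c \<zeta> d)) \<longlonglongrightarrow> q0" by (rule LIM_zero_cancel[OF lims(2)])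
qed

text \<open>A converse of 1 - y \<le> exp (- y), for lower bounds on powers; it comes from 1 / (1 -
  y) = 1 + y / (1 - y) \<le> exp (y / (1 - y)).\<close>

lemma exp_le_one_minus:
  fixes y :: real
  assumes "0 \<le> y" "y < 1"
  shows "exp (- (y / (1 - y))) \<le> 1 - y"
proof -
  have "1 / (1 - y) \<le> exp (y / (1 - y))"
    using exp_ge_add_one_self[of "y / (1 - y)"] assms by (simp add: field_simps)
  then have "1 / exp (y / (1 - y)) \<le> 1 / (1 / (1 - y))"
    using assms by (intro divide_left_mono) auto
  then show ?thesis by (simp add: exp_minus field_simps)
qed

text \<open>With activities of order 1 / sqrt n and pair probabilities of order 1 / n, the product
  of about n factors turns into an exponential. All error terms stay explicit in 1 / n, 1 / sqrt n
  and \<open>\<delta>\<close>, so that their joint limit can be taken afterwards.\<close>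

lemma (in linear_gibbs) marg_recursion_scaled:
  fixes n k :: nat and c \<delta> \<zeta> a b s :: real
  assumes s: "s = sqrt (real n)" and m: "m = n - 2" and n: "n \<ge> 2 + 2 * k"
    and adm: "adm ((c - \<delta>) / s) ((c + \<delta>) / s) k lam A H D" and e: "e \<in> E - D"
    and z: "\<bar>z - \<zeta>\<bar> \<le> \<delta>" and c: "0 \<le> c - \<delta>" "0 \<le> \<delta>" "(c + \<delta>) / s \<le> 1"
    and ab: "0 \<le> a" "a / s \<le> 1" "0 \<le> b" "b / s \<le> 1"
    and small: "(\<zeta> + \<delta>) * b\<^sup>2 / n < 1" "(\<zeta> + \<delta>) * ((c + \<delta>) / s) \<le> 1"
    and bd: "\<And>lam A H D x. adm ((c - \<delta>) / s) ((c + \<delta>) / s) (4 * k + 3) lam A H D \<Longrightarrow> x \<in> E - D \<Longrightarrow>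
        a / s \<le> marg lam A H x \<and> marg lam A H x \<le> b / s"
  shows "s * marg lam A H e \<le> (c + \<delta>) * exp (- ((\<zeta> - \<delta>) * a\<^sup>2 * (1 - (2 + 2 * real k) * (1 / n))))"
    and "(c - \<delta>) * (1 - (c + \<delta>) / s) * (exp (- ((\<zeta> + \<delta>) * b\<^sup>2 / (1 - (\<zeta> + \<delta>) * b\<^sup>2 / n))) *
       (1 - (\<zeta> + \<delta>) * ((c + \<delta>) / s)) ^ k) \<le> s * marg lam A H e"
proof -
  have n0: "0 < real n" using n by simp
  have s0: "0 < s" "s\<^sup>2 = n" using s n0 by auto
  have u0: "0 \<le> (c + \<delta>) / s" using c s0 by simp
  have lu: "0 \<le> (c - \<delta>) / s" "0 \<le> a / s" "0 \<le> b / s" using c s0 ab by auto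
  note rec = marg_recursion[OF adm e lu(1) u0 c(3) lu(2) ab(2) lu(3) ab(4)]
  have r1: "marg lam A H e \<le> (c + \<delta>) / s * (1 - z * (a / s)\<^sup>2) ^ (m - 2 * k)"
    by (rule rec(1)) (erule (1) bd)
  have r2: "(c - \<delta>) / s * (1 - (c + \<delta>) / s) * ((1 - z * (b / s)\<^sup>2) ^ m * (1 - z * ((c + \<delta>) / s)) ^ k) \<le> marg lam A H e"
    by (rule rec(2)) (erule (1) bd)
  have as: "(a / s)\<^sup>2 = a\<^sup>2 / n" "(b / s)\<^sup>2 = b\<^sup>2 / n" using s0 by (auto simp: power_divide)
  have a1: "a\<^sup>2 / n \<le> 1" unfolding as[symmetric] using ab lu by (intro power_le_one) auto
  define N where "N = m - 2 * k"
  have rN: "real N = n - (2 + 2 * real k)" unfolding N_def m using n by (simp add: of_nat_diff)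
  have "0 \<le> 1 - z * (a\<^sup>2 / n)" using a1 z01 mult_mono[of z 1 "a\<^sup>2 / n" 1] by auto
  then have "(1 - z * (a\<^sup>2 / n)) ^ N \<le> exp (- (z * (a\<^sup>2 / n))) ^ N"
    using exp_ge_add_one_self[of "- (z * (a\<^sup>2 / n))"] by (intro power_mono) auto
  also have "\<dots> = exp (- (z * a\<^sup>2 * (1 - (2 + 2 * real k) * (1 / n))))"
    unfolding exp_of_nat_mult[symmetric] rN using n0 by (simp add: field_simps)
  also have "\<dots> \<le> exp (- ((\<zeta> - \<delta>) * a\<^sup>2 * (1 - (2 + 2 * real k) * (1 / n))))"
  proof -
    have "real (2 + 2 * k) \<le> real n" using n by (rule of_nat_mono)
    then have "(2 + 2 * real k) * (1 / n) \<le> 1" using n0 by simp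
    then have "(\<zeta> - \<delta>) * (a\<^sup>2 * (1 - (2 + 2 * real k) * (1 / n))) \<le> z * (a\<^sup>2 * (1 - (2 + 2 * real k) * (1 / n)))"
      using z by (intro mult_right_mono) auto
    then show ?thesis by (simp add: mult.assoc)
  qed
  finally have p: "(1 - z * (a / s)\<^sup>2) ^ (m - 2 * k) \<le> exp (- ((\<zeta> - \<delta>) * a\<^sup>2 * (1 - (2 + 2 * real k) * (1 / n))))"
    unfolding as N_def .
  have "s * marg lam A H e \<le> s * ((c + \<delta>) / s * exp (- ((\<zeta> - \<delta>) * a\<^sup>2 * (1 - (2 + 2 * real k) * (1 / n)))))"
    using s0 order_trans[OF r1 mult_left_mono[OF p u0]] by (intro mult_left_mono) auto
  then show "s * marg lam A H e \<le> (c + \<delta>) * exp (- ((\<zeta> - \<delta>) * a\<^sup>2 * (1 - (2 + 2 * real k) * (1 / n))))"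
    using s0 by simp
  define y where "y = (\<zeta> + \<delta>) * b\<^sup>2 / n"
  have zz: "z \<le> \<zeta> + \<delta>" using z by auto
  then have zp: "0 \<le> \<zeta> + \<delta>" using z01 by linarith
  have y: "0 \<le> y" "y < 1" unfolding y_def using zp small by auto
  have zy: "z * (b / s)\<^sup>2 \<le> y" unfolding as y_def
    using zz mult_right_mono[of z "\<zeta> + \<delta>" "b\<^sup>2 / n"] by simp
  have "exp (- ((\<zeta> + \<delta>) * b\<^sup>2 / (1 - (\<zeta> + \<delta>) * b\<^sup>2 / n))) = exp (- (y / (1 - y))) ^ n"
    unfolding exp_of_nat_mult[symmetric] y_def[symmetric] using n0 by (simp add: y_def)
  also have "\<dots> \<le> (1 - y) ^ n"
    using exp_le_one_minus[OF y] by (intro power_mono) auto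
  also have "\<dots> \<le> (1 - y) ^ m" using y m by (intro power_decreasing) auto
  also have "\<dots> \<le> (1 - z * (b / s)\<^sup>2) ^ m" using zy y by (intro power_mono) auto
  finally have p1: "exp (- ((\<zeta> + \<delta>) * b\<^sup>2 / (1 - (\<zeta> + \<delta>) * b\<^sup>2 / n))) \<le> (1 - z * (b / s)\<^sup>2) ^ m" .
  have p2: "(1 - (\<zeta> + \<delta>) * ((c + \<delta>) / s)) ^ k \<le> (1 - z * ((c + \<delta>) / s)) ^ k"
    using small mult_right_mono[OF zz u0] by (intro power_mono) auto
  have "exp (- ((\<zeta> + \<delta>) * b\<^sup>2 / (1 - (\<zeta> + \<delta>) * b\<^sup>2 / n))) * (1 - (\<zeta> + \<delta>) * ((c + \<delta>) / s)) ^ k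
    \<le> (1 - z * (b / s)\<^sup>2) ^ m * (1 - z * ((c + \<delta>) / s)) ^ k"
    by (rule mult_mono[OF p1 p2]) (use zy y small in auto)
  then have "(c - \<delta>) / s * (1 - (c + \<delta>) / s) * (exp (- ((\<zeta> + \<delta>) * b\<^sup>2 / (1 - (\<zeta> + \<delta>) * b\<^sup>2 / n))) * (1 - (\<zeta> + \<delta>) * ((c + \<delta>) / s)) ^ k)
    \<le> (c - \<delta>) / s * (1 - (c + \<delta>) / s) * ((1 - z * (b / s)\<^sup>2) ^ m * (1 - z * ((c + \<delta>) / s)) ^ k)"
    using lu c by (intro mult_left_mono mult_nonneg_nonneg) auto
  with r2 have "s * ((c - \<delta>) / s * (1 - (c + \<delta>) / s) * (exp (- ((\<zeta> + \<delta>) * b\<^sup>2 / (1 - (\<zeta> + \<delta>) * b\<^sup>2 / n))) * (1 - (\<zeta> + \<delta>) * ((c + \<delta>) / s)) ^ k))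
     \<le> s * marg lam A H e" using s0 by (intro mult_left_mono) auto
  then show "(c - \<delta>) * (1 - (c + \<delta>) / s) * (exp (- ((\<zeta> + \<delta>) * b\<^sup>2 / (1 - (\<zeta> + \<delta>) * b\<^sup>2 / n))) *
       (1 - (\<zeta> + \<delta>) * ((c + \<delta>) / s)) ^ k) \<le> s * marg lam A H e"
    using s0 by (simp add: mult.assoc)
qed

text \<open>The second component is the size \<delta> of the perturbation of penalty and activities.
  In a product filter the ranges of n and \<delta> are chosen independently, so one fixed \<delta>
  serves all large n; the tilts by a fixed amount depend on this.\<close>

abbreviation nd_filter :: "(nat \<times> real) filter" where
  "nd_filter \<equiv> sequentially \<times>\<^sub>F at_right 0"

text \<open>Uniformity over all models with at most k exceptional vertices is essential, since the
  recursion for one model leads to many others.\<close>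

definition marg_within :: "real \<Rightarrow> real \<Rightarrow> nat \<Rightarrow> nat \<Rightarrow> real \<Rightarrow> real \<Rightarrow> real \<Rightarrow> bool" where
  "marg_within c \<zeta> k n \<delta> lo hi \<longleftrightarrow>
     (\<forall>(E :: nat set set) z Tri lam A H D e.
        linear_gibbs E z Tri (n - 2) \<longrightarrow> \<bar>z - \<zeta>\<bar> \<le> \<delta> \<longrightarrow>
        linear_gibbs.adm E Tri ((c - \<delta>) / sqrt n) ((c + \<delta>) / sqrt n) k lam A H D \<longrightarrow> e \<in> E - D \<longrightarrow>
        lo \<le> sqrt n * gprob E z lam A H (\<lambda>U. e \<in> U) \<and> sqrt n * gprob E z lam A H (\<lambda>U. e \<in> U) \<le> hi)"

lemma marg_within_mono:
  assumes "marg_within c \<zeta> k n \<delta> lo hi" "lo' \<le> lo" "hi \<le> hi'"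
  shows "marg_within c \<zeta> k n \<delta> lo' hi'"
  unfolding marg_within_def
proof (intro allI impI)
  fix E :: "nat set set" and z Tri lam A H D e
  assume a: "linear_gibbs E z Tri (n - 2)" "\<bar>z - \<zeta>\<bar> \<le> \<delta>"
    "linear_gibbs.adm E Tri ((c - \<delta>) / sqrt n) ((c + \<delta>) / sqrt n) k lam A H D" "e \<in> E - D"
  show "lo' \<le> sqrt n * gprob E z lam A H (\<lambda>U. e \<in> U) \<and> sqrt n * gprob E z lam A H (\<lambda>U. e \<in> U) \<le> hi'"
    using assms(1)[unfolded marg_within_def, rule_format, OF a] assms(2,3) by auto
qed

lemma
  shows nd_snd: "(snd \<longlongrightarrow> 0) nd_filter"
    and nd_inv: "((\<lambda>x. 1 / real (fst x)) \<longlongrightarrow> 0) nd_filter"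
    and nd_inv_sqrt: "((\<lambda>x. 1 / sqrt (real (fst x))) \<longlongrightarrow> 0) nd_filter"
    and nd_snd_pos: "\<forall>\<^sub>F x in nd_filter. 0 < snd x"
    and nd_fst_ge: "\<forall>\<^sub>F x in nd_filter. N \<le> fst x"
proof -
  have f: "filterlim fst sequentially nd_filter" by (rule filterlim_fst)
  have s: "filterlim snd (at_right 0) nd_filter" by (rule filterlim_snd)
  show "(snd \<longlongrightarrow> 0) nd_filter"
    using s by (rule filterlim_mono) (auto simp: at_within_le_nhds)
  show "((\<lambda>x. 1 / real (fst x)) \<longlongrightarrow> 0) nd_filter"
    by (rule filterlim_compose[OF lim_1_over_n f])
  have "((\<lambda>n. 1 / sqrt (real n)) \<longlongrightarrow> 0) sequentially" by real_asymp
  then show "((\<lambda>x. 1 / sqrt (real (fst x))) \<longlongrightarrow> 0) nd_filter"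
    by (rule filterlim_compose[OF _ f])
  show "\<forall>\<^sub>F x in nd_filter. 0 < snd x"
    using filterlim_iff[THEN iffD1, OF s] eventually_at_right_less by blast
  show "\<forall>\<^sub>F x in nd_filter. N \<le> fst x"
    using filterlim_iff[THEN iffD1, OF f] eventually_ge_at_top by blast
qed

text \<open>Induction on the depth \<open>d\<close> with \<open>k\<close> arbitrary: the bounds of
  depth d + 1 for \<open>k\<close> use those of depth d for 4k + 3.\<close>

lemma marg_within_iter:
  assumes c: "0 < c" and z: "0 \<le> \<zeta>" and "0 < \<epsilon>"
  shows "\<forall>\<^sub>F x in nd_filter. marg_within c \<zeta> k (fst x) (snd x)
     (fst (marg_bds c \<zeta> d) - \<epsilon>) (snd (marg_bds c \<zeta> d) + \<epsilon>)"
  using \<open>0 < \<epsilon>\<close>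
proof (induction d arbitrary: k \<epsilon>)
  case 0
  have "\<forall>\<^sub>F x in nd_filter. snd x < \<epsilon>" using order_tendstoD(2)[OF nd_snd 0] .
  then show ?case
    using nd_fst_ge[of 1] nd_snd_pos
  proof eventually_elim
    case (elim x)
    show ?case unfolding marg_within_def
    proof (intro allI impI)
      fix E :: "nat set set" and z Tri lam A H D e
      assume lg: "linear_gibbs E z Tri (fst x - 2)" and "\<bar>z - \<zeta>\<bar> \<le> snd x"
        and a: "linear_gibbs.adm E Tri ((c - snd x) / sqrt (fst x)) ((c + snd x) / sqrt (fst x)) k lam A H D"
        and e: "e \<in> E - D"
      have s: "0 < sqrt (real (fst x))" using elim by simp
      note t = linear_gibbs.marg_trivial[OF lg a e]
      have "sqrt (fst x) * gprob E z lam A H (\<lambda>U. e \<in> U) \<le> sqrt (fst x) * ((c + snd x) / sqrt (fst x))"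
        using t s by (intro mult_left_mono) auto
      also have "\<dots> = c + snd x" using s by simp
      finally have "sqrt (fst x) * gprob E z lam A H (\<lambda>U. e \<in> U) \<le> c + \<epsilon>" using elim by simp
      moreover have "0 \<le> sqrt (fst x) * gprob E z lam A H (\<lambda>U. e \<in> U)" using t s by simp
      ultimately show "fst (marg_bds c \<zeta> 0) - \<epsilon> \<le> sqrt (fst x) * gprob E z lam A H (\<lambda>U. e \<in> U) \<and>
         sqrt (fst x) * gprob E z lam A H (\<lambda>U. e \<in> U) \<le> snd (marg_bds c \<zeta> 0) + \<epsilon>"
        using 0 by auto
    qed
  qed
next
  case (Suc d)
  define \<alpha> where "\<alpha> = fst (marg_bds c \<zeta> d)"
  define \<beta> where "\<beta> = snd (marg_bds c \<zeta> d)"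
  have ab: "0 \<le> \<alpha>" "0 \<le> \<beta>" using marg_bds_nonneg[OF c] unfolding \<alpha>_def \<beta>_def by auto
  note id0 = tendsto_ident_at[of "0 :: real" "{0<..}"]
  \<comment> \<open>By continuity, a small slack \<open>\<epsilon>'\<close> in the bounds of depth
    \<open>d\<close> costs less than \<open>\<epsilon>\<close> at the next depth.\<close>
  have "((\<lambda>x. c * exp (- (\<zeta> * (max 0 (\<alpha> - x))\<^sup>2))) \<longlongrightarrow> c * exp (- (\<zeta> * (max 0 (\<alpha> - 0))\<^sup>2))) (at_right 0)"
    by (intro tendsto_intros id0)
  then have t1: "\<forall>\<^sub>F x in at_right 0. c * exp (- (\<zeta> * (max 0 (\<alpha> - x))\<^sup>2)) < c * exp (- (\<zeta> * \<alpha>\<^sup>2)) + \<epsilon>"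
    by (rule order_tendstoD) (use ab Suc.prems in \<open>simp add: max_absorb2\<close>)
  have "((\<lambda>x. c * exp (- (\<zeta> * (\<beta> + x)\<^sup>2))) \<longlongrightarrow> c * exp (- (\<zeta> * (\<beta> + 0)\<^sup>2))) (at_right 0)"
    by (intro tendsto_intros id0)
  then have t2: "\<forall>\<^sub>F x in at_right 0. c * exp (- (\<zeta> * \<beta>\<^sup>2)) - \<epsilon> < c * exp (- (\<zeta> * (\<beta> + x)\<^sup>2))"
    by (rule order_tendstoD) (use ab Suc.prems in simp)
  have "\<forall>\<^sub>F x::real in at_right 0. x > 0" by (rule eventually_at_right_less)
  with t1 t2 have "\<forall>\<^sub>F x::real in at_right 0. x > 0 \<and>
     c * exp (- (\<zeta> * (max 0 (\<alpha> - x))\<^sup>2)) < c * exp (- (\<zeta> * \<alpha>\<^sup>2)) + \<epsilon> \<and>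
     c * exp (- (\<zeta> * \<beta>\<^sup>2)) - \<epsilon> < c * exp (- (\<zeta> * (\<beta> + x)\<^sup>2))"
    by eventually_elim auto
  then obtain \<epsilon>' where e': "\<epsilon>' > 0"
     "c * exp (- (\<zeta> * (max 0 (\<alpha> - \<epsilon>'))\<^sup>2)) < c * exp (- (\<zeta> * \<alpha>\<^sup>2)) + \<epsilon>"
     "c * exp (- (\<zeta> * \<beta>\<^sup>2)) - \<epsilon> < c * exp (- (\<zeta> * (\<beta> + \<epsilon>')\<^sup>2))"
    using eventually_happens'[of "at_right (0::real)"] by auto
  \<comment> \<open>The truncation keeps the lower bound nonnegative, as its use inside a square
    requires.\<close>
  define a where "a = max 0 (\<alpha> - \<epsilon>')"
  define b where "b = \<beta> + \<epsilon>'"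
  have ab': "0 \<le> a" "0 \<le> b" using ab e' unfolding a_def b_def by auto
  define Up where "Up x = (c + snd x) * exp (- ((\<zeta> - snd x) * a\<^sup>2 * (1 - (2 + 2 * real k) * (1 / real (fst x)))))" for x :: "nat \<times> real"
  define Lo where "Lo x = (c - snd x) * (1 - (c + snd x) * (1 / sqrt (fst x))) *
     (exp (- ((\<zeta> + snd x) * b\<^sup>2 / (1 - (\<zeta> + snd x) * b\<^sup>2 * (1 / real (fst x))))) *
       (1 - (\<zeta> + snd x) * ((c + snd x) * (1 / sqrt (fst x)))) ^ k)" for x :: "nat \<times> real"
  have "(Up \<longlongrightarrow> (c + 0) * exp (- ((\<zeta> - 0) * a\<^sup>2 * (1 - (2 + 2 * real k) * 0)))) nd_filter"
    unfolding Up_def by (intro tendsto_intros nd_snd nd_inv)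
  then have u: "\<forall>\<^sub>F x in nd_filter. Up x < c * exp (- (\<zeta> * \<alpha>\<^sup>2)) + \<epsilon>"
    by (rule order_tendstoD) (use e'(2) a_def in simp)
  have "(Lo \<longlongrightarrow> (c - 0) * (1 - (c + 0) * 0) *
     (exp (- ((\<zeta> + 0) * b\<^sup>2 / (1 - (\<zeta> + 0) * b\<^sup>2 * 0))) *
       (1 - (\<zeta> + 0) * ((c + 0) * 0)) ^ k)) nd_filter"
    unfolding Lo_def by (intro tendsto_intros nd_snd nd_inv nd_inv_sqrt) simp
  then have l: "\<forall>\<^sub>F x in nd_filter. c * exp (- (\<zeta> * \<beta>\<^sup>2)) - \<epsilon> < Lo x"
    by (rule order_tendstoD) (use e'(3) b_def in simp)
  have "((\<lambda>x. (c + snd x) * (1 / sqrt (real (fst x)))) \<longlongrightarrow> (c + 0) * 0) nd_filter"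
    by (intro tendsto_intros nd_snd nd_inv_sqrt)
  then have s1: "\<forall>\<^sub>F x in nd_filter. (c + snd x) * (1 / sqrt (real (fst x))) < 1"
    by (rule order_tendstoD) simp
  have "((\<lambda>x. a * (1 / sqrt (real (fst x)))) \<longlongrightarrow> a * 0) nd_filter"
    by (intro tendsto_intros nd_inv_sqrt)
  then have s2: "\<forall>\<^sub>F x in nd_filter. a * (1 / sqrt (real (fst x))) < 1"
    by (rule order_tendstoD) simp
  have "((\<lambda>x. b * (1 / sqrt (real (fst x)))) \<longlongrightarrow> b * 0) nd_filter"
    by (intro tendsto_intros nd_inv_sqrt)
  then have s3: "\<forall>\<^sub>F x in nd_filter. b * (1 / sqrt (real (fst x))) < 1"
    by (rule order_tendstoD) simp
  have "((\<lambda>x. (\<zeta> + snd x) * b\<^sup>2 * (1 / real (fst x))) \<longlongrightarrow> (\<zeta> + 0) * b\<^sup>2 * 0) nd_filter"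
    by (intro tendsto_intros nd_snd nd_inv)
  then have s4: "\<forall>\<^sub>F x in nd_filter. (\<zeta> + snd x) * b\<^sup>2 * (1 / real (fst x)) < 1"
    by (rule order_tendstoD) simp
  have "((\<lambda>x. (\<zeta> + snd x) * ((c + snd x) * (1 / sqrt (real (fst x))))) \<longlongrightarrow> (\<zeta> + 0) * ((c + 0) * 0)) nd_filter"
    by (intro tendsto_intros nd_snd nd_inv_sqrt)
  then have s5: "\<forall>\<^sub>F x in nd_filter. (\<zeta> + snd x) * ((c + snd x) * (1 / sqrt (real (fst x)))) < 1"
    by (rule order_tendstoD) simp
  have s6: "\<forall>\<^sub>F x in nd_filter. snd x < c" by (rule order_tendstoD(2)[OF nd_snd c])
  have IH: "\<forall>\<^sub>F x in nd_filter. marg_within c \<zeta> (4 * k + 3) (fst x) (snd x) (\<alpha> - \<epsilon>') b"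
    unfolding \<alpha>_def \<beta>_def b_def by (rule Suc.IH[OF e'(1)])
  from u l s1 s2 s3 s4 s5 s6 IH nd_fst_ge[of "2 + 2 * k"] nd_snd_pos show ?case
  proof eventually_elim
    case (elim x)
    define n where "n = fst x"
    define \<delta> where "\<delta> = snd x"
    note elim = elim[folded n_def \<delta>_def]
    show ?case unfolding marg_within_def n_def[symmetric] \<delta>_def[symmetric]
    proof (intro allI impI)
      fix E :: "nat set set" and z Tri lam A H D e
      assume lg: "linear_gibbs E z Tri (n - 2)" and z: "\<bar>z - \<zeta>\<bar> \<le> \<delta>"
        and adm: "linear_gibbs.adm E Tri ((c - \<delta>) / sqrt n) ((c + \<delta>) / sqrt n) k lam A H D"
        and e: "e \<in> E - D"
      have s: "0 < sqrt (real n)" using elim by simp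
      have bd: "a / sqrt n \<le> gprob E z lam A H (\<lambda>U. x \<in> U) \<and> gprob E z lam A H (\<lambda>U. x \<in> U) \<le> b / sqrt n"
        if "linear_gibbs.adm E Tri ((c - \<delta>) / sqrt n) ((c + \<delta>) / sqrt n) (4 * k + 3) lam A H D" "x \<in> E - D"
        for lam A H D x
      proof -
        have "\<alpha> - \<epsilon>' \<le> sqrt n * gprob E z lam A H (\<lambda>U. x \<in> U)" "sqrt n * gprob E z lam A H (\<lambda>U. x \<in> U) \<le> b"
          using elim(9)[unfolded marg_within_def, rule_format, OF lg z that] by auto
        moreover have "0 \<le> sqrt n * gprob E z lam A H (\<lambda>U. x \<in> U)"
          using linear_gibbs.marg_trivial(1)[OF lg that] s by simp
        ultimately show ?thesis using s unfolding a_def by (simp add: field_simps)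
      qed
      have g: "0 \<le> c - \<delta>" "0 \<le> \<delta>" "(c + \<delta>) / sqrt n \<le> 1" "a / sqrt n \<le> 1" "b / sqrt n \<le> 1"
        "(\<zeta> + \<delta>) * b\<^sup>2 / n < 1" "(\<zeta> + \<delta>) * ((c + \<delta>) / sqrt n) \<le> 1" using elim by auto
      have R1: "sqrt n * gprob E z lam A H (\<lambda>U. e \<in> U) \<le> Up x"
        using linear_gibbs.marg_recursion_scaled(1)[OF lg refl refl elim(10) adm e z g(1-3) ab'(1) g(4) ab'(2) g(5-7)] bd
        unfolding Up_def n_def[symmetric] \<delta>_def[symmetric] by blast
      have R2: "Lo x \<le> sqrt n * gprob E z lam A H (\<lambda>U. e \<in> U)"
        using linear_gibbs.marg_recursion_scaled(2)[OF lg refl refl elim(10) adm e z g(1-3) ab'(1) g(4) ab'(2) g(5-7)] bd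
        unfolding Lo_def n_def[symmetric] \<delta>_def[symmetric] by simp
      show "fst (marg_bds c \<zeta> (Suc d)) - \<epsilon> \<le> sqrt n * gprob E z lam A H (\<lambda>U. e \<in> U) \<and>
         sqrt n * gprob E z lam A H (\<lambda>U. e \<in> U) \<le> snd (marg_bds c \<zeta> (Suc d)) + \<epsilon>"
        using R1 R2 elim(1,2) unfolding \<alpha>_def \<beta>_def by simp
    qed
  qed
qed

text \<open>The depth is fixed first, so that \<open>marg_bds\<close> is within
  \<open>\<epsilon> / 2\<close> of its limit; only then do n and \<delta> move, so the growth of
  \<open>k\<close> with the depth is harmless.\<close>

lemma marg_within_limit:
  assumes c: "0 < c" and z: "0 \<le> \<zeta>" "2 * \<zeta> * c\<^sup>2 < 1" and q: "0 \<le> q0" "q0 = c * exp (- (\<zeta> * q0\<^sup>2))" and e: "0 < \<epsilon>"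
  shows "\<forall>\<^sub>F x in nd_filter. marg_within c \<zeta> k (fst x) (snd x) (q0 - \<epsilon>) (q0 + \<epsilon>)"
proof -
  note t = marg_bds_tendsto[OF c z q]
  have "\<forall>\<^sub>F d in sequentially. q0 - \<epsilon> / 2 < fst (marg_bds c \<zeta> d)"
    by (rule order_tendstoD(1)[OF t(1)]) (use e in simp)
  moreover have "\<forall>\<^sub>F d in sequentially. snd (marg_bds c \<zeta> d) < q0 + \<epsilon> / 2"
    by (rule order_tendstoD(2)[OF t(2)]) (use e in simp)
  ultimately have "\<forall>\<^sub>F d in sequentially. q0 - \<epsilon> / 2 < fst (marg_bds c \<zeta> d) \<and> snd (marg_bds c \<zeta> d) < q0 + \<epsilon> / 2"
    by eventually_elim auto
  then obtain d where d: "q0 - \<epsilon> / 2 < fst (marg_bds c \<zeta> d)" "snd (marg_bds c \<zeta> d) < q0 + \<epsilon> / 2"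
    using eventually_happens'[of sequentially] by auto
  have "\<forall>\<^sub>F x in nd_filter. marg_within c \<zeta> k (fst x) (snd x)
     (fst (marg_bds c \<zeta> d) - \<epsilon> / 2) (snd (marg_bds c \<zeta> d) + \<epsilon> / 2)"
    by (rule marg_within_iter[OF c z(1)]) (use e in simp)
  then show ?thesis
  proof eventually_elim
    case (elim x)
    then show ?case by (rule marg_within_mono) (use d in auto)
  qed
qed

text \<open>
  Chernoff's bound, with the moment generating function estimated through Jensen's inequality for
  the exponentially tilted weights; only the tilted mean enters.
\<close>

lemma tilted_tail_bound:
  fixes w Y :: "'b \<Rightarrow> real" and t y :: real
  assumes fin: "finite \<Omega>" and w: "\<And>x. x \<in> \<Omega> \<Longrightarrow> 0 \<le> w x" and t: "0 \<le> t"
    and pos: "0 < (\<Sum>x\<in>\<Omega>. w x * exp (t * Y x))"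
    and m: "m = (\<Sum>x\<in>\<Omega>. Y x * (w x * exp (t * Y x))) / (\<Sum>x\<in>\<Omega>. w x * exp (t * Y x))"
  shows "(\<Sum>x\<in>\<Omega>. of_bool (y \<le> Y x) * w x) \<le> exp (t * (m - y)) * (\<Sum>x\<in>\<Omega>. w x)"
proof -
  define v where "v x = w x * exp (t * Y x)" for x
  define W where "W = (\<Sum>x\<in>\<Omega>. v x)"
  have W: "0 < W" using pos unfolding W_def v_def .
  have mW: "(\<Sum>x\<in>\<Omega>. Y x * v x) = m * W" using m W unfolding v_def W_def by simp
  \<comment> \<open>The last factor equals \<open>W\<close> because \<open>m\<close> is the tilted
    mean; in this form the sum contains, term by term, the linear lower bound 1 - t (Y - m) of exp
    (- t (Y - m)).\<close>
  have "exp (- (t * m)) * W = exp (- (t * m)) * ((1 + t * m) * W - t * (\<Sum>x\<in>\<Omega>. Y x * v x))"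
    unfolding mW by (simp add: algebra_simps)
  also have "\<dots> = (\<Sum>x\<in>\<Omega>. exp (- (t * m)) * (1 - t * (Y x - m)) * v x)"
    unfolding W_def sum_distrib_left sum_subtractf[symmetric] by (intro sum.cong) (auto simp: algebra_simps)
  also have "\<dots> \<le> (\<Sum>x\<in>\<Omega>. w x)"
  proof (rule sum_mono)
    fix x assume x: "x \<in> \<Omega>"
    have "exp (- (t * m)) * (1 - t * (Y x - m)) \<le> exp (- (t * m)) * exp (- (t * (Y x - m)))"
      using exp_ge_add_one_self[of "- (t * (Y x - m))"] by (intro mult_left_mono) auto
    also have "\<dots> = exp (- (t * Y x))" by (simp add: algebra_simps flip: exp_add)
    finally have "exp (- (t * m)) * (1 - t * (Y x - m)) * v x \<le> exp (- (t * Y x)) * v x"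
      using w[OF x] unfolding v_def by (intro mult_right_mono) auto
    also have "exp (- (t * Y x)) * v x = w x" by (simp add: v_def exp_minus)
    finally show "exp (- (t * m)) * (1 - t * (Y x - m)) * v x \<le> w x" .
  qed
  finally have 1: "exp (- (t * m)) * W \<le> (\<Sum>x\<in>\<Omega>. w x)" .
  have "exp (t * y) * (\<Sum>x\<in>\<Omega>. of_bool (y \<le> Y x) * w x) \<le> W"
    unfolding W_def sum_distrib_left
  proof (rule sum_mono)
    fix x assume x: "x \<in> \<Omega>"
    show "exp (t * y) * (of_bool (y \<le> Y x) * w x) \<le> v x"
    proof (cases "y \<le> Y x")
      case True
      then have "exp (t * y) * w x \<le> exp (t * Y x) * w x"
        using t w[OF x] by (intro mult_right_mono) (auto intro: mult_left_mono)
      then show ?thesis using True by (simp add: v_def mult.commute)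
    qed (use w[OF x] in \<open>auto simp: v_def\<close>)
  qed
  also have "W = exp (t * m) * (exp (- (t * m)) * W)" by (simp add: exp_minus)
  also have "\<dots> \<le> exp (t * m) * (\<Sum>x\<in>\<Omega>. w x)" by (intro mult_left_mono 1) auto
  finally have 2: "exp (t * y) * (\<Sum>x\<in>\<Omega>. of_bool (y \<le> Y x) * w x) \<le> exp (t * m) * (\<Sum>x\<in>\<Omega>. w x)" .
  have "(\<Sum>x\<in>\<Omega>. of_bool (y \<le> Y x) * w x) = exp (- (t * y)) * (exp (t * y) * (\<Sum>x\<in>\<Omega>. of_bool (y \<le> Y x) * w x))"
    by (simp add: exp_minus)
  also have "\<dots> \<le> exp (- (t * y)) * (exp (t * m) * (\<Sum>x\<in>\<Omega>. w x))"
    by (intro mult_left_mono 2) auto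
  also have "\<dots> = exp (t * (m - y)) * (\<Sum>x\<in>\<Omega>. w x)"
    by (simp add: algebra_simps exp_diff exp_minus field_simps)
  finally show ?thesis .
qed

section \<open>Tail bounds by tilting the activities or the penalty\<close>

context gibbs
begin

text \<open>If the tilted weights again belong to the Gibbs family, the tilted mean is a mean in the
  model with parameters \<open>z'\<close> and \<open>lam'\<close>. Estimates of means that are
  uniform in the parameters thus become tail bounds.\<close>

lemma gprob_tilted_tail:
  assumes lam: "\<And>v. v \<in> E \<Longrightarrow> 0 \<le> lam v" and z': "gibbs E z'" and t: "0 \<le> t"
    and pos: "0 < gsum E z' lam' A H (\<lambda>_. 1)" "0 < Z lam A H"
    and tilt: "\<And>U. U \<subseteq> E \<Longrightarrow> gwt z lam A H U * exp (t * Y U) = gwt z' lam' A H U"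
    and m: "m = gsum E z' lam' A H Y / gsum E z' lam' A H (\<lambda>_. 1)"
  shows "P lam A H (\<lambda>U. y \<le> Y U) \<le> exp (t * (m - y))"
proof -
  have W: "(\<Sum>U\<in>Pow E. gwt z lam A H U * exp (t * Y U)) = gsum E z' lam' A H (\<lambda>_. 1)"
    unfolding gsum_def by (intro sum.cong) (auto simp: tilt)
  have Y: "(\<Sum>U\<in>Pow E. Y U * (gwt z lam A H U * exp (t * Y U))) = gsum E z' lam' A H Y"
    unfolding gsum_def by (intro sum.cong) (auto simp: tilt)
  have "S lam A H (\<lambda>U. of_bool (y \<le> Y U)) \<le> exp (t * (m - y)) * Z lam A H"
    unfolding gsum_def
    using tilted_tail_bound[of "Pow E" "gwt z lam A H" t Y m y] finite_E gwt_nonneg[OF lam] t pos m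
    by (simp add: W Y)
  then show ?thesis unfolding gprob_def using pos(2) by (simp add: divide_le_eq)
qed

lemma gsum_add: "S lam A H (\<lambda>U. f U + g U) = S lam A H f + S lam A H g"
  by (simp add: gsum_def distrib_right sum.distrib)

lemma gsum_sum: "finite I \<Longrightarrow> S lam A H (\<lambda>U. \<Sum>i\<in>I. f i U) = (\<Sum>i\<in>I. S lam A H (f i))"
  by (induction I rule: finite_induct) (simp_all add: gsum_add, simp add: gsum_def)

lemma gprob_disj:
  assumes "\<And>v. v \<in> E \<Longrightarrow> 0 \<le> lam v"
  shows "P lam A H (\<lambda>U. Q U \<or> R U) \<le> P lam A H Q + P lam A H R"
  unfolding gprob_def add_divide_distrib[symmetric] gsum_add[symmetric]
  by (intro divide_right_mono gsum_mono gsum_nonneg assms) auto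

lemma gprob_Bex:
  assumes "\<And>v. v \<in> E \<Longrightarrow> 0 \<le> lam v" "finite I"
  shows "P lam A H (\<lambda>U. \<exists>i\<in>I. Q i U) \<le> (\<Sum>i\<in>I. P lam A H (Q i))"
  using assms(2)
proof (induction I rule: finite_induct)
  case empty
  then show ?case by (simp add: gprob_def gsum_def)
next
  case (insert i I)
  then show ?case
    using gprob_disj[of lam A H "Q i" "\<lambda>U. \<exists>i\<in>I. Q i U"] assms(1) by simp
qed

lemma mean_weighted_size:
  "S lam A H (\<lambda>U. \<Sum>e\<in>U. w e) / Z lam A H = (\<Sum>e\<in>E. w e * marg lam A H e)"
proof -
  have "S lam A H (\<lambda>U. \<Sum>e\<in>U. w e) = S lam A H (\<lambda>U. \<Sum>e\<in>E. w e * of_bool (e \<in> U))"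
  proof (rule gsum_cong)
    fix U assume "U \<subseteq> E"
    then have "(\<Sum>e\<in>U. w e) = (\<Sum>e\<in>E. if e \<in> U then w e else 0)"
      using finite_E by (simp add: sum.inter_restrict[symmetric] inf.absorb2)
    then show "(\<Sum>e\<in>U. w e) = (\<Sum>e\<in>E. w e * of_bool (e \<in> U))"
      by (simp add: if_distrib cong: if_cong) (auto simp: of_bool_def intro!: sum.cong)
  qed
  also have "\<dots> = (\<Sum>e\<in>E. w e * S lam A H (\<lambda>U. of_bool (e \<in> U)))"
    unfolding gsum_sum[OF finite_E] gsum_cmult ..
  finally show ?thesis by (simp add: gprob_def sum_divide_distrib)
qed

lemma mean_card:
  assumes "finite H'"
  shows "S lam A H (\<lambda>U. real (card {h \<in> H'. h \<subseteq> U})) / Z lam A H = (\<Sum>h\<in>H'. P lam A H (\<lambda>U. h \<subseteq> U))"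
proof -
  have "(\<lambda>U. real (card {h \<in> H'. h \<subseteq> U})) = (\<lambda>U. \<Sum>h\<in>H'. of_bool (h \<subseteq> U))"
    using assms by (auto simp: of_bool_def Collect_conj_eq Int_commute simp flip: sum.inter_filter)
  then show ?thesis by (simp only: gsum_sum[OF assms] gprob_def sum_divide_distrib)
qed

text \<open>The exponential of a sum over the chosen vertices factors over them and is absorbed into
  the activities.\<close>

lemma weighted_size_tail:
  assumes lam: "\<And>v. v \<in> E \<Longrightarrow> 0 \<le> lam v" and t: "0 \<le> t" and H: "\<And>h. h \<in> H \<Longrightarrow> \<not> h \<subseteq> A"
  shows "P lam A H (\<lambda>U. y \<le> (\<Sum>e\<in>U. w e)) \<le>
    exp (t * ((\<Sum>e\<in>E. w e * marg (\<lambda>e. lam e * exp (t * w e)) A H e) - y))"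
proof (rule gprob_tilted_tail[OF lam _ t])
  show "gibbs E z" by unfold_locales
  have "1 \<le> Z (\<lambda>e. lam e * exp (t * w e)) A H" by (rule Z_ge_1) (use lam H in auto)
  then show "0 < Z (\<lambda>e. lam e * exp (t * w e)) A H" by linarith
  have "1 \<le> Z lam A H" by (rule Z_ge_1) (use lam H in auto)
  then show "0 < Z lam A H" by linarith
  show "gwt z lam A H U * exp (t * (\<Sum>e\<in>U. w e)) = gwt z (\<lambda>e. lam e * exp (t * w e)) A H U"
    if "U \<subseteq> E" for U
  proof -
    have "exp (t * (\<Sum>e\<in>U. w e)) = (\<Prod>e\<in>U. exp (t * w e))"
      unfolding sum_distrib_left by (rule exp_sum) (use that finite_E finite_subset in auto)
    then show ?thesis by (simp add: gwt_def prod.distrib)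
  qed
qed (assumption | rule mean_weighted_size[symmetric])+

text \<open>Every hyperedge contained in \<open>U\<close> already contributes a factor 1 - z, so
  tilting by their number merely changes the penalty to \<open>z'\<close>. For the lower tail the
  negated count is tilted.\<close>

lemma card_tail:
  assumes lam: "\<And>v. v \<in> E \<Longrightarrow> 0 \<le> lam v" and t: "0 \<le> t" and H: "finite H" "{} \<notin> H"
    and z': "0 \<le> z'" "z' \<le> 1"
  shows "1 - z' = (1 - z) * exp t \<Longrightarrow> P lam {} H (\<lambda>U. y \<le> real (card {h \<in> H. h \<subseteq> U})) \<le>
      exp (t * ((\<Sum>h\<in>H. gprob E z' lam {} H (\<lambda>U. h \<subseteq> U)) - y))"
    and "1 - z' = (1 - z) * exp (- t) \<Longrightarrow> P lam {} H (\<lambda>U. real (card {h \<in> H. h \<subseteq> U}) \<le> y) \<le>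
      exp (t * (y - (\<Sum>h\<in>H. gprob E z' lam {} H (\<lambda>U. h \<subseteq> U))))"
proof -
  interpret z': gibbs E z' by unfold_locales (use finite_E z' in auto)
  have "1 \<le> gsum E z' lam {} H (\<lambda>_. 1)" by (rule z'.Z_ge_1) (use lam H in auto)
  then have p1: "0 < gsum E z' lam {} H (\<lambda>_. 1)" by linarith
  have "1 \<le> Z lam {} H" by (rule Z_ge_1) (use lam H in auto)
  then have p2: "0 < Z lam {} H" by linarith
  have g: "gibbs E z'" by unfold_locales
  show "P lam {} H (\<lambda>U. y \<le> real (card {h \<in> H. h \<subseteq> U})) \<le>
      exp (t * ((\<Sum>h\<in>H. gprob E z' lam {} H (\<lambda>U. h \<subseteq> U)) - y))" if e: "1 - z' = (1 - z) * exp t"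
  proof (rule gprob_tilted_tail[OF lam g t p1 p2])
    show "gwt z lam {} H U * exp (t * real (card {h \<in> H. h \<subseteq> U})) = gwt z' lam {} H U" for U
      by (simp add: gwt_def e power_mult_distrib exp_of_nat_mult[symmetric] mult.commute)
  qed (simp_all add: z'.mean_card H)
  have "P lam {} H (\<lambda>U. - y \<le> - real (card {h \<in> H. h \<subseteq> U})) \<le>
      exp (t * (- (\<Sum>h\<in>H. gprob E z' lam {} H (\<lambda>U. h \<subseteq> U)) - (- y)))" if e: "1 - z' = (1 - z) * exp (- t)"
  proof (rule gprob_tilted_tail[OF lam g t p1 p2])
    show "gwt z lam {} H U * exp (t * (- real (card {h \<in> H. h \<subseteq> U}))) = gwt z' lam {} H U" for U
      by (simp add: gwt_def e power_mult_distrib exp_of_nat_mult[symmetric] mult.commute)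
    have "gsum E z' lam {} H (\<lambda>U. - real (card {h \<in> H. h \<subseteq> U})) = - gsum E z' lam {} H (\<lambda>U. real (card {h \<in> H. h \<subseteq> U}))"
      by (simp add: gsum_def sum_negf)
    then show "- (\<Sum>h\<in>H. gprob E z' lam {} H (\<lambda>U. h \<subseteq> U)) = gsum E z' lam {} H (\<lambda>U. - real (card {h \<in> H. h \<subseteq> U})) /
        gsum E z' lam {} H (\<lambda>_. 1)"
      using z'.mean_card[OF H(1), of lam "{}" H] by simp
  qed simp_all
  then show "P lam {} H (\<lambda>U. real (card {h \<in> H. h \<subseteq> U}) \<le> y) \<le>
      exp (t * (y - (\<Sum>h\<in>H. gprob E z' lam {} H (\<lambda>U. h \<subseteq> U))))" if e: "1 - z' = (1 - z) * exp (- t)"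
    using e by simp
qed

end

section \<open>The probability that a given triangle is present\<close>

context linear_gibbs
begin

text \<open>Hyperedges have three vertices, so with nothing conditioned no vertex carries a direct
  penalty and \<open>D\<close> may be empty.\<close>

lemma adm_unconditioned:
  assumes "0 \<le> l" "\<And>v. v \<in> E \<Longrightarrow> l \<le> lam v \<and> lam v \<le> u"
    and "H \<subseteq> Tri" "card (Tri - H) \<le> k"
  shows "adm l u k lam {} H {}"
proof -
  have 1: "\<not> h \<subseteq> insert x {}" if "h \<in> H" for h x
  proof
    assume "h \<subseteq> insert x {}"
    then have "card h \<le> card (insert x {})" by (intro card_mono) auto
    moreover have "card h = 3" using that assms(3) tri_card by auto
    ultimately show False by simp
  qed
  have 2: "card {h \<in> Tri - H. v \<in> h} \<le> k" for v
    by (rule order_trans[OF card_mono assms(4)]) (use finite_Tri in auto)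
  have "0 \<le> lam v" if "v \<in> E" for v using assms(1) assms(2)[OF that] by linarith
  moreover have "\<not> h \<subseteq> {}" if "h \<in> H" for h using 1[OF that] by blast
  ultimately show ?thesis unfolding adm_def
    by (intro conjI ballI impI) (use 1 2 assms in auto)
qed

text \<open>The hyperedge \<open>T\<close> is removed first: without its own penalty the chain rule
  gives a probability p between a^3 and b^3. Restoring it turns p into (1 - z) p / (1 - z p). The 7
  is 4k + 3 with k = 1, for the one missing hyperedge.\<close>

lemma gprob_triangle_bounds:
  assumes T: "T \<in> Tri" and l: "0 \<le> l" "\<And>v. v \<in> E \<Longrightarrow> l \<le> lam v \<and> lam v \<le> u"
    and ab: "0 \<le> a" "0 \<le> b" "b < 1"
    and bd: "\<And>lam A H D x. adm l u 7 lam A H D \<Longrightarrow> x \<in> E - D \<Longrightarrow> a \<le> marg lam A H x \<and> marg lam A H x \<le> b"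
  shows "(1 - z) * a ^ 3 \<le> P lam {} Tri (\<lambda>U. T \<subseteq> U)"
    and "P lam {} Tri (\<lambda>U. T \<subseteq> U) \<le> (1 - z) * b ^ 3 / (1 - b ^ 3)"
proof -
  define H where "H = Tri - {T}"
  have H: "T \<notin> H" "Tri = insert T H" "H \<subseteq> Tri" "finite H" using T finite_Tri unfolding H_def by auto
  have "Tri - H = {T}" using T unfolding H_def by auto
  then have adm: "adm l u 1 lam {} H {}" by (intro adm_unconditioned[OF l]) (use H in auto)
  obtain e f g where efg: "T = {e, f, g}" "e \<noteq> f" "e \<noteq> g" "f \<noteq> g"
    using tri_cases[OF T] tri_card[OF T] by (metis all_not_in_conv card.empty zero_neq_numeral)
  have mem: "e \<in> E" "f \<in> E" "g \<in> E" using tri_sub[OF T] efg by auto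
  have s: "{h \<in> H. e \<notin> h} \<subseteq> H" by auto
  have eE: "e \<in> E - {}" using mem by auto
  note st = adm_step[OF adm eE order.refl s]
  have nn: "\<And>v. v \<in> E \<Longrightarrow> 0 \<le> lam v" using l by fastforce
  have p0: "P lam {} H (\<lambda>U. e \<in> U \<and> f \<in> U \<and> g \<in> U)
       = marg lam {} H e * P (lam(e := 0)) {e} H (\<lambda>U. f \<in> U \<and> g \<in> U)"
    by (rule gprob_triple[OF mem(1) _ efg(2)[symmetric] efg(3)[symmetric] adm_Z_pos[OF st]]) auto
  have "a\<^sup>2 \<le> P (lam(e := 0)) {e} H (\<lambda>U. f \<in> U \<and> g \<in> U)"
    by (rule gprob_good_pair(1)[OF adm eE order.refl s _ _ _ _ efg(2-4) _ ab(1,2)])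
       (use T H efg bd in auto)
  moreover have "P (lam(e := 0)) {e} H (\<lambda>U. f \<in> U \<and> g \<in> U) \<le> b\<^sup>2"
    by (rule gprob_good_pair(2)[OF adm eE order.refl s _ _ _ _ efg(2-4) _ ab(1,2)])
       (use T H efg bd in auto)
  moreover have "a \<le> marg lam {} H e" "marg lam {} H e \<le> b"
    using bd[OF adm_mono[OF adm] eE] by auto
  moreover define p where "p = P lam {} H (\<lambda>U. T \<subseteq> U)"
  moreover have "p = marg lam {} H e * P (lam(e := 0)) {e} H (\<lambda>U. f \<in> U \<and> g \<in> U)"
  proof -
    have "(\<lambda>U. T \<subseteq> U) = (\<lambda>U. e \<in> U \<and> f \<in> U \<and> g \<in> U)" using efg(1) by auto
    then show ?thesis unfolding p_def p0[symmetric] by (rule arg_cong)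
  qed
  ultimately have p: "a ^ 3 \<le> p" "p \<le> b ^ 3"
    using ab mult_mono[of a "marg lam {} H e" "a\<^sup>2" "P (lam(e := 0)) {e} H (\<lambda>U. f \<in> U \<and> g \<in> U)"]
     mult_mono[of "marg lam {} H e" b "P (lam(e := 0)) {e} H (\<lambda>U. f \<in> U \<and> g \<in> U)" "b\<^sup>2"]
     gprob_nonneg[of "lam(e := 0)" "{e}" H "\<lambda>U. f \<in> U \<and> g \<in> U"] nn
    by (auto simp: power3_eq_cube power2_eq_square mult.assoc)
  have Zp: "0 < Z lam {} H" by (rule adm_Z_pos[OF adm])
  have "S lam {} Tri (\<lambda>U. of_bool (T \<subseteq> U)) = S lam {} H (\<lambda>U. (1 - z) * of_bool (T \<subseteq> U))"
    unfolding H(2) gsum_insert_H[OF H(4,1)] by (rule gsum_cong) auto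
  then have "S lam {} Tri (\<lambda>U. of_bool (T \<subseteq> U)) = (1 - z) * (p * Z lam {} H)"
    unfolding p_def gprob_def gsum_cmult using Zp by simp
  moreover have "Z lam {} Tri = (1 - z * p) * Z lam {} H"
    using Z_insert_H[OF H(4,1) Zp] unfolding H(2)[symmetric] p_def by simp
  ultimately have eq: "P lam {} Tri (\<lambda>U. T \<subseteq> U) = (1 - z) * p / (1 - z * p)"
    unfolding gprob_def using Zp by simp
  have b3: "b ^ 3 < 1" using ab power_strict_mono[of b 1 3] by simp
  have p0: "0 \<le> p" using order_trans[OF zero_le_power[OF ab(1)] p(1)] .
  have zp: "z * p \<le> b ^ 3" using mult_mono[of z 1 p "b ^ 3"] z01 p p0 by simp
  have zp0: "0 \<le> z * p" using z01 p0 by simp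
  show "(1 - z) * a ^ 3 \<le> P lam {} Tri (\<lambda>U. T \<subseteq> U)"
  proof -
    have "(1 - z) * a ^ 3 \<le> (1 - z) * p" using p z01 by (intro mult_left_mono) auto
    also have "\<dots> \<le> (1 - z) * p / (1 - z * p)"
      using zp zp0 b3 z01 p0 by (simp add: le_divide_eq mult_left_le)
    finally show ?thesis using eq by simp
  qed
  show "P lam {} Tri (\<lambda>U. T \<subseteq> U) \<le> (1 - z) * b ^ 3 / (1 - b ^ 3)"
    unfolding eq using p zp zp0 b3 z01 p0 ab by (intro frac_le mult_left_mono) auto
qed

end

section \<open>Triangles of the complete graph and the random graph\<close>

definition K_edges :: "nat \<Rightarrow> nat set set" where
  "K_edges n = nsets {..<n} 2"

definition K_tri :: "nat \<Rightarrow> nat set set set" where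
  "K_tri n = (\<lambda>T. nsets T 2) ` nsets {..<n} 3"

lemma Union_nsets_2:
  assumes "card T = 3"
  shows "\<Union> (nsets T 2) = T"
proof
  show "T \<subseteq> \<Union> (nsets T 2)"
  proof
    fix x assume x: "x \<in> T"
    have "finite T" using assms card.infinite by fastforce
    then have "card (T - {x}) = 2" using assms x by simp
    then obtain y where "y \<in> T" "y \<noteq> x" by (metis Diff_iff card.empty equals0I insertI1 zero_neq_numeral)
    then have "{x, y} \<in> nsets T 2" using x by (auto simp: nsets_def)
    then show "x \<in> \<Union> (nsets T 2)" by auto
  qed
qed (auto simp: nsets_def)

lemma inj_nsets_2: "inj_on (\<lambda>T. nsets T 2) {T. card T = 3}"
  by (rule inj_on_inverseI[where g = Union]) (simp add: Union_nsets_2)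

lemma finite_K_edges: "finite (K_edges n)"
  unfolding K_edges_def by (simp add: finite_imp_finite_nsets)

lemma card_K_tri: "card (K_tri n) = n choose 3"
proof -
  have "inj_on (\<lambda>T. nsets T 2) (nsets {..<n} 3)"
    by (rule inj_on_subset[OF inj_nsets_2]) (auto simp: nsets_def)
  then have "card (K_tri n) = card (nsets {..<n} 3)" unfolding K_tri_def by (rule card_image)
  also have "nsets {..<n} 3 = {T. T \<subseteq> {..<n} \<and> card T = 3}"
    by (auto simp: nsets_def intro: finite_subset)
  also have "card \<dots> = n choose 3" by (simp add: n_subsets)
  finally show ?thesis .
qed

text \<open>Two different edges of a triangle cover its three vertices, so no other triangle
  contains both; the triangles through an edge correspond to the n - 2 remaining vertices.\<close>

lemma linear_gibbs_K:
  assumes "0 \<le> z" "z \<le> 1"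
  shows "linear_gibbs (K_edges n) z (K_tri n) (n - 2)"
proof
  show "finite (K_edges n)" by (rule finite_K_edges)
  show "0 \<le> z" "z \<le> 1" by fact+
next
  fix h assume "h \<in> K_tri n"
  then obtain T where T: "h = nsets T 2" "T \<subseteq> {..<n}" "finite T" "card T = 3"
    by (auto simp: K_tri_def nsets_def)
  show "h \<subseteq> K_edges n" using T unfolding K_edges_def by (auto simp: nsets_def)
  have "h = {S. S \<subseteq> T \<and> card S = 2}" unfolding T by (auto simp: nsets_def intro: finite_subset T(3))
  then show "card h = 3" using n_subsets[OF T(3), of 2] T(4) by (simp add: numeral_eq_Suc)
next
  fix h h' x y assume h: "h \<in> K_tri n" "h' \<in> K_tri n" "x \<noteq> y" "{x, y} \<subseteq> h" "{x, y} \<subseteq> h'"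
  obtain T T' where T: "h = nsets T 2" "finite T" "card T = 3" "h' = nsets T' 2" "finite T'" "card T' = 3"
    using h by (auto simp: K_tri_def nsets_def)
  have xy: "x \<subseteq> T" "y \<subseteq> T" "x \<subseteq> T'" "y \<subseteq> T'" "card x = 2" "card y = 2" "finite x" "finite y"
    using h T by (auto simp: nsets_def)
  have "\<not> y \<subseteq> x" using h(3) xy card_subset_eq by metis
  then have "x \<subset> x \<union> y" by auto
  then have "3 \<le> card (x \<union> y)" using psubset_card_mono[of "x \<union> y" x] xy by simp
  then have "T = x \<union> y" "T' = x \<union> y"
    using card_seteq[of T "x \<union> y"] card_seteq[of T' "x \<union> y"] T xy by auto
  then show "h = h'" using T by simp
next
  fix e assume "e \<in> K_edges n"
  then have e: "e \<subseteq> {..<n}" "card e = 2" "finite e" by (auto simp: K_edges_def nsets_def)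
  have eq: "{h \<in> K_tri n. e \<in> h} = (\<lambda>v. nsets (insert v e) 2) ` ({..<n} - e)"
  proof (intro equalityI subsetI)
    fix h assume "h \<in> {h \<in> K_tri n. e \<in> h}"
    then obtain T where T: "h = nsets T 2" "T \<subseteq> {..<n}" "finite T" "card T = 3" "e \<subseteq> T"
      by (auto simp: K_tri_def nsets_def)
    have "card (T - e) = 1" using T e by (simp add: card_Diff_subset)
    then obtain v where "T - e = {v}" by (auto simp: card_1_singleton_iff)
    then have "T = insert v e" "v \<in> {..<n} - e" using T by auto
    then show "h \<in> (\<lambda>v. nsets (insert v e) 2) ` ({..<n} - e)" using T by auto
  next
    fix h assume "h \<in> (\<lambda>v. nsets (insert v e) 2) ` ({..<n} - e)"
    then obtain v where v: "h = nsets (insert v e) 2" "v < n" "v \<notin> e" by auto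
    then show "h \<in> {h \<in> K_tri n. e \<in> h}" using e
      by (auto simp: K_tri_def nsets_def intro!: image_eqI[of _ _ "insert v e"])
  qed
  have "inj_on (\<lambda>v. nsets (insert v e) 2) ({..<n} - e)"
  proof (rule inj_onI)
    fix v w assume vw: "v \<in> {..<n} - e" "w \<in> {..<n} - e" "nsets (insert v e) 2 = nsets (insert w e) 2"
    have "insert v e = insert w e"
      by (rule inj_onD[OF inj_nsets_2 vw(3)]) (use vw e in auto)
    then show "v = w" using vw by auto
  qed
  then show "card {h \<in> K_tri n. e \<in> h} = n - 2"
    unfolding eq using e by (simp add: card_image card_Diff_subset)
qed

text \<open>\<open>num_triangles\<close> ranges over triples of arbitrary naturals, but a triple is
  the union of its edges, so triples with all edges in \<open>U\<close> lie in
  \<open>{..<n}\<close>.\<close>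

lemma num_triangles_eq:
  assumes "U \<subseteq> K_edges n"
  shows "num_triangles U = card {h \<in> K_tri n. h \<subseteq> U}"
proof -
  have "T \<subseteq> {..<n}" if "card T = 3" "nsets T 2 \<subseteq> U" for T
  proof -
    have "nsets T 2 \<subseteq> nsets {..<n} 2" using that(2) assms unfolding K_edges_def by blast
    then have "\<Union> (nsets T 2) \<subseteq> \<Union> (nsets {..<n} 2)" by (rule Union_mono)
    also have "\<dots> \<subseteq> {..<n}" by (auto simp: nsets_def)
    finally show ?thesis using Union_nsets_2[OF that(1)] by simp
  qed
  then have "{h \<in> K_tri n. h \<subseteq> U} = (\<lambda>T. nsets T 2) ` {T. card T = 3 \<and> nsets T 2 \<subseteq> U}"
    by (auto simp: K_tri_def nsets_def card_ge_0_finite)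
  moreover have "inj_on (\<lambda>T. nsets T 2) {T. card T = 3 \<and> nsets T 2 \<subseteq> U}"
    by (rule inj_on_subset[OF inj_nsets_2]) auto
  ultimately show ?thesis unfolding num_triangles_def by (simp add: card_image)
qed

lemma pmf_gnp:
  assumes p: "0 < p" "p < 1" and U: "U \<subseteq> K_edges n"
  shows "pmf (gnp n p) U = (1 - p) ^ card (K_edges n) * (p / (1 - p)) ^ card U"
proof -
  let ?E = "nsets {..<n} 2"
  have finE: "finite ?E" using finite_K_edges unfolding K_edges_def .
  have UE: "U \<subseteq> ?E" using U unfolding K_edges_def .
  have finU: "finite U" using finE UE finite_subset by auto
  let ?P = "Pi_pmf ?E False (\<lambda>_. bernoulli_pmf p)"
  have "pmf (gnp n p) U = measure_pmf.prob ?P ((\<lambda>f. {e \<in> ?E. f e}) -` {U})"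
    unfolding gnp_def pmf_map by simp
  \<comment> \<open>\<open>Pi_pmf\<close> assigns \<open>False\<close> outside the edge set, so
    almost surely only the membership predicate of \<open>U\<close> is mapped to
    \<open>U\<close>.\<close>
  also have "\<dots> = measure_pmf.prob ?P {\<lambda>e. e \<in> U}"
  proof (rule measure_pmf.finite_measure_eq_AE)
    show "AE f in measure_pmf ?P. (f \<in> (\<lambda>f. {e \<in> ?E. f e}) -` {U}) = (f \<in> {\<lambda>e. e \<in> U})"
    proof (rule AE_pmfI)
      fix f assume "f \<in> set_pmf ?P"
      then have "f e = False" if "e \<notin> ?E" for e
        using set_Pi_pmf_subset[OF finE, of False "\<lambda>_. bernoulli_pmf p"] that by auto
      then show "(f \<in> (\<lambda>f. {e \<in> ?E. f e}) -` {U}) = (f \<in> {\<lambda>e. e \<in> U})"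
        using UE by (auto simp: fun_eq_iff)
    qed
  qed auto
  also have "\<dots> = pmf ?P (\<lambda>e. e \<in> U)" by (simp add: pmf.rep_eq)
  also have "\<dots> = (\<Prod>e\<in>?E. pmf (bernoulli_pmf p) (e \<in> U))"
    by (rule pmf_Pi') (use finE UE in auto)
  also have "\<dots> = (\<Prod>e\<in>U. pmf (bernoulli_pmf p) (e \<in> U)) * (\<Prod>e\<in>?E - U. pmf (bernoulli_pmf p) (e \<in> U))"
    using prod.subset_diff[OF UE finE, of "\<lambda>e. pmf (bernoulli_pmf p) (e \<in> U)"] by (simp add: mult.commute)
  also have "\<dots> = p ^ card U * (1 - p) ^ card (?E - U)" using p by simp
  also have "card (?E - U) = card ?E - card U" using finU UE by (rule card_Diff_subset)
  also have "p ^ card U * (1 - p) ^ (card ?E - card U) = (1 - p) ^ card ?E * (p / (1 - p)) ^ card U"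
    using p card_mono[OF finE UE] by (simp add: power_divide power_diff)
  finally show ?thesis unfolding K_edges_def .
qed

lemma gnp_support: "set_pmf (gnp n p) \<subseteq> Pow (K_edges n)"
  unfolding gnp_def K_edges_def by auto

text \<open>Without penalty the Gibbs weights are proportional to the probabilities of G(n,p), the
  activity being the odds of p. Taking \<open>f = 1\<close> identifies the constant as the inverse
  of the partition function.\<close>

lemma expectation_gnp:
  assumes p: "0 < p" "p < 1"
  shows "measure_pmf.expectation (gnp n p) f =
    gsum (K_edges n) 0 (\<lambda>_. p / (1 - p)) {} (K_tri n) f / gsum (K_edges n) 0 (\<lambda>_. p / (1 - p)) {} (K_tri n) (\<lambda>_. 1)"
proof -
  let ?C = "(1 - p) ^ card (K_edges n)"
  have ex: "measure_pmf.expectation (gnp n p) f = ?C * gsum (K_edges n) 0 (\<lambda>_. p / (1 - p)) {} (K_tri n) f" for f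
  proof -
    have "measure_pmf.expectation (gnp n p) f = (\<Sum>U\<in>Pow (K_edges n). pmf (gnp n p) U *\<^sub>R f U)"
    proof (rule integral_measure_pmf)
      show "finite (Pow (K_edges n))" using finite_K_edges by simp
      show "U \<in> Pow (K_edges n)" if "U \<in> set_pmf (gnp n p)" for U
        using gnp_support[of n p] that by blast
    qed
    also have "\<dots> = (\<Sum>U\<in>Pow (K_edges n). ?C * (f U * gwt 0 (\<lambda>_. p / (1 - p)) {} (K_tri n) U))"
      by (intro sum.cong) (auto simp: pmf_gnp[OF p] gwt_def)
    finally show ?thesis by (simp add: gsum_def sum_distrib_left)
  qed
  define S where "S = gsum (K_edges n) 0 (\<lambda>_. p / (1 - p)) {} (K_tri n) f"
  define Z where "Z = gsum (K_edges n) 0 (\<lambda>_. p / (1 - p)) {} (K_tri n) (\<lambda>_. 1)"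
  have CZ: "?C * Z = 1" unfolding Z_def using ex[of "\<lambda>_. 1"] by simp
  then have "Z \<noteq> 0" by auto
  moreover have "?C * S * Z = (?C * Z) * S" by (simp only: mult_ac)
  ultimately show ?thesis
    unfolding ex[of f] S_def[symmetric] Z_def[symmetric] CZ by (simp add: eq_divide_eq)
qed

lemma prob_gnp:
  assumes p: "0 < p" "p < 1"
  shows "measure_pmf.prob (gnp n p) Q = gprob (K_edges n) 0 (\<lambda>_. p / (1 - p)) {} (K_tri n) (\<lambda>U. U \<in> Q)"
proof -
  have "measure_pmf.prob (gnp n p) Q = measure_pmf.expectation (gnp n p) (indicator Q)" by simp
  also have "(indicator Q :: nat set set \<Rightarrow> real) = (\<lambda>U. of_bool (U \<in> Q))" by (auto simp: indicator_def)
  finally show ?thesis by (simp add: expectation_gnp[OF p] gprob_def)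
qed

lemma expectation_triangles:
  assumes p: "0 < p" "p < 1"
  shows "measure_pmf.expectation (gnp n p) (\<lambda>U. real (num_triangles U)) =
    (\<Sum>h\<in>K_tri n. gprob (K_edges n) 0 (\<lambda>_. p / (1 - p)) {} (K_tri n) (\<lambda>U. h \<subseteq> U))"
proof -
  interpret linear_gibbs "K_edges n" 0 "K_tri n" "n - 2" by (rule linear_gibbs_K) auto
  have "S (\<lambda>_. p / (1 - p)) {} (K_tri n) (\<lambda>U. real (num_triangles U)) =
     S (\<lambda>_. p / (1 - p)) {} (K_tri n) (\<lambda>U. real (card {h \<in> K_tri n. h \<subseteq> U}))"
    by (rule gsum_cong) (simp add: num_triangles_eq)
  then show ?thesis unfolding expectation_gnp[OF p] by (simp add: mean_card finite_Tri)
qed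

text \<open>
  The price of passing from a hard bound on the number of triangles to a penalty is the probability,
  in the penalised model, that the triangle count is just below the bound. For z = 1 the factor with
  the logarithm is 1, as x - y = 0.
\<close>

lemma cond_gnp_le:
  fixes x y :: real
  assumes p: "0 < p" "p < 1" and z: "0 \<le> z" "z \<le> 1" and zx: "z = 1 \<Longrightarrow> x = 0 \<and> y = 0"
    and Q: "\<And>U. U \<subseteq> K_edges n \<Longrightarrow> U \<in> L \<longleftrightarrow> real (num_triangles U) \<le> x"
    and pos: "0 < gprob (K_edges n) z (\<lambda>_. p / (1 - p)) {} (K_tri n) (\<lambda>U. y \<le> num_triangles U \<and> num_triangles U \<le> x)"
  shows "0 < measure_pmf.prob (gnp n p) L"
    and "measure_pmf.prob (gnp n p) (B \<inter> L) / measure_pmf.prob (gnp n p) L \<le>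
     exp (- ln (1 - z) * (x - y)) * gprob (K_edges n) z (\<lambda>_. p / (1 - p)) {} (K_tri n) (\<lambda>U. U \<in> B) /
      gprob (K_edges n) z (\<lambda>_. p / (1 - p)) {} (K_tri n) (\<lambda>U. y \<le> num_triangles U \<and> num_triangles U \<le> x)"
proof -
  interpret z: linear_gibbs "K_edges n" z "K_tri n" "n - 2" by (rule linear_gibbs_K[OF z])
  interpret o: linear_gibbs "K_edges n" 0 "K_tri n" "n - 2" by (rule linear_gibbs_K) auto
  define lam :: "nat set \<Rightarrow> real" where "lam = (\<lambda>_. p / (1 - p))"
  have lam: "\<And>v. 0 \<le> lam v" using p unfolding lam_def by auto
  define X where "X U = real (num_triangles U)" for U :: "nat set set"
  define v where "v U = gwt 0 lam {} (K_tri n) U" for U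
  define w where "w U = gwt z lam {} (K_tri n) U" for U
  \<comment> \<open>For z < 1 the weights with and without penalty differ by the factor exp (- L' X
    U). Comparing X U with \<open>x\<close> from above and with \<open>y\<close> from below gives
    \<open>up\<close> and \<open>lo\<close>.\<close>
  define L' where "L' = - ln (1 - z)"
  have v0: "0 \<le> v U" if "U \<subseteq> K_edges n" for U using o.gwt_nonneg[OF lam that] unfolding v_def .
  have w0: "0 \<le> w U" if "U \<subseteq> K_edges n" for U using z.gwt_nonneg[OF lam that] unfolding w_def .
  have wv: "w U = v U * (1 - z) ^ num_triangles U" if "U \<subseteq> K_edges n" for U
    unfolding w_def v_def gwt_def using num_triangles_eq[OF that] by simp
  have up: "v U \<le> exp (L' * x) * w U" if U: "U \<subseteq> K_edges n" "X U \<le> x" for U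
  proof (cases "z = 1")
    case True
    then have "num_triangles U = 0" using zx U unfolding X_def by auto
    then show ?thesis using True zx wv[OF U(1)] by simp
  next
    case False
    have "(1 - z) ^ num_triangles U = exp (- (L' * X U))"
      unfolding L'_def X_def using False z by (simp add: exp_of_nat_mult mult.commute[of "ln _"])
    then have "exp (L' * x) * w U = v U * exp (L' * (x - X U))"
      using wv[OF U(1)] by (simp add: algebra_simps flip: exp_add)
    moreover have "0 \<le> L'" using False z unfolding L'_def by simp
    then have "0 \<le> L' * (x - X U)" using U by simp
    ultimately show ?thesis using v0[OF U(1)] by (simp add: mult_le_cancel_left1)
  qed
  have lo: "exp (L' * y) * w U \<le> v U" if U: "U \<subseteq> K_edges n" "y \<le> X U" "X U \<le> x" for U
  proof (cases "z = 1")
    case True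
    then have "num_triangles U = 0" using zx U unfolding X_def by auto
    then show ?thesis using True zx wv[OF U(1)] by simp
  next
    case False
    have "(1 - z) ^ num_triangles U = exp (- (L' * X U))"
      unfolding L'_def X_def using False z by (simp add: exp_of_nat_mult mult.commute[of "ln _"])
    then have "exp (L' * y) * w U = v U * exp (L' * (y - X U))"
      using wv[OF U(1)] by (simp add: algebra_simps flip: exp_add)
    moreover have "0 \<le> L'" using False z unfolding L'_def by simp
    then have "L' * (y - X U) \<le> 0" using U by (simp add: mult_nonneg_nonpos)
    ultimately show ?thesis using v0[OF U(1)] by (simp add: mult_left_le)
  qed
  define Zo where "Zo = o.Z lam {} (K_tri n)"
  define Zz where "Zz = z.Z lam {} (K_tri n)"
  have no: "\<not> h \<subseteq> {}" if "h \<in> K_tri n" for h using o.tri_card[OF that] by auto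
  have Zp: "0 < Zo" "0 < Zz"
    using o.Z_ge_1[of lam "K_tri n" "{}"] z.Z_ge_1[of lam "K_tri n" "{}"] lam no unfolding Zo_def Zz_def by force+
  define gB where "gB = z.P lam {} (K_tri n) (\<lambda>U. U \<in> B)"
  define gy where "gy = z.P lam {} (K_tri n) (\<lambda>U. y \<le> num_triangles U \<and> num_triangles U \<le> x)"
  have gy: "0 < gy" using pos unfolding gy_def lam_def .
  have pr: "measure_pmf.prob (gnp n p) A = (\<Sum>U\<in>Pow (K_edges n). of_bool (U \<in> A) * v U) / Zo" for A
    unfolding prob_gnp[OF p] gprob_def Zo_def lam_def v_def gsum_def by simp
  have gB': "(\<Sum>U\<in>Pow (K_edges n). of_bool (U \<in> B) * w U) = gB * Zz"
    unfolding gB_def gprob_def w_def Zz_def[symmetric] using Zp by (simp add: gsum_def)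
  have gy': "(\<Sum>U\<in>Pow (K_edges n). of_bool (y \<le> X U \<and> X U \<le> x) * w U) = gy * Zz"
    unfolding gy_def gprob_def w_def X_def Zz_def[symmetric] using Zp by (simp add: gsum_def)
  have "exp (L' * y) * (gy * Zz) \<le> (\<Sum>U\<in>Pow (K_edges n). of_bool (U \<in> L) * v U)"
    unfolding gy'[symmetric] sum_distrib_left
    by (rule sum_mono) (use lo v0 Q in \<open>auto simp: X_def\<close>)
  then have l: "exp (L' * y) * (gy * Zz) / Zo \<le> measure_pmf.prob (gnp n p) L"
    unfolding pr using Zp by (intro divide_right_mono) auto
  have l0: "0 < exp (L' * y) * (gy * Zz) / Zo" using gy Zp by simp
  show "0 < measure_pmf.prob (gnp n p) L" using l l0 by linarith
  have "(\<Sum>U\<in>Pow (K_edges n). of_bool (U \<in> B \<inter> L) * v U) \<le> exp (L' * x) * (gB * Zz)"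
    unfolding gB'[symmetric] sum_distrib_left
    by (rule sum_mono) (use up v0 w0 Q in \<open>auto simp: X_def\<close>)
  then have u: "measure_pmf.prob (gnp n p) (B \<inter> L) \<le> exp (L' * x) * (gB * Zz) / Zo"
    unfolding pr using Zp by (intro divide_right_mono) auto
  have "measure_pmf.prob (gnp n p) (B \<inter> L) / measure_pmf.prob (gnp n p) L \<le>
     (exp (L' * x) * (gB * Zz) / Zo) / (exp (L' * y) * (gy * Zz) / Zo)"
    by (rule frac_le) (use u l l0 in \<open>auto intro: order_trans[OF measure_nonneg]\<close>)
  also have "\<dots> = exp (L' * (x - y)) * gB / gy"
    using Zp gy by (simp add: right_diff_distrib exp_diff)
  finally show "measure_pmf.prob (gnp n p) (B \<inter> L) / measure_pmf.prob (gnp n p) L \<le>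
     exp (- ln (1 - z) * (x - y)) * gprob (K_edges n) z (\<lambda>_. p / (1 - p)) {} (K_tri n) (\<lambda>U. U \<in> B) /
      gprob (K_edges n) z (\<lambda>_. p / (1 - p)) {} (K_tri n) (\<lambda>U. y \<le> num_triangles U \<and> num_triangles U \<le> x)"
    unfolding L'_def gB_def gy_def lam_def .
qed

section \<open>Concentration in the penalised model\<close>

lemma nd_filter_extract:
  assumes "\<forall>\<^sub>F x in nd_filter. Q x" "0 < c"
  obtains \<delta> N where "0 < \<delta>" "\<delta> < c" "\<And>n. n \<ge> N \<Longrightarrow> Q (n, \<delta>)"
proof -
  obtain Pf Pg where P: "eventually Pf sequentially" "eventually Pg (at_right 0)" "\<And>x y. Pf x \<Longrightarrow> Pg y \<Longrightarrow> Q (x, y)"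
    using assms(1) unfolding eventually_prod_filter by auto
  have "eventually (\<lambda>x. x \<in> {0<..<c}) (at_right 0)" by (rule eventually_at_right_real[OF assms(2)])
  with P(2) have "eventually (\<lambda>x. Pg x \<and> x \<in> {0<..<c}) (at_right 0)" by eventually_elim auto
  then obtain \<delta> where "Pg \<delta>" "0 < \<delta>" "\<delta> < c"
    using eventually_happens'[of "at_right (0::real)"] by auto
  moreover obtain N where "\<And>n. n \<ge> N \<Longrightarrow> Pf n" using P(1) unfolding eventually_sequentially by auto
  ultimately show thesis using that P(3) by blast
qed

text \<open>The window of parameters on which marginals and triangle counts are controlled; tilted
  models have to stay inside it.\<close>

definition near :: "real \<Rightarrow> real \<Rightarrow> nat \<Rightarrow> real \<Rightarrow> real \<Rightarrow> (nat set \<Rightarrow> real) \<Rightarrow> bool" where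
  "near c \<zeta> n \<delta> z lam \<longleftrightarrow> 0 \<le> z \<and> z \<le> 1 \<and> \<bar>z - \<zeta>\<bar> \<le> \<delta> \<and>
     (\<forall>e\<in>K_edges n. (c - \<delta>) / sqrt n \<le> lam e \<and> lam e \<le> (c + \<delta>) / sqrt n)"

lemma near_nonneg: "near c \<zeta> n \<delta> z lam \<Longrightarrow> \<delta> \<le> c \<Longrightarrow> e \<in> K_edges n \<Longrightarrow> 0 \<le> lam e"
  unfolding near_def by (meson diff_ge_0_iff_ge order_trans real_sqrt_ge_zero of_nat_0_le_iff divide_nonneg_nonneg)

lemma card_K_edges: "card (K_edges n) = n choose 2"
proof -
  have "K_edges n = {T. T \<subseteq> {..<n} \<and> card T = 2}"
    unfolding K_edges_def by (auto simp: nsets_def intro: finite_subset)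
  then show ?thesis by (simp add: n_subsets)
qed

lemma card_K_edges_le: "2 * real (card (K_edges n)) \<le> (real n)\<^sup>2"
proof -
  have "2 * real (n choose 2) = real n * (real n - 1)"
    by (simp add: binomial_gbinomial gbinomial_prod_rev numeral_eq_Suc fact_numeral)
  also have "\<dots> \<le> real n * real n" by (intro mult_left_mono) auto
  finally show ?thesis unfolding card_K_edges by (simp add: power2_eq_square)
qed

lemma choose_3_bounds:
  assumes "n \<ge> 2"
  shows "(real n - 2) ^ 3 \<le> 6 * real (n choose 3)" "6 * real (n choose 3) \<le> real n ^ 3"
proof -
  have "6 * real (n choose 3) = real n * (real n - 1) * (real n - 2)"
    by (simp add: binomial_gbinomial gbinomial_prod_rev numeral_eq_Suc fact_numeral)
  moreover have "(real n - 2) * (real n - 2) * (real n - 2) \<le> real n * (real n - 1) * (real n - 2)"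
    using assms by (intro mult_mono) auto
  moreover have "real n * (real n - 1) * (real n - 2) \<le> real n * real n * real n"
    using assms by (intro mult_mono) auto
  ultimately show "(real n - 2) ^ 3 \<le> 6 * real (n choose 3)" "6 * real (n choose 3) \<le> real n ^ 3"
    by (auto simp: power3_eq_cube)
qed

text \<open>\<open>q0\<close> is the limit of sqrt n times an edge marginal. Keeping it a parameter
  lets G(n,p) itself be an instance, with \<open>\<zeta> = 0\<close> and
  \<open>q0 = c\<close>.\<close>

locale subcritical =
  fixes c \<zeta> q0 :: real
  assumes c_pos: "0 < c" and zeta: "0 \<le> \<zeta>" "\<zeta> \<le> 1" and contr: "2 * \<zeta> * c\<^sup>2 < 1"
    and q0_nonneg: "0 \<le> q0" and q0_eq: "q0 = c * exp (- (\<zeta> * q0\<^sup>2))"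
begin

lemma marg_near:
  assumes "0 < \<epsilon>"
  obtains \<delta> N where "0 < \<delta>" "\<delta> < c"
    "\<And>n z lam e. n \<ge> N \<Longrightarrow> near c \<zeta> n \<delta> z lam \<Longrightarrow> e \<in> K_edges n \<Longrightarrow>
       \<bar>sqrt n * gprob (K_edges n) z lam {} (K_tri n) (\<lambda>U. e \<in> U) - q0\<bar> \<le> \<epsilon>"
proof -
  obtain \<delta> N where d: "0 < \<delta>" "\<delta> < c" "\<And>n. n \<ge> N \<Longrightarrow> marg_within c \<zeta> 0 n \<delta> (q0 - \<epsilon>) (q0 + \<epsilon>)"
    using nd_filter_extract[OF marg_within_limit[OF c_pos zeta(1) contr q0_nonneg q0_eq assms, of 0] c_pos]
    by auto
  show thesis
  proof (rule that[OF d(1,2)])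
    fix n z lam e assume n: "n \<ge> N" "near c \<zeta> n \<delta> z lam" "e \<in> K_edges n"
    interpret linear_gibbs "K_edges n" z "K_tri n" "n - 2"
      by (rule linear_gibbs_K) (use n near_def in auto)
    have a: "adm ((c - \<delta>) / sqrt n) ((c + \<delta>) / sqrt n) 0 lam {} (K_tri n) {}"
      by (rule adm_unconditioned) (use n d near_def in auto)
    have z: "\<bar>z - \<zeta>\<bar> \<le> \<delta>" and e: "e \<in> K_edges n - {}" using n near_def by auto
    show "\<bar>sqrt n * gprob (K_edges n) z lam {} (K_tri n) (\<lambda>U. e \<in> U) - q0\<bar> \<le> \<epsilon>"
      using d(3)[OF n(1), unfolded marg_within_def, rule_format, OF linear_gibbs_axioms z a e]
      by linarith
  qed
qed

text \<open>About n^3 / 6 triangles, each present with probability about (1 - \<zeta>) (q0 / sqrt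
  n)^3, where 1 - \<zeta> is the penalty of the triangle itself.\<close>

lemma triangles_near:
  assumes "0 < \<epsilon>"
  obtains \<delta> N where "0 < \<delta>" "\<delta> < c"
    "\<And>n z lam. n \<ge> N \<Longrightarrow> near c \<zeta> n \<delta> z lam \<Longrightarrow>
       \<bar>(\<Sum>h\<in>K_tri n. gprob (K_edges n) z lam {} (K_tri n) (\<lambda>U. h \<subseteq> U)) - (1 - \<zeta>) * q0 ^ 3 / 6 * sqrt n ^ 3\<bar> \<le> \<epsilon> * sqrt n ^ 3"
proof -
  define L where "L = (1 - \<zeta>) * q0 ^ 3 / 6"
  note id0 = tendsto_ident_at[of "0 :: real" "{0<..}"]
  have "((\<lambda>x. (1 - \<zeta>) * (q0 + x) ^ 3 / 6) \<longlongrightarrow> (1 - \<zeta>) * (q0 + 0) ^ 3 / 6) (at_right 0)"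
    by (intro tendsto_intros id0) simp
  then have t1: "\<forall>\<^sub>F x in at_right 0. (1 - \<zeta>) * (q0 + x) ^ 3 / 6 < L + \<epsilon>"
    by (rule order_tendstoD(2)) (use assms in \<open>simp add: L_def\<close>)
  have "((\<lambda>x. (1 - \<zeta>) * (max 0 (q0 - x)) ^ 3 / 6) \<longlongrightarrow> (1 - \<zeta>) * (max 0 (q0 - 0)) ^ 3 / 6) (at_right 0)"
    by (intro tendsto_intros id0) simp
  then have t2: "\<forall>\<^sub>F x in at_right 0. L - \<epsilon> < (1 - \<zeta>) * (max 0 (q0 - x)) ^ 3 / 6"
    by (rule order_tendstoD(1)) (use assms q0_nonneg in \<open>simp add: L_def max_absorb2\<close>)
  have "\<forall>\<^sub>F x::real in at_right 0. x > 0" by (rule eventually_at_right_less)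
  with t1 t2 have "\<forall>\<^sub>F x in at_right 0. x > 0 \<and> (1 - \<zeta>) * (q0 + x) ^ 3 / 6 < L + \<epsilon> \<and>
     L - \<epsilon> < (1 - \<zeta>) * (max 0 (q0 - x)) ^ 3 / 6" by eventually_elim auto
  then obtain \<epsilon>1 where e1: "\<epsilon>1 > 0" "(1 - \<zeta>) * (q0 + \<epsilon>1) ^ 3 / 6 < L + \<epsilon>"
     "L - \<epsilon> < (1 - \<zeta>) * (max 0 (q0 - \<epsilon>1)) ^ 3 / 6"
    using eventually_happens'[of "at_right (0::real)"] by auto
  define a where "a = max 0 (q0 - \<epsilon>1)"
  define b where "b = q0 + \<epsilon>1"
  have ab: "0 \<le> a" "0 \<le> b" unfolding a_def b_def using q0_nonneg e1 by auto
  define Up where "Up x = (1 - \<zeta> + snd x) * b ^ 3 / (1 - (b * (1 / sqrt (fst x))) ^ 3) / 6" for x :: "nat \<times> real"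
  define Lo where "Lo x = (1 - 2 * (1 / real (fst x))) ^ 3 * (max 0 (1 - \<zeta> - snd x) * a ^ 3 / 6)" for x :: "nat \<times> real"
  have "(Up \<longlongrightarrow> (1 - \<zeta> + 0) * b ^ 3 / (1 - (b * 0) ^ 3) / 6) nd_filter"
    unfolding Up_def by (intro tendsto_intros nd_snd nd_inv_sqrt) auto
  then have u: "\<forall>\<^sub>F x in nd_filter. Up x < L + \<epsilon>"
    by (rule order_tendstoD(2)) (use e1 in \<open>simp add: b_def\<close>)
  have "(Lo \<longlongrightarrow> (1 - 2 * 0) ^ 3 * (max 0 (1 - \<zeta> - 0) * a ^ 3 / 6)) nd_filter"
    unfolding Lo_def by (intro tendsto_intros nd_snd nd_inv) auto
  then have l: "\<forall>\<^sub>F x in nd_filter. L - \<epsilon> < Lo x"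
    by (rule order_tendstoD(1)) (use e1 zeta in \<open>simp add: a_def max_absorb2\<close>)
  have "((\<lambda>x. b * (1 / sqrt (real (fst x)))) \<longlongrightarrow> b * 0) nd_filter"
    by (intro tendsto_intros nd_inv_sqrt)
  then have s1: "\<forall>\<^sub>F x in nd_filter. b * (1 / sqrt (real (fst x))) < 1"
    by (rule order_tendstoD(2)) simp
  have "\<forall>\<^sub>F x in nd_filter. Up x < L + \<epsilon> \<and> L - \<epsilon> < Lo x \<and> b * (1 / sqrt (real (fst x))) < 1 \<and>
     marg_within c \<zeta> 7 (fst x) (snd x) (q0 - \<epsilon>1) b \<and> 2 \<le> fst x"
    using u l s1 marg_within_limit[OF c_pos zeta(1) contr q0_nonneg q0_eq e1(1), of 7] nd_fst_ge[of 2]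
    unfolding b_def by eventually_elim auto
  note ev = this
  obtain \<delta> N where dd: "0 < \<delta>" "\<delta> < c" "\<And>n. n \<ge> N \<Longrightarrow> Up (n, \<delta>) < L + \<epsilon> \<and> L - \<epsilon> < Lo (n, \<delta>) \<and>
     b * (1 / sqrt (real (fst (n, \<delta>)))) < 1 \<and>
     marg_within c \<zeta> 7 (fst (n, \<delta>)) (snd (n, \<delta>)) (q0 - \<epsilon>1) b \<and> 2 \<le> fst (n, \<delta>)"
    by (rule nd_filter_extract[OF ev c_pos]) (blast intro: that)
  note d = dd[unfolded fst_conv snd_conv]
  show thesis
  proof (rule that[OF d(1,2)])
    fix n z lam assume n: "n \<ge> N" and nr: "near c \<zeta> n \<delta> z lam"
    interpret linear_gibbs "K_edges n" z "K_tri n" "n - 2"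
      by (rule linear_gibbs_K) (use nr near_def in auto)
    note dn = d(3)[OF n]
    define s where "s = sqrt (real n)"
    have n2: "2 \<le> n" using dn by auto
    have s: "0 < s" "s\<^sup>2 = real n" using n2 by (auto simp: s_def)
    have s6: "real n ^ 3 = s ^ 3 * s ^ 3" unfolding s(2)[symmetric] by (simp flip: power_add power_mult)
    have z: "\<bar>z - \<zeta>\<bar> \<le> \<delta>" using nr near_def by auto
    have bd: "a / s \<le> marg lam A H x \<and> marg lam A H x \<le> b / s"
      if "adm ((c - \<delta>) / s) ((c + \<delta>) / s) 7 lam A H D" "x \<in> K_edges n - D" for lam A H D x
    proof -
      have "q0 - \<epsilon>1 \<le> s * marg lam A H x" "s * marg lam A H x \<le> b"
        using dn that linear_gibbs_axioms z unfolding marg_within_def s_def by blast+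
      moreover have "0 \<le> s * marg lam A H x"
        using marg_trivial(1)[OF that] s by simp
      ultimately show ?thesis using s unfolding a_def by (simp add: field_simps)
    qed
    have lu: "0 \<le> (c - \<delta>) / s" "\<And>v. v \<in> K_edges n \<Longrightarrow> (c - \<delta>) / s \<le> lam v \<and> lam v \<le> (c + \<delta>) / s"
      using d s nr unfolding near_def s_def by auto
    have ab': "0 \<le> a / s" "0 \<le> b / s" "b / s < 1" using ab s dn unfolding s_def by auto
    have T1: "(1 - z) * (a / s) ^ 3 \<le> P lam {} (K_tri n) (\<lambda>U. T \<subseteq> U)" if "T \<in> K_tri n" for T
      by (rule gprob_triangle_bounds(1)[OF that lu(1) _ ab']) (erule lu(2), erule (1) bd)
    have T2: "P lam {} (K_tri n) (\<lambda>U. T \<subseteq> U) \<le> (1 - z) * (b / s) ^ 3 / (1 - (b / s) ^ 3)" if "T \<in> K_tri n" for T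
      by (rule gprob_triangle_bounds(2)[OF that lu(1) _ ab']) (erule lu(2), erule (1) bd)
    have b3: "0 < 1 - (b / s) ^ 3" using ab' power_strict_mono[of "b / s" 1 3] by simp
    have "(\<Sum>h\<in>K_tri n. P lam {} (K_tri n) (\<lambda>U. h \<subseteq> U)) \<le> (\<Sum>h\<in>K_tri n. (1 - z) * (b / s) ^ 3 / (1 - (b / s) ^ 3))"
      by (intro sum_mono T2)
    also have "\<dots> = real (n choose 3) * ((1 - z) * (b / s) ^ 3 / (1 - (b / s) ^ 3))" by (simp add: card_K_tri)
    also have "\<dots> \<le> (s ^ 3 * s ^ 3 / 6) * ((1 - \<zeta> + \<delta>) * (b / s) ^ 3 / (1 - (b / s) ^ 3))"
      using choose_3_bounds[OF n2] z b3 ab' z01 s unfolding s6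
      by (intro mult_mono divide_right_mono mult_right_mono) auto
    also have "\<dots> = Up (n, \<delta>) * s ^ 3"
    proof -
      define D where "D = 1 - (b / s) ^ 3"
      have U: "Up (n, \<delta>) = (1 - \<zeta> + \<delta>) * b ^ 3 / D / 6" unfolding Up_def D_def s_def by simp
      have bs: "(b / s) ^ 3 = b ^ 3 / s ^ 3" by (rule power_divide)
      have gen: "(t * t / 6) * (k * (B / t) / d) = k * B / d / 6 * t" if "t \<noteq> 0" for t k B d :: real
        using that by (cases "d = 0") (auto simp: field_simps)
      show ?thesis unfolding U D_def[symmetric] unfolding bs by (rule gen) (use s(1) in simp)
    qed
    also have "\<dots> \<le> (L + \<epsilon>) * s ^ 3" using dn s by (intro mult_right_mono) auto
    finally have 1: "(\<Sum>h\<in>K_tri n. P lam {} (K_tri n) (\<lambda>U. h \<subseteq> U)) \<le> (L + \<epsilon>) * s ^ 3" .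
    have "(L - \<epsilon>) * s ^ 3 \<le> Lo (n, \<delta>) * s ^ 3" using dn s by (intro mult_right_mono) auto
    also have "\<dots> = ((real n - 2) ^ 3 / 6) * (max 0 (1 - \<zeta> - \<delta>) * (a / s) ^ 3)"
    proof -
      have "real n - 2 = s\<^sup>2 * (1 - 2 * (1 / real n))" using s n2 by (simp add: field_simps)
      then have n3: "(real n - 2) ^ 3 = s ^ 3 * s ^ 3 * (1 - 2 * (1 / real n)) ^ 3"
        by (simp add: power_mult_distrib flip: power_add power_mult)
      have gen: "x * (k * A / 6) * t = (t * t * x / 6) * (k * (A / t))" if "t \<noteq> 0" for t x k A :: real
        using that by simp
      show ?thesis unfolding Lo_def n3 power_divide fst_conv snd_conv by (rule gen) (use s(1) in simp)
    qed
    also have "\<dots> \<le> real (n choose 3) * ((1 - z) * (a / s) ^ 3)"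
      using choose_3_bounds[OF n2] z ab' z01 n2
      by (intro mult_mono mult_right_mono) auto
    also have "\<dots> = (\<Sum>h\<in>K_tri n. (1 - z) * (a / s) ^ 3)" by (simp add: card_K_tri)
    also have "\<dots> \<le> (\<Sum>h\<in>K_tri n. P lam {} (K_tri n) (\<lambda>U. h \<subseteq> U))" by (intro sum_mono T1)
    finally have 2: "(L - \<epsilon>) * s ^ 3 \<le> (\<Sum>h\<in>K_tri n. P lam {} (K_tri n) (\<lambda>U. h \<subseteq> U))" .
    show "\<bar>(\<Sum>h\<in>K_tri n. P lam {} (K_tri n) (\<lambda>U. h \<subseteq> U)) - (1 - \<zeta>) * q0 ^ 3 / 6 * sqrt n ^ 3\<bar> \<le> \<epsilon> * sqrt n ^ 3"
      using 1 2 unfolding L_def[symmetric] s_def[symmetric] by (simp add: abs_le_iff algebra_simps)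
  qed
qed

text \<open>Tilting by a small fixed \<open>t\<close> keeps sqrt n times each marginal within
  \<epsilon> / 2 of \<open>q0\<close>. The total weight is at most n^2, so the tilted mean moves by
  at most half of the deviation, and the other half gives the exponent
  \<open>\<kappa> = t * \<epsilon> / 2\<close>.\<close>

lemma weighted_size_concentration:
  assumes "0 < \<epsilon>"
  obtains \<delta> \<kappa> N where "0 < \<delta>" "0 < \<kappa>"
    "\<And>n z lam w. n \<ge> N \<Longrightarrow> near c \<zeta> n \<delta> z lam \<Longrightarrow> (\<And>e. e \<in> K_edges n \<Longrightarrow> 0 \<le> w e \<and> w e \<le> (2::real)) \<Longrightarrow>
       gprob (K_edges n) z lam {} (K_tri n) (\<lambda>U. \<epsilon> * sqrt n ^ 3 \<le> \<bar>(\<Sum>e\<in>U. w e) - q0 / sqrt n * (\<Sum>e\<in>K_edges n. w e)\<bar>)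
         \<le> 2 * exp (- \<kappa> * sqrt n ^ 3)"
proof -
  have e2: "0 < \<epsilon> / 2" using assms by simp
  obtain \<delta>1 N where d: "0 < \<delta>1" "\<delta>1 < c"
    "\<And>n z lam e. n \<ge> N \<Longrightarrow> near c \<zeta> n \<delta>1 z lam \<Longrightarrow> e \<in> K_edges n \<Longrightarrow>
       \<bar>sqrt n * gprob (K_edges n) z lam {} (K_tri n) (\<lambda>U. e \<in> U) - q0\<bar> \<le> \<epsilon> / 2"
    using marg_near[OF e2] by metis
  \<comment> \<open>The other half of the window is left to the tilt.\<close>
  define \<delta> where "\<delta> = \<delta>1 / 2"
  note id0 = tendsto_ident_at[of "0 :: real" "{0<..}"]
  have "((\<lambda>t. (c + \<delta>) * exp (2 * t)) \<longlongrightarrow> (c + \<delta>) * exp (2 * 0)) (at_right 0)"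
    by (intro tendsto_intros id0)
  then have t1: "\<forall>\<^sub>F t in at_right 0. (c + \<delta>) * exp (2 * t) < c + \<delta>1"
    by (rule order_tendstoD(2)) (use d \<delta>_def in simp)
  have "((\<lambda>t. (c - \<delta>) * exp (- (2 * t))) \<longlongrightarrow> (c - \<delta>) * exp (- (2 * 0))) (at_right 0)"
    by (intro tendsto_intros id0)
  then have t2: "\<forall>\<^sub>F t in at_right 0. c - \<delta>1 < (c - \<delta>) * exp (- (2 * t))"
    by (rule order_tendstoD(1)) (use d \<delta>_def in simp)
  have "\<forall>\<^sub>F x::real in at_right 0. x > 0" by (rule eventually_at_right_less)
  with t1 t2 have "\<forall>\<^sub>F t in at_right 0. t > 0 \<and> (c + \<delta>) * exp (2 * t) < c + \<delta>1 \<and> c - \<delta>1 < (c - \<delta>) * exp (- (2 * t))"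
    by eventually_elim auto
  then obtain t where t: "t > 0" "(c + \<delta>) * exp (2 * t) < c + \<delta>1" "c - \<delta>1 < (c - \<delta>) * exp (- (2 * t))"
    using eventually_happens'[of "at_right (0::real)"] by auto
  have tilt: "near c \<zeta> n \<delta>1 z (\<lambda>e. lam e * exp (r e))"
    if nr: "near c \<zeta> n \<delta> z lam" and r: "\<And>e. e \<in> K_edges n \<Longrightarrow> \<bar>r e\<bar> \<le> 2 * t" for n z lam r
    unfolding near_def
  proof (intro conjI ballI)
    show "0 \<le> z" "z \<le> 1" "\<bar>z - \<zeta>\<bar> \<le> \<delta>1" using nr d unfolding near_def \<delta>_def by auto
    fix e assume e: "e \<in> K_edges n"
    have l: "(c - \<delta>) / sqrt n \<le> lam e" "lam e \<le> (c + \<delta>) / sqrt n" "0 \<le> (c - \<delta>) / sqrt n" "0 \<le> (c + \<delta>) / sqrt n"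
      using nr e d unfolding near_def \<delta>_def by auto
    have "(c - \<delta>1) / sqrt n \<le> (c - \<delta>) * exp (- (2 * t)) / sqrt n"
      using t by (intro divide_right_mono) auto
    also have "\<dots> = (c - \<delta>) / sqrt n * exp (- (2 * t))" by simp
    also have "\<dots> \<le> lam e * exp (r e)" using l r[OF e] by (intro mult_mono) auto
    finally show "(c - \<delta>1) / sqrt n \<le> lam e * exp (r e)" .
    have "lam e * exp (r e) \<le> (c + \<delta>) / sqrt n * exp (2 * t)" using l r[OF e] by (intro mult_mono) auto
    also have "\<dots> = (c + \<delta>) * exp (2 * t) / sqrt n" by simp
    also have "\<dots> \<le> (c + \<delta>1) / sqrt n" using t by (intro divide_right_mono) auto
    finally show "lam e * exp (r e) \<le> (c + \<delta>1) / sqrt n" .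
  qed
  define \<kappa> where "\<kappa> = t * \<epsilon> / 2"
  show thesis
  proof (rule that)
    show "0 < \<delta>" "0 < \<kappa>" using d t assms unfolding \<delta>_def \<kappa>_def by auto
    fix n :: nat and z lam and w :: "nat set \<Rightarrow> real"
    assume n: "max N 1 \<le> n" and nr: "near c \<zeta> n \<delta> z lam"
      and w: "\<And>e. e \<in> K_edges n \<Longrightarrow> 0 \<le> w e \<and> w e \<le> 2"
    interpret linear_gibbs "K_edges n" z "K_tri n" "n - 2"
      by (rule linear_gibbs_K) (use nr near_def in auto)
    define s where "s = sqrt (real n)"
    have s: "0 < s" "s\<^sup>2 = real n" using n by (auto simp: s_def)
    have lam: "0 \<le> lam v" if "v \<in> K_edges n" for v
      by (rule near_nonneg[OF nr _ that]) (use d \<delta>_def in simp)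
    have no: "\<not> h \<subseteq> {}" if "h \<in> K_tri n" for h using tri_card[OF that] by auto
    define W where "W = (\<Sum>e\<in>K_edges n. w e)"
    have "W \<le> (\<Sum>e\<in>K_edges n. 2)" unfolding W_def using w by (intro sum_mono) auto
    also have "\<dots> \<le> (real n)\<^sup>2" using card_K_edges_le[of n] by (simp add: mult.commute)
    also have "\<dots> = s ^ 4" unfolding s(2)[symmetric] by (simp flip: power_mult)
    finally have W: "W \<le> s ^ 4" .
    have W0: "0 \<le> W" unfolding W_def using w by (intro sum_nonneg) auto
    have Ws: "\<epsilon> / 2 / s * W \<le> \<epsilon> / 2 * s ^ 3"
    proof -
      have "\<epsilon> / 2 / s * W \<le> \<epsilon> / 2 / s * s ^ 4" using W assms s by (intro mult_left_mono) auto
      also have "\<dots> = \<epsilon> / 2 * s ^ 3" using s by (simp add: power_eq_if)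
      finally show ?thesis .
    qed
    have mb: "(q0 - \<epsilon> / 2) / s \<le> marg lam' {} (K_tri n) e \<and> marg lam' {} (K_tri n) e \<le> (q0 + \<epsilon> / 2) / s"
      if "near c \<zeta> n \<delta>1 z lam'" "e \<in> K_edges n" for lam' e
    proof -
      have "\<bar>s * marg lam' {} (K_tri n) e - q0\<bar> \<le> \<epsilon> / 2"
        using d(3)[OF _ that] n unfolding s_def by simp
      then have "q0 - \<epsilon> / 2 \<le> s * marg lam' {} (K_tri n) e" "s * marg lam' {} (K_tri n) e \<le> q0 + \<epsilon> / 2"
        by linarith+
      then show ?thesis using s(1) by (simp only: pos_divide_le_eq pos_le_divide_eq mult.commute)
    qed
    have nr1: "near c \<zeta> n \<delta>1 z (\<lambda>e. lam e * exp (t * w e))"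
      by (rule tilt[OF nr]) (use w t in \<open>auto simp: abs_mult\<close>)
    have nr2: "near c \<zeta> n \<delta>1 z (\<lambda>e. lam e * exp (t * - w e))"
      by (rule tilt[OF nr]) (use w t in \<open>auto simp: abs_mult\<close>)
    have m1: "(\<Sum>e\<in>K_edges n. w e * marg (\<lambda>e. lam e * exp (t * w e)) {} (K_tri n) e) \<le> (q0 + \<epsilon> / 2) / s * W"
      unfolding W_def sum_distrib_left
    proof (rule sum_mono)
      fix e assume e: "e \<in> K_edges n"
      show "w e * marg (\<lambda>e. lam e * exp (t * w e)) {} (K_tri n) e \<le> (q0 + \<epsilon> / 2) / s * w e"
        unfolding mult.commute[of "(q0 + \<epsilon> / 2) / s"]
        by (rule mult_left_mono[OF conjunct2[OF mb[OF nr1 e]] conjunct1[OF w[OF e]]])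
    qed
    have m2: "(\<Sum>e\<in>K_edges n. - w e * marg (\<lambda>e. lam e * exp (t * - w e)) {} (K_tri n) e) \<le> - ((q0 - \<epsilon> / 2) / s * W)"
      unfolding W_def sum_distrib_left sum_negf[symmetric]
    proof (rule sum_mono)
      fix e assume e: "e \<in> K_edges n"
      show "- w e * marg (\<lambda>e. lam e * exp (t * - w e)) {} (K_tri n) e \<le> - ((q0 - \<epsilon> / 2) / s * w e)"
        unfolding mult.commute[of "(q0 - \<epsilon> / 2) / s"] mult_minus_left[of "w e"] neg_le_iff_le
        by (rule mult_left_mono[OF conjunct1[OF mb[OF nr2 e]] conjunct1[OF w[OF e]]])
    qed
    have "P lam {} (K_tri n) (\<lambda>U. q0 / s * W + \<epsilon> * s ^ 3 \<le> (\<Sum>e\<in>U. w e))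
      \<le> exp (t * ((\<Sum>e\<in>K_edges n. w e * marg (\<lambda>e. lam e * exp (t * w e)) {} (K_tri n) e) - (q0 / s * W + \<epsilon> * s ^ 3)))"
      by (rule weighted_size_tail) (use lam t no in auto)
    also have "\<dots> \<le> exp (- \<kappa> * s ^ 3)"
    proof -
      have "(\<Sum>e\<in>K_edges n. w e * marg (\<lambda>e. lam e * exp (t * w e)) {} (K_tri n) e) - (q0 / s * W + \<epsilon> * s ^ 3)
        \<le> - (\<epsilon> / 2 * s ^ 3)" using m1 Ws unfolding add_divide_distrib distrib_right by linarith
      then have "t * ((\<Sum>e\<in>K_edges n. w e * marg (\<lambda>e. lam e * exp (t * w e)) {} (K_tri n) e) - (q0 / s * W + \<epsilon> * s ^ 3))
        \<le> t * - (\<epsilon> / 2 * s ^ 3)" using t by (intro mult_left_mono) auto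
      then show ?thesis unfolding \<kappa>_def by simp
    qed
    finally have 1: "P lam {} (K_tri n) (\<lambda>U. q0 / s * W + \<epsilon> * s ^ 3 \<le> (\<Sum>e\<in>U. w e)) \<le> exp (- \<kappa> * s ^ 3)" .
    have "P lam {} (K_tri n) (\<lambda>U. - (q0 / s * W) + \<epsilon> * s ^ 3 \<le> (\<Sum>e\<in>U. - w e))
      \<le> exp (t * ((\<Sum>e\<in>K_edges n. - w e * marg (\<lambda>e. lam e * exp (t * - w e)) {} (K_tri n) e) - (- (q0 / s * W) + \<epsilon> * s ^ 3)))"
      by (rule weighted_size_tail) (use lam t no in auto)
    also have "\<dots> \<le> exp (- \<kappa> * s ^ 3)"
    proof -
      have "(\<Sum>e\<in>K_edges n. - w e * marg (\<lambda>e. lam e * exp (t * - w e)) {} (K_tri n) e) - (- (q0 / s * W) + \<epsilon> * s ^ 3)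
        \<le> - (\<epsilon> / 2 * s ^ 3)" using m2 Ws unfolding diff_divide_distrib left_diff_distrib by linarith
      then have "t * ((\<Sum>e\<in>K_edges n. - w e * marg (\<lambda>e. lam e * exp (t * - w e)) {} (K_tri n) e) - (- (q0 / s * W) + \<epsilon> * s ^ 3))
        \<le> t * - (\<epsilon> / 2 * s ^ 3)" using t by (intro mult_left_mono) auto
      then show ?thesis unfolding \<kappa>_def by simp
    qed
    finally have 2: "P lam {} (K_tri n) (\<lambda>U. - (q0 / s * W) + \<epsilon> * s ^ 3 \<le> (\<Sum>e\<in>U. - w e)) \<le> exp (- \<kappa> * s ^ 3)" .
    have "P lam {} (K_tri n) (\<lambda>U. \<epsilon> * s ^ 3 \<le> \<bar>(\<Sum>e\<in>U. w e) - q0 / s * W\<bar>)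
      \<le> P lam {} (K_tri n) (\<lambda>U. q0 / s * W + \<epsilon> * s ^ 3 \<le> (\<Sum>e\<in>U. w e) \<or> - (q0 / s * W) + \<epsilon> * s ^ 3 \<le> (\<Sum>e\<in>U. - w e))"
      by (rule gprob_mono[OF lam]) (auto simp: sum_negf abs_if split: if_splits)
    also have "\<dots> \<le> 2 * exp (- \<kappa> * s ^ 3)"
      using order_trans[OF gprob_disj[OF lam] add_mono[OF 1 2]] by simp
    finally show "P lam {} (K_tri n) (\<lambda>U. \<epsilon> * sqrt n ^ 3 \<le> \<bar>(\<Sum>e\<in>U. w e) - q0 / sqrt n * (\<Sum>e\<in>K_edges n. w e)\<bar>)
         \<le> 2 * exp (- \<kappa> * sqrt n ^ 3)" unfolding s_def W_def .
  qed
qed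

text \<open>Here the penalty is tilted: 1 - \<zeta> times exp t and exp (- t) gives penalties
  \<open>z1\<close> and \<open>z2\<close> within \<open>\<delta>\<close> of \<zeta>, where
  \<open>triangles_near\<close> still locates the mean. The assumption 0 < \<zeta> leaves room for
  \<open>z1\<close> below \<zeta>, and \<zeta> < 1 lets the tilt act at all.\<close>

lemma triangle_concentration:
  assumes "0 < \<epsilon>" "0 < \<zeta>" "\<zeta> < 1"
  obtains \<delta> \<kappa> N where "0 < \<delta>" "0 < \<kappa>"
    "\<And>n lam. n \<ge> N \<Longrightarrow> near c \<zeta> n \<delta> \<zeta> lam \<Longrightarrow>
       1 - 2 * exp (- \<kappa> * sqrt n ^ 3) \<le> gprob (K_edges n) \<zeta> lam {} (K_tri n)
         (\<lambda>U. ((1 - \<zeta>) * q0 ^ 3 / 6 - \<epsilon>) * sqrt n ^ 3 \<le> num_triangles U \<and>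
              num_triangles U \<le> ((1 - \<zeta>) * q0 ^ 3 / 6 + \<epsilon>) * sqrt n ^ 3)"
proof -
  have e2: "0 < \<epsilon> / 2" using assms by simp
  define f where "f = (1 - \<zeta>) * q0 ^ 3 / 6"
  obtain \<delta> N where d: "0 < \<delta>" "\<delta> < c"
    "\<And>n z lam. n \<ge> N \<Longrightarrow> near c \<zeta> n \<delta> z lam \<Longrightarrow>
       \<bar>(\<Sum>h\<in>K_tri n. gprob (K_edges n) z lam {} (K_tri n) (\<lambda>U. h \<subseteq> U)) - f * sqrt n ^ 3\<bar> \<le> \<epsilon> / 2 * sqrt n ^ 3"
    using triangles_near[OF e2] unfolding f_def by metis
  note id0 = tendsto_ident_at[of "0 :: real" "{0<..}"]
  have "((\<lambda>t. 1 - (1 - \<zeta>) * exp t) \<longlongrightarrow> 1 - (1 - \<zeta>) * exp 0) (at_right 0)"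
    by (intro tendsto_intros id0)
  then have t1: "\<forall>\<^sub>F t in at_right 0. max 0 (\<zeta> - \<delta>) < 1 - (1 - \<zeta>) * exp t"
    by (rule order_tendstoD(1)) (use d assms in simp)
  have "((\<lambda>t. 1 - (1 - \<zeta>) * exp (- t)) \<longlongrightarrow> 1 - (1 - \<zeta>) * exp (- 0)) (at_right 0)"
    by (intro tendsto_intros id0)
  then have t2: "\<forall>\<^sub>F t in at_right 0. 1 - (1 - \<zeta>) * exp (- t) < min 1 (\<zeta> + \<delta>)"
    by (rule order_tendstoD(2)) (use d assms in simp)
  have "\<forall>\<^sub>F x::real in at_right 0. x > 0" by (rule eventually_at_right_less)
  with t1 t2 have "\<forall>\<^sub>F t in at_right 0. t > 0 \<and> max 0 (\<zeta> - \<delta>) < 1 - (1 - \<zeta>) * exp t \<and> 1 - (1 - \<zeta>) * exp (- t) < min 1 (\<zeta> + \<delta>)"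
    by eventually_elim auto
  then obtain t where t: "t > 0" "max 0 (\<zeta> - \<delta>) < 1 - (1 - \<zeta>) * exp t" "1 - (1 - \<zeta>) * exp (- t) < min 1 (\<zeta> + \<delta>)"
    using eventually_happens'[of "at_right (0::real)"] by auto
  define z1 where "z1 = 1 - (1 - \<zeta>) * exp t"
  define z2 where "z2 = 1 - (1 - \<zeta>) * exp (- t)"
  have "(1 - \<zeta>) * 1 \<le> (1 - \<zeta>) * exp t" using assms t by (intro mult_left_mono) auto
  then have "1 - \<zeta> \<le> (1 - \<zeta>) * exp t" by (simp only: mult_1_right)
  then have "z1 \<le> \<zeta>" unfolding z1_def by simp
  moreover have "0 < z1" "\<zeta> - \<delta> < z1" using t(2) unfolding z1_def by auto
  ultimately have z1: "0 \<le> z1" "z1 \<le> 1" "\<bar>z1 - \<zeta>\<bar> \<le> \<delta>" using assms by auto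
  have "(1 - \<zeta>) * exp (- t) \<le> (1 - \<zeta>) * 1" using assms t by (intro mult_left_mono) auto
  then have "(1 - \<zeta>) * exp (- t) \<le> 1 - \<zeta>" by (simp only: mult_1_right)
  then have "\<zeta> \<le> z2" unfolding z2_def by simp
  moreover have "z2 < 1" "z2 < \<zeta> + \<delta>" using t(3) unfolding z2_def min_less_iff_conj by blast+
  ultimately have z2: "0 \<le> z2" "z2 \<le> 1" "\<bar>z2 - \<zeta>\<bar> \<le> \<delta>" using assms by auto
  define \<kappa> where "\<kappa> = t * \<epsilon> / 2"
  show thesis
  proof (rule that)
    show "0 < \<delta>" "0 < \<kappa>" using d t assms unfolding \<kappa>_def by auto
    fix n :: nat and lam
    assume n: "N \<le> n" and nr: "near c \<zeta> n \<delta> \<zeta> lam"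
    interpret linear_gibbs "K_edges n" \<zeta> "K_tri n" "n - 2"
      by (rule linear_gibbs_K) (use assms in auto)
    define s where "s = sqrt (real n)"
    define X where "X U = real (card {h \<in> K_tri n. h \<subseteq> U})" for U
    have s: "0 \<le> s ^ 3" by (simp add: s_def)
    have lam: "0 \<le> lam v" if "v \<in> K_edges n" for v
      by (rule near_nonneg[OF nr _ that]) (use d in simp)
    have ne: "{} \<notin> K_tri n" using tri_card[of "{}"] by auto
    define m where "m z = (\<Sum>h\<in>K_tri n. gprob (K_edges n) z lam {} (K_tri n) (\<lambda>U. h \<subseteq> U))" for z
    have m: "\<bar>m z - f * s ^ 3\<bar> \<le> \<epsilon> / 2 * s ^ 3" if "0 \<le> z" "z \<le> 1" "\<bar>z - \<zeta>\<bar> \<le> \<delta>" for z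
      unfolding m_def s_def by (rule d(3)[OF n]) (use nr that in \<open>auto simp: near_def\<close>)
    have "P lam {} (K_tri n) (\<lambda>U. (f + \<epsilon>) * s ^ 3 \<le> X U) \<le> exp (t * (m z1 - (f + \<epsilon>) * s ^ 3))"
      unfolding X_def m_def
      by (rule card_tail(1)[OF lam _ finite_Tri ne z1(1,2)]) (use t z1_def in auto)
    also have "\<dots> \<le> exp (- \<kappa> * s ^ 3)"
    proof -
      have "m z1 - (f + \<epsilon>) * s ^ 3 \<le> - (\<epsilon> / 2 * s ^ 3)"
        using m[OF z1] unfolding distrib_right by linarith
      then have "t * (m z1 - (f + \<epsilon>) * s ^ 3) \<le> t * - (\<epsilon> / 2 * s ^ 3)" using t by (intro mult_left_mono) auto
      then show ?thesis unfolding \<kappa>_def by simp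
    qed
    finally have 1: "P lam {} (K_tri n) (\<lambda>U. (f + \<epsilon>) * s ^ 3 \<le> X U) \<le> exp (- \<kappa> * s ^ 3)" .
    have "P lam {} (K_tri n) (\<lambda>U. X U \<le> (f - \<epsilon>) * s ^ 3) \<le> exp (t * ((f - \<epsilon>) * s ^ 3 - m z2))"
      unfolding X_def m_def
      by (rule card_tail(2)[OF lam _ finite_Tri ne z2(1,2)]) (use t z2_def in auto)
    also have "\<dots> \<le> exp (- \<kappa> * s ^ 3)"
    proof -
      have "(f - \<epsilon>) * s ^ 3 - m z2 \<le> - (\<epsilon> / 2 * s ^ 3)"
        using m[OF z2] unfolding left_diff_distrib by linarith
      then have "t * ((f - \<epsilon>) * s ^ 3 - m z2) \<le> t * - (\<epsilon> / 2 * s ^ 3)" using t by (intro mult_left_mono) auto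
      then show ?thesis unfolding \<kappa>_def by simp
    qed
    finally have 2: "P lam {} (K_tri n) (\<lambda>U. X U \<le> (f - \<epsilon>) * s ^ 3) \<le> exp (- \<kappa> * s ^ 3)" .
    have Zp: "0 < Z lam {} (K_tri n)"
      using Z_ge_1[of lam "K_tri n" "{}"] lam ne by fastforce
    define G where "G U \<longleftrightarrow> (f - \<epsilon>) * s ^ 3 \<le> num_triangles U \<and> num_triangles U \<le> (f + \<epsilon>) * s ^ 3" for U
    have "1 = P lam {} (K_tri n) (\<lambda>U. True)" unfolding gprob_def using Zp by simp
    also have "\<dots> \<le> P lam {} (K_tri n) (\<lambda>U. G U \<or> ((f + \<epsilon>) * s ^ 3 \<le> X U \<or> X U \<le> (f - \<epsilon>) * s ^ 3))"
      by (rule gprob_mono[OF lam]) (auto simp: G_def X_def num_triangles_eq)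
    also have "\<dots> \<le> P lam {} (K_tri n) G + (exp (- \<kappa> * s ^ 3) + exp (- \<kappa> * s ^ 3))"
      by (rule order_trans[OF gprob_disj[OF lam] add_left_mono[OF order_trans[OF gprob_disj[OF lam] add_mono[OF 1 2]]]])
    finally have "1 - 2 * exp (- \<kappa> * s ^ 3) \<le> P lam {} (K_tri n) G" by simp
    then show "1 - 2 * exp (- \<kappa> * sqrt n ^ 3) \<le> P lam {} (K_tri n)
         (\<lambda>U. ((1 - \<zeta>) * q0 ^ 3 / 6 - \<epsilon>) * sqrt n ^ 3 \<le> num_triangles U \<and>
              num_triangles U \<le> ((1 - \<zeta>) * q0 ^ 3 / 6 + \<epsilon>) * sqrt n ^ 3)"
      unfolding G_def s_def f_def .
  qed
qed

end

section \<open>The Lambert function and the equation for the penalty\<close>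

text \<open>This one inequality yields uniqueness, monotonicity and the Lipschitz continuity of
  \<open>Lambert_W\<close>.\<close>

lemma mult_exp_diff_ge:
  fixes v w :: real
  assumes "0 \<le> v" "v \<le> w"
  shows "w - v \<le> w * exp w - v * exp v"
proof -
  have "v * (exp v - 1) \<le> w * (exp w - 1)"
    using assms by (intro mult_mono) auto
  then show ?thesis by (simp add: algebra_simps)
qed

lemma Lambert_W_ex1:
  fixes x :: real
  assumes "0 \<le> x"
  shows "\<exists>!w. 0 \<le> w \<and> w * exp w = x"
proof -
  have "\<exists>w\<ge>0. w \<le> x \<and> w * exp w = x"
  proof (rule IVT'[of "\<lambda>w. w * exp w" 0 x x])
    show "x \<le> x * exp x" using assms mult_left_mono[of 1 "exp x" x] by simp
  qed (use assms in \<open>auto intro!: continuous_intros\<close>)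
  then obtain w where w: "0 \<le> w" "w * exp w = x" by auto
  moreover have "v = w" if v: "0 \<le> v" "v * exp v = x" for v
    using mult_exp_diff_ge[of v w] mult_exp_diff_ge[of w v] v w by linarith
  ultimately show ?thesis by blast
qed

lemma Lambert_W:
  assumes "0 \<le> x"
  shows Lambert_W_nonneg: "0 \<le> Lambert_W x" and Lambert_W_exp: "Lambert_W x * exp (Lambert_W x) = x"
  using theI'[OF Lambert_W_ex1[OF assms]] unfolding Lambert_W_def by auto

lemma Lambert_W_mono:
  assumes "0 \<le> x" "x \<le> y"
  shows "Lambert_W x \<le> Lambert_W y" "Lambert_W y - Lambert_W x \<le> y - x"
proof -
  note x = Lambert_W[OF assms(1)] and y = Lambert_W[OF order_trans[OF assms]]
  show 1: "Lambert_W x \<le> Lambert_W y"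
  proof (rule ccontr)
    assume "\<not> ?thesis"
    then show False using mult_exp_diff_ge[OF y(1), of "Lambert_W x"] x y assms by simp
  qed
  show "Lambert_W y - Lambert_W x \<le> y - x"
    using mult_exp_diff_ge[OF x(1) 1] x y by simp
qed

lemma Lambert_W_0: "Lambert_W 0 = 0"
  using Lambert_W_exp[of 0] by simp

lemma continuous_on_Lambert_W: "continuous_on {0..} Lambert_W"
proof (rule continuous_on_iff[THEN iffD2], intro ballI allI impI)
  fix x e :: real assume x: "x \<in> {0..}" "0 < e"
  show "\<exists>d>0. \<forall>x'\<in>{0..}. dist x' x < d \<longrightarrow> dist (Lambert_W x') (Lambert_W x) < e"
  proof (intro exI[of _ e] conjI ballI impI)
    fix x' assume x': "x' \<in> {0..}" "dist x' x < e"
    then show "dist (Lambert_W x') (Lambert_W x) < e"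
      using Lambert_W_mono[of x x'] Lambert_W_mono[of x' x] x by (cases "x \<le> x'") (auto simp: dist_real_def)
  qed (rule x(2))
qed

text \<open>From W exp W = x; at 0 both sides are 1, so the exponential form removes the case
  distinction from what follows.\<close>

lemma Lambert_W_quot_eq:
  assumes "0 \<le> x"
  shows "Lambert_W_quot x = exp (- Lambert_W x)"
proof (cases "x = 0")
  case False
  then have "Lambert_W x \<noteq> 0" using Lambert_W_exp[OF assms] by auto
  have "Lambert_W x / x = Lambert_W x / (Lambert_W x * exp (Lambert_W x))"
    using Lambert_W_exp[OF assms] by simp
  then show ?thesis using False \<open>Lambert_W x \<noteq> 0\<close> by (simp add: Lambert_W_quot_def exp_minus divide_simps)
qed (simp add: Lambert_W_quot_def Lambert_W_0)

lemma Lambert_W_quot_powr: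
  assumes "0 \<le> x"
  shows "Lambert_W_quot x powr (3/2) = exp (- (3/2 * Lambert_W x))"
  using Lambert_W_quot_eq[OF assms] by (simp add: exp_powr_real)

text \<open>This is q times the square root of n, in a form that also makes sense for z = 0.\<close>

definition edge_rate :: "real \<Rightarrow> real \<Rightarrow> real" where
  "edge_rate c z = c * exp (- (Lambert_W (2 * z * c\<^sup>2) / 2))"

lemma edge_rate_pos: "0 < c \<Longrightarrow> 0 < edge_rate c z"
  by (simp add: edge_rate_def)

text \<open>Squaring the rate x and inserting W exp W = 2 z c^2 gives z x^2 = W / 2, which is the
  exponent in its definition.\<close>

lemma edge_rate_fixpoint:
  assumes "0 \<le> z"
  shows "edge_rate c z = c * exp (- (z * (edge_rate c z)\<^sup>2))"
proof -
  let ?W = "Lambert_W (2 * z * c\<^sup>2)"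
  have W: "?W * exp ?W = 2 * z * c\<^sup>2" by (rule Lambert_W_exp) (use assms in simp)
  have "z * (edge_rate c z)\<^sup>2 = z * c\<^sup>2 * exp (- ?W)"
    unfolding edge_rate_def power_mult_distrib by (simp flip: exp_double)
  also have "\<dots> = ?W * exp ?W * exp (- ?W) / 2" unfolding W by simp
  also have "\<dots> = ?W / 2" by (simp add: exp_minus)
  finally show ?thesis by (simp add: edge_rate_def)
qed

lemma edge_rate_cubed: "0 \<le> z \<Longrightarrow> edge_rate c z ^ 3 = c ^ 3 * Lambert_W_quot (2 * z * c\<^sup>2) powr (3/2)"
  unfolding edge_rate_def power_mult_distrib
  by (subst Lambert_W_quot_powr) (simp_all flip: exp_of_nat_mult)

lemma continuous_on_edge_rate: "continuous_on {0..} (edge_rate c)"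
  unfolding edge_rate_def
  by (intro continuous_intros continuous_on_compose2[OF continuous_on_Lambert_W]) auto

lemma edge_rate_antimono: "0 < c \<Longrightarrow> 0 \<le> z \<Longrightarrow> z \<le> z' \<Longrightarrow> edge_rate c z' \<le> edge_rate c z"
  unfolding edge_rate_def by (simp add: Lambert_W_mono mult_right_mono)

text \<open>Up to the factor 1 / 6 this is the limiting triangle count on the scale n^(3/2). Both
  factors decrease in z, the first one strictly.\<close>

lemma tri_rate_strict_antimono:
  assumes "0 < c" "0 \<le> z" "z < z'" "z' \<le> 1"
  shows "(1 - z') * edge_rate c z' ^ 3 < (1 - z) * edge_rate c z ^ 3"
proof -
  have "(1 - z') * edge_rate c z' ^ 3 \<le> (1 - z') * edge_rate c z ^ 3"
    using assms edge_rate_antimono[of c z z'] edge_rate_pos[of c z'] by (intro mult_left_mono power_mono) auto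
  also have "\<dots> < (1 - z) * edge_rate c z ^ 3"
    using assms edge_rate_pos[of c z] by (intro mult_strict_right_mono) auto
  finally show ?thesis .
qed

text \<open>Multiplied by c^3 the equation says that the triangle rate of the penalised model is
  \<eta> times the rate c^3 of G(n,p).\<close>

lemma zeta_solution_iff:
  assumes "0 < c"
  shows "zeta_solution c \<eta> z \<longleftrightarrow> z \<in> {0..1} \<and> (1 - z) * edge_rate c z ^ 3 = \<eta> * c ^ 3"
  using assms unfolding zeta_solution_def by (auto simp: edge_rate_cubed)

lemma zeta_solution_ex1:
  assumes "0 < c" "0 \<le> \<eta>" "\<eta> < 1"
  shows "\<exists>!z. zeta_solution c \<eta> z"
proof -
  have "\<exists>z\<ge>0. z \<le> 1 \<and> (1 - z) * edge_rate c z ^ 3 = \<eta> * c ^ 3"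
  proof (rule IVT2'[of "\<lambda>z. (1 - z) * edge_rate c z ^ 3" 1 "\<eta> * c ^ 3" 0])
    show "\<eta> * c ^ 3 \<le> (1 - 0) * edge_rate c 0 ^ 3"
      using assms by (simp add: edge_rate_def Lambert_W_0)
    show "continuous_on {0..1} (\<lambda>z. (1 - z) * edge_rate c z ^ 3)"
      by (intro continuous_intros continuous_on_subset[OF continuous_on_edge_rate]) auto
  qed (use assms in auto)
  then obtain z where z: "zeta_solution c \<eta> z" unfolding zeta_solution_iff[OF assms(1)] by auto
  moreover have "y = z" if "zeta_solution c \<eta> y" for y
    using tri_rate_strict_antimono[OF assms(1), of y z] tri_rate_strict_antimono[OF assms(1), of z y]
      z that unfolding zeta_solution_iff[OF assms(1)] by (cases y z rule: linorder_cases) auto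
  ultimately show ?thesis by blast
qed

lemma zeta_solution_pos:
  assumes "0 < c" "\<eta> < 1" "zeta_solution c \<eta> z"
  shows "0 < z"
proof (rule ccontr)
  assume "\<not> 0 < z"
  then have "z = 0" using assms(3) unfolding zeta_solution_def by auto
  then show False using assms unfolding zeta_solution_def by (simp add: Lambert_W_quot_def)
qed

text \<open>If z c^2 were at least 1 / e, monotonicity of W would give \<eta> \<le> (1 - z)
  \<open>eta_star\<close>, hence \<eta> < \<open>eta_star\<close> and z \<le> 1 - \<eta> /
  \<open>eta_star\<close>; but then the bound on c yields z c^2 < 1 / e. For \<eta> \<ge>
  \<open>eta_star\<close>, where c is unrestricted, the first conclusion is already absurd. Finally
  1 / e \<le> 1 / 2.\<close>

lemma zeta_contraction:
  assumes c: "0 < c" and e: "0 \<le> \<eta>" "\<eta> < 1" and cl: "ereal c < c_bar \<eta>" and z: "zeta_solution c \<eta> z"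
  shows "2 * z * c\<^sup>2 < 1"
proof -
  have z01: "0 < z" "z \<le> 1" using zeta_solution_pos[OF c e(2) z] z unfolding zeta_solution_def by auto
  have es: "0 < eta_star" unfolding eta_star_def by (subst Lambert_W_quot_powr) auto
  have "z * c\<^sup>2 < 1 / exp 1"
  proof (rule ccontr)
    assume "\<not> ?thesis"
    then have h: "1 / exp 1 \<le> z * c\<^sup>2" by simp
    have "Lambert_W (2 / exp 1) \<le> Lambert_W (2 * z * c\<^sup>2)"
      using h by (intro Lambert_W_mono) auto
    then have "Lambert_W_quot (2 * z * c\<^sup>2) powr (3/2) \<le> eta_star"
      unfolding eta_star_def using z01 by (subst (1 2) Lambert_W_quot_powr) auto
    then have "(1 - z) * Lambert_W_quot (2 * z * c\<^sup>2) powr (3/2) \<le> (1 - z) * eta_star"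
      using z01 by (intro mult_left_mono) auto
    then have le: "\<eta> \<le> (1 - z) * eta_star" using z unfolding zeta_solution_def by simp
    also have "\<dots> < eta_star" using z01 es by simp
    finally have less: "\<eta> < eta_star" .
    define d where "d = 1 - \<eta> / eta_star"
    have d: "0 < d" "z \<le> d" using less le es unfolding d_def by (auto simp: field_simps)
    have "c < 1 / sqrt (exp 1 * d)" using cl less unfolding c_bar_def d_def by simp
    then have "c\<^sup>2 < (1 / sqrt (exp 1 * d))\<^sup>2" using c by (intro power_strict_mono) auto
    also have "\<dots> = 1 / (exp 1 * d)" using d by (simp add: power_divide)
    finally have "d * c\<^sup>2 < d * (1 / (exp 1 * d))" using d by (intro mult_strict_left_mono) auto
    also have "\<dots> = 1 / exp 1" using d by simp
    finally have "d * c\<^sup>2 < 1 / exp 1" .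
    moreover have "z * c\<^sup>2 \<le> d * c\<^sup>2" using d by (intro mult_right_mono) auto
    ultimately show False using h by simp
  qed
  moreover have "1 / exp 1 \<le> (1 / 2 :: real)" using exp_ge_add_one_self[of 1] by (simp add: field_simps)
  ultimately show ?thesis by linarith
qed

lemma sqrt_Lambert_W_eq_edge_rate:
  assumes "0 < c" "0 < z"
  shows "sqrt (Lambert_W (2 * z * c\<^sup>2) / (2 * z)) = edge_rate c z"
proof -
  let ?W = "Lambert_W (2 * z * c\<^sup>2)"
  have W: "?W * exp ?W = 2 * z * c\<^sup>2" by (rule Lambert_W_exp) (use assms in simp)
  have "(edge_rate c z)\<^sup>2 = c\<^sup>2 * exp (- ?W)"
    unfolding edge_rate_def power_mult_distrib by (simp flip: exp_double)
  also have "\<dots> = (2 * z * c\<^sup>2) * exp (- ?W) / (2 * z)" using assms by simp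
  also have "\<dots> = ?W * exp ?W * exp (- ?W) / (2 * z)" by (simp only: W)
  also have "\<dots> = ?W / (2 * z)" by (simp add: exp_minus)
  finally show ?thesis
    using real_sqrt_unique edge_rate_pos[OF assms(1), of z] by (metis less_imp_le)
qed

section \<open>The cut norm\<close>

text \<open>
  Summed over the edges of a graph with adjacency matrix A, this weight gives the bilinear form of A
  at the indicator vectors of S and T.
\<close>

definition pair_weight :: "nat set \<Rightarrow> nat set \<Rightarrow> nat set \<Rightarrow> real" where
  "pair_weight S T e = real (card {(i, j) \<in> S \<times> T. {i, j} = e})"

lemma pair_weight_bounds:
  assumes "e \<in> K_edges n"
  shows "0 \<le> pair_weight S T e" "pair_weight S T e \<le> 2"
proof -
  obtain a b where e: "e = {a, b}" using assms by (auto simp: K_edges_def nsets_def card_2_iff)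
  have "card {(i, j) \<in> S \<times> T. {i, j} = e} \<le> card {(a, b), (b, a)}"
    by (rule card_mono) (auto simp: e doubleton_eq_iff)
  also have "\<dots> \<le> 2" by (intro card_insert_le_m1) auto
  finally show "pair_weight S T e \<le> 2" by (simp add: pair_weight_def)
qed (simp add: pair_weight_def)

lemma sum_pair_weight:
  assumes "finite S" "finite T" "finite U"
  shows "(\<Sum>e\<in>U. pair_weight S T e) = (\<Sum>i\<in>S. \<Sum>j\<in>T. of_bool ({i, j} \<in> U))"
proof -
  have "pair_weight S T e = (\<Sum>x\<in>S \<times> T. of_bool ({fst x, snd x} = e))" for e
  proof -
    have "(\<Sum>x\<in>S \<times> T. of_bool ({fst x, snd x} = e)) = (\<Sum>x\<in>{x \<in> S \<times> T. {fst x, snd x} = e}. (1::real))"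
      unfolding of_bool_def by (rule sum.inter_filter[symmetric]) (use assms in auto)
    also have "{x \<in> S \<times> T. {fst x, snd x} = e} = {(i, j) \<in> S \<times> T. {i, j} = e}" by auto
    finally show ?thesis by (simp add: pair_weight_def)
  qed
  then have "(\<Sum>e\<in>U. pair_weight S T e) = (\<Sum>x\<in>S \<times> T. \<Sum>e\<in>U. of_bool ({fst x, snd x} = e))"
    by (simp only: sum.swap[of _ U])
  also have "\<dots> = (\<Sum>x\<in>S \<times> T. of_bool ({fst x, snd x} \<in> U))"
    using assms by (intro sum.cong refl) (simp add: of_bool_def)
  finally show ?thesis by (simp add: sum.cartesian_product case_prod_beta)
qed

text \<open>Of the ordered pairs in \<open>S \<times> T\<close>, only the diagonal ones are not
  edges of the complete graph.\<close>

lemma sum_pair_weight_K_edges: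
  assumes "S \<subseteq> {..<n}" "T \<subseteq> {..<n}"
  shows "\<bar>(\<Sum>e\<in>K_edges n. pair_weight S T e) - real (card S) * real (card T)\<bar> \<le> real n"
proof -
  have fin: "finite S" "finite T" using assms finite_subset by auto
  have "real (card S) * real (card T) - (\<Sum>e\<in>K_edges n. pair_weight S T e)
     = (\<Sum>i\<in>S. \<Sum>j\<in>T. 1 - of_bool ({i, j} \<in> K_edges n))"
    by (simp add: sum_pair_weight[OF fin finite_K_edges] sum_subtractf)
  also have "\<dots> = (\<Sum>i\<in>S. \<Sum>j\<in>T. of_bool (i = j))"
  proof (intro sum.cong refl)
    fix i j assume "i \<in> S" "j \<in> T"
    then show "1 - of_bool ({i, j} \<in> K_edges n) = (of_bool (i = j) :: real)"
      using assms unfolding K_edges_def doubleton_in_nsets_2 by auto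
  qed
  finally have eq: "real (card S) * real (card T) - (\<Sum>e\<in>K_edges n. pair_weight S T e) = (\<Sum>i\<in>S. \<Sum>j\<in>T. of_bool (i = j))" .
  have "(\<Sum>i\<in>S. \<Sum>j\<in>T. of_bool (i = j)) \<le> (\<Sum>i\<in>S. (1::real))"
    using fin by (intro sum_mono) (simp add: of_bool_def)
  also have "\<dots> \<le> n" using card_mono[OF _ assms(1)] by simp
  finally have "(\<Sum>i\<in>S. \<Sum>j\<in>T. of_bool (i = j)) \<le> real n" .
  moreover have "0 \<le> (\<Sum>i\<in>S. \<Sum>j\<in>T. (of_bool (i = j) :: real))" by (intro sum_nonneg) auto
  ultimately show ?thesis using eq by linarith
qed

text \<open>Pairs of 0/1 vectors are pairs of vertex sets. The hypothesis also supplies the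
  boundedness that a real supremum needs in order to dominate its value at the zero vectors.\<close>

lemma cut_norm_bounds:
  assumes "\<And>S T. S \<subseteq> {..<n} \<Longrightarrow> T \<subseteq> {..<n} \<Longrightarrow> \<bar>\<Sum>i\<in>S. \<Sum>j\<in>T. of_bool ({i, j} \<in> U) - r\<bar> \<le> B"
  shows "0 \<le> cut_norm (adj_mat n U - r \<cdot>\<^sub>m all_ones_mat n)" "cut_norm (adj_mat n U - r \<cdot>\<^sub>m all_ones_mat n) \<le> B"
proof -
  let ?A = "adj_mat n U - r \<cdot>\<^sub>m all_ones_mat n"
  define F where "F = (\<lambda>(x, y). \<bar>scalar_prod x (?A *\<^sub>v y)\<bar>)"
  define V where "V = zero_one_vecs (dim_row ?A) \<times> zero_one_vecs (dim_col ?A)"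
  have cn: "cut_norm ?A = (SUP p\<in>V. F p)" unfolding cut_norm_def V_def F_def ..
  have dim: "dim_row ?A = n" "dim_col ?A = n" by (simp_all add: all_ones_mat_def adj_mat_def)
  have A: "?A $$ (i, j) = of_bool ({i, j} \<in> U) - r" if "i < n" "j < n" for i j
    using that by (simp add: all_ones_mat_def adj_mat_def)
  have F: "F p \<le> B" if "p \<in> V" for p
  proof -
    obtain x y where p: "p = (x, y)" by (cases p)
    have cxy: "x \<in> carrier_vec n" "y \<in> carrier_vec n"
      and img': "vec_index x ` {..<dim_vec x} \<subseteq> {0, 1}" "vec_index y ` {..<dim_vec y} \<subseteq> {0, 1}"
      using that unfolding V_def zero_one_vecs_def p dim vec_set_def by blast+
    have dxy: "dim_vec x = n" "dim_vec y = n" using cxy by auto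
    note img = img'[unfolded dxy]
    have "x $ i \<in> {0, 1}" "y $ i \<in> {0, 1}" if "i < n" for i
      using that img by blast+
    note xy = dxy this
    define S where "S = {i \<in> {..<n}. x $ i = 1}"
    define T where "T = {i \<in> {..<n}. y $ i = 1}"
    have x: "x $ i = of_bool (i \<in> S)" if "i < n" for i using xy(3)[OF that] that by (auto simp: S_def)
    have y: "y $ i = of_bool (i \<in> T)" if "i < n" for i using xy(4)[OF that] that by (auto simp: T_def)
    have "scalar_prod x (?A *\<^sub>v y) = (\<Sum>i\<in>{0..<n}. x $ i * (\<Sum>j\<in>{0..<n}. ?A $$ (i, j) * y $ j))"
      unfolding scalar_prod_def using dim xy by (intro sum.cong) (auto simp: scalar_prod_def)
    also have "\<dots> = (\<Sum>i\<in>{..<n}. of_bool (i \<in> S) * (\<Sum>j\<in>{..<n}. of_bool (j \<in> T) * (of_bool ({i, j} \<in> U) - r)))"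
    proof -
      have "(\<Sum>j\<in>{0..<n}. ?A $$ (i, j) * y $ j) = (\<Sum>j\<in>{0..<n}. of_bool (j \<in> T) * (of_bool ({i, j} \<in> U) - r))"
        if "i < n" for i
        by (rule sum.cong) (use that in \<open>simp_all add: y A mult.commute\<close>)
      then show ?thesis unfolding lessThan_atLeast0 by (intro sum.cong) (simp_all add: x)
    qed
    also have "\<dots> = (\<Sum>i\<in>S. \<Sum>j\<in>T. of_bool ({i, j} \<in> U) - r)"
    proof -
      have *: "(\<Sum>i\<in>{..<n}. of_bool (i \<in> S) * f i) = (\<Sum>i\<in>S. f i)" if "S \<subseteq> {..<n}" for f :: "nat \<Rightarrow> real" and S
        using that by (intro sum.mono_neutral_cong_right) auto
      have "S \<subseteq> {..<n}" "T \<subseteq> {..<n}" by (auto simp: S_def T_def)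
      then show ?thesis by (simp only: *)
    qed
    finally show ?thesis unfolding F_def p using assms[of S T] by (auto simp: S_def T_def)
  qed
  have zero: "(0\<^sub>v n, 0\<^sub>v n) \<in> V" unfolding V_def dim zero_one_vecs_def by (auto simp: vec_set_def)
  then have ne: "V \<noteq> {}" by auto
  show "cut_norm ?A \<le> B" unfolding cn by (rule cSUP_least[OF ne F])
  have "0 \<le> F (0\<^sub>v n, 0\<^sub>v n)" unfolding F_def by simp
  also have "\<dots> \<le> cut_norm ?A"
    unfolding cn by (rule cSUP_upper[OF zero bdd_aboveI2]) (rule F)
  finally show "0 \<le> cut_norm ?A" .
qed

text \<open>The cut norm compares with the all-ones matrix, the deviation with the complete graph;
  the diagonal accounts for the extra \<open>r * n\<close>.\<close>

lemma cut_norm_pair_weight: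
  assumes U: "U \<subseteq> K_edges n" and r: "0 \<le> r"
    and B: "\<And>S T. S \<subseteq> {..<n} \<Longrightarrow> T \<subseteq> {..<n} \<Longrightarrow>
       \<bar>(\<Sum>e\<in>U. pair_weight S T e) - r * (\<Sum>e\<in>K_edges n. pair_weight S T e)\<bar> \<le> B"
  shows "0 \<le> cut_norm (adj_mat n U - r \<cdot>\<^sub>m all_ones_mat n)"
    "cut_norm (adj_mat n U - r \<cdot>\<^sub>m all_ones_mat n) \<le> B + r * n"
proof -
  have "\<bar>\<Sum>i\<in>S. \<Sum>j\<in>T. of_bool ({i, j} \<in> U) - r\<bar> \<le> B + r * n" if ST: "S \<subseteq> {..<n}" "T \<subseteq> {..<n}" for S T
  proof -
    have fin: "finite S" "finite T" using ST finite_subset by auto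
    have finU: "finite U" using U finite_K_edges finite_subset by auto
    have "(\<Sum>i\<in>S. \<Sum>j\<in>T. of_bool ({i, j} \<in> U) - r) =
       ((\<Sum>e\<in>U. pair_weight S T e) - r * (\<Sum>e\<in>K_edges n. pair_weight S T e)) +
       r * ((\<Sum>e\<in>K_edges n. pair_weight S T e) - real (card S) * real (card T))"
      by (simp add: sum_pair_weight[OF fin finU] sum_subtractf algebra_simps)
    moreover have "\<bar>r * ((\<Sum>e\<in>K_edges n. pair_weight S T e) - real (card S) * real (card T))\<bar> \<le> r * n"
      unfolding abs_mult using r sum_pair_weight_K_edges[OF ST] by (simp add: mult_left_mono)
    ultimately show ?thesis using B[OF ST] by linarith
  qed
  then show "0 \<le> cut_norm (adj_mat n U - r \<cdot>\<^sub>m all_ones_mat n)"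
    "cut_norm (adj_mat n U - r \<cdot>\<^sub>m all_ones_mat n) \<le> B + r * n"
    using cut_norm_bounds[of n U r "B + r * n"] by blast+
qed

section \<open>The conditioned random graph\<close>

lemma subcritical_edge_rate:
  assumes "0 < c" "0 \<le> z" "z \<le> 1" "2 * z * c\<^sup>2 < 1"
  shows "subcritical c z (edge_rate c z)"
  by standard (use assms edge_rate_pos[of c z] edge_rate_fixpoint[of z c] in auto)

lemma activity_tendsto:
  fixes p :: "nat \<Rightarrow> real"
  assumes c: "0 < c" and p: "p \<sim>[at_top] (\<lambda>n. c / sqrt (real n))"
  shows "\<forall>\<^sub>F n in sequentially. 0 < p n \<and> p n < 1"
    and "(\<lambda>n. sqrt n * (p n / (1 - p n))) \<longlonglongrightarrow> c"
proof -
  have ev: "\<forall>\<^sub>F n in sequentially. c / sqrt (real n) \<noteq> 0"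
    using eventually_gt_at_top[of 0] by eventually_elim (use c in simp)
  have "(\<lambda>n. p n / (c / sqrt (real n))) \<longlonglongrightarrow> 1"
    by (rule asymp_equivD_strong[OF p]) (use ev in \<open>auto elim: eventually_mono\<close>)
  then have "(\<lambda>n. c * (p n / (c / sqrt (real n)))) \<longlonglongrightarrow> c * 1" by (intro tendsto_intros)
  moreover have "c * (p n / (c / sqrt (real n))) = sqrt n * p n" for n using c by simp
  ultimately have sp: "(\<lambda>n. sqrt n * p n) \<longlonglongrightarrow> c" by simp
  have "(\<lambda>n. 1 / sqrt (real n)) \<longlonglongrightarrow> 0" by real_asymp
  then have "(\<lambda>n. sqrt n * p n * (1 / sqrt (real n))) \<longlonglongrightarrow> c * 0" by (intro tendsto_intros sp)
  moreover have "\<forall>\<^sub>F n in sequentially. sqrt n * p n * (1 / sqrt (real n)) = p n"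
    using eventually_gt_at_top[of 0] by eventually_elim simp
  ultimately have p0: "p \<longlonglongrightarrow> 0" by (simp add: tendsto_cong)
  have "\<forall>\<^sub>F n in sequentially. 0 < sqrt (real n) * p n" by (rule order_tendstoD(1)[OF sp c])
  moreover have "\<forall>\<^sub>F n in sequentially. p n < 1" by (rule order_tendstoD(2)[OF p0]) simp
  ultimately show "\<forall>\<^sub>F n in sequentially. 0 < p n \<and> p n < 1"
    by eventually_elim (simp add: zero_less_mult_iff)
  have "(\<lambda>n. (sqrt n * p n) / (1 - p n)) \<longlonglongrightarrow> c / (1 - 0)"
    by (intro tendsto_intros sp p0) simp
  then show "(\<lambda>n. sqrt n * (p n / (1 - p n))) \<longlonglongrightarrow> c" by simp
qed

lemma eventually_near:
  fixes p :: "nat \<Rightarrow> real"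
  assumes c: "0 < c" and p: "p \<sim>[at_top] (\<lambda>n. c / sqrt (real n))"
    and d: "0 < \<delta>" and z: "0 \<le> z" "z \<le> 1" "\<bar>z - \<zeta>\<bar> \<le> \<delta>"
  shows "\<forall>\<^sub>F n in sequentially. near c \<zeta> n \<delta> z (\<lambda>_. p n / (1 - p n))"
proof -
  note t = activity_tendsto(2)[OF c p]
  have "\<forall>\<^sub>F n in sequentially. c - \<delta> < sqrt n * (p n / (1 - p n))" by (rule order_tendstoD(1)[OF t]) (use d in simp)
  moreover have "\<forall>\<^sub>F n in sequentially. sqrt n * (p n / (1 - p n)) < c + \<delta>" by (rule order_tendstoD(2)[OF t]) (use d in simp)
  ultimately show ?thesis using eventually_gt_at_top[of 0]
  proof eventually_elim
    case (elim n)
    define x where "x = p n / (1 - p n)"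
    have "0 < sqrt (real n)" using elim by simp
    then have "(c - \<delta>) / sqrt n \<le> x" "x \<le> (c + \<delta>) / sqrt n"
      using elim(1,2) unfolding x_def[symmetric] by (simp_all add: divide_le_eq le_divide_eq mult.commute)
    then show ?case unfolding near_def x_def[symmetric] using z by simp
  qed
qed

text \<open>G(n,p) is the unpenalised model, so \<open>triangles_near\<close> applies at \<zeta> =
  0, where the fixed point is c.\<close>

lemma expectation_triangles_asymp:
  fixes p :: "nat \<Rightarrow> real"
  assumes c: "0 < c" and p: "p \<sim>[at_top] (\<lambda>n. c / sqrt (real n))" and e: "0 < \<epsilon>"
  shows "\<forall>\<^sub>F n in sequentially.
    \<bar>measure_pmf.expectation (gnp n (p n)) (\<lambda>U. real (num_triangles U)) - c ^ 3 / 6 * sqrt n ^ 3\<bar> \<le> \<epsilon> * sqrt n ^ 3"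
proof -
  interpret subcritical c 0 c by standard (use c in auto)
  obtain \<delta> N where d: "0 < \<delta>" "\<delta> < c"
    "\<And>n z lam. n \<ge> N \<Longrightarrow> near c 0 n \<delta> z lam \<Longrightarrow>
       \<bar>(\<Sum>h\<in>K_tri n. gprob (K_edges n) z lam {} (K_tri n) (\<lambda>U. h \<subseteq> U)) - (1 - 0) * c ^ 3 / 6 * sqrt n ^ 3\<bar> \<le> \<epsilon> * sqrt n ^ 3"
    using triangles_near[OF e] by metis
  have "\<forall>\<^sub>F n in sequentially. near c 0 n \<delta> 0 (\<lambda>_. p n / (1 - p n))"
    by (rule eventually_near[OF c p]) (use d in auto)
  with activity_tendsto(1)[OF c p] eventually_ge_at_top[of N] show ?thesis
  proof eventually_elim
    case (elim n)
    then show ?case using d(3)[OF elim(2,3)] by (simp add: expectation_triangles)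
  qed
qed

lemma tri_rate_isCont:
  assumes "0 < z"
  shows "isCont (\<lambda>z. (1 - z) * edge_rate c z ^ 3 / 6) z"
proof -
  have "continuous_on {0<..} (edge_rate c)"
    by (rule continuous_on_subset[OF continuous_on_edge_rate]) auto
  then have "isCont (edge_rate c) z"
    using assms by (simp add: continuous_on_eq_continuous_at)
  then show ?thesis by (intro continuous_intros) auto
qed

text \<open>
  The penalty z is taken slightly above the solution of the equation, so that in the penalised model
  the triangle count typically falls just below the prescribed bound.
\<close>

lemma lower_tail_le_penalised:
  fixes p :: "nat \<Rightarrow> real"
  assumes c: "0 < c" and eta: "0 \<le> \<eta>" "\<eta> < 1" and sol: "zeta_solution c \<eta> \<zeta>" and contr: "2 * \<zeta> * c\<^sup>2 < 1"
    and p: "p \<sim>[at_top] (\<lambda>n. c / sqrt (real n))" and d: "0 < \<delta>"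
  obtains z where "0 \<le> z" "z \<le> 1" "\<bar>z - \<zeta>\<bar> \<le> \<delta>"
    "\<forall>\<^sub>F n in sequentially. 0 < measure_pmf.prob (gnp n (p n)) (lower_tail n (p n) \<eta>) \<and>
      (\<forall>B. measure_pmf.prob (gnp n (p n)) (B \<inter> lower_tail n (p n) \<eta>) / measure_pmf.prob (gnp n (p n)) (lower_tail n (p n) \<eta>)
        \<le> 2 * exp (\<delta> * sqrt n ^ 3) * gprob (K_edges n) z (\<lambda>_. p n / (1 - p n)) {} (K_tri n) (\<lambda>U. U \<in> B))"
proof (cases "\<eta> = 0")
  case True
  \<comment> \<open>For \<eta> = 0 the penalty is a hard constraint: since \<open>0 ^ 0 = 1\<close>,
    the weights at z = 1 are those of the triangle-free graphs, and no window below the threshold is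
    involved.\<close>
  then have z1: "\<zeta> = 1" using sol edge_rate_pos[OF c, of \<zeta>] unfolding zeta_solution_iff[OF c] by auto
  have "\<forall>\<^sub>F n in sequentially. 0 < measure_pmf.prob (gnp n (p n)) (lower_tail n (p n) \<eta>) \<and>
      (\<forall>B. measure_pmf.prob (gnp n (p n)) (B \<inter> lower_tail n (p n) \<eta>) / measure_pmf.prob (gnp n (p n)) (lower_tail n (p n) \<eta>)
        \<le> 2 * exp (\<delta> * sqrt n ^ 3) * gprob (K_edges n) 1 (\<lambda>_. p n / (1 - p n)) {} (K_tri n) (\<lambda>U. U \<in> B))"
    using activity_tendsto(1)[OF c p]
  proof eventually_elim
    case (elim n)
    define lam :: "nat set \<Rightarrow> real" where "lam = (\<lambda>_. p n / (1 - p n))"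
    interpret linear_gibbs "K_edges n" 1 "K_tri n" "n - 2" by (rule linear_gibbs_K) auto
    have lam: "0 \<le> lam v" for v using elim unfolding lam_def by auto
    have ne: "{} \<notin> K_tri n" using tri_card[of "{}"] by auto
    have Zp: "0 < Z lam {} (K_tri n)" using Z_ge_1[of lam "K_tri n" "{}"] lam ne by fastforce
    have "of_bool (0 \<le> real (num_triangles U) \<and> real (num_triangles U) \<le> 0) * gwt 1 lam {} (K_tri n) U = gwt 1 lam {} (K_tri n) U"
      if "U \<subseteq> K_edges n" for U
      unfolding gwt_def num_triangles_eq[OF that] by (cases "card {h \<in> K_tri n. h \<subseteq> U}") simp_all
    then have "S lam {} (K_tri n) (\<lambda>U. of_bool (0 \<le> real (num_triangles U) \<and> real (num_triangles U) \<le> 0)) = Z lam {} (K_tri n)"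
      unfolding gsum_def by (intro sum.cong refl) simp
    then have one: "P lam {} (K_tri n) (\<lambda>U. 0 \<le> real (num_triangles U) \<and> real (num_triangles U) \<le> 0) = 1"
      unfolding gprob_def using Zp by simp
    have L: "U \<in> lower_tail n (p n) \<eta> \<longleftrightarrow> real (num_triangles U) \<le> 0" for U
      unfolding lower_tail_def True by simp
    note cg = cond_gnp_le[where x = 0 and y = 0 and z = 1 and n = n and L = "lower_tail n (p n) \<eta>", OF conjunct1[OF elim] conjunct2[OF elim] _ _ _ L,
        folded lam_def, unfolded one]
    have 1: "0 < measure_pmf.prob (gnp n (p n)) (lower_tail n (p n) \<eta>)" by (rule cg(1)) auto
    have 2: "measure_pmf.prob (gnp n (p n)) (B \<inter> lower_tail n (p n) \<eta>) / measure_pmf.prob (gnp n (p n)) (lower_tail n (p n) \<eta>)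
        \<le> P lam {} (K_tri n) (\<lambda>U. U \<in> B)" for B
      using cg(2)[of B] by simp
    have 3: "1 * P lam {} (K_tri n) (\<lambda>U. U \<in> B) \<le> 2 * exp (\<delta> * sqrt n ^ 3) * P lam {} (K_tri n) (\<lambda>U. U \<in> B)" for B
    proof (rule mult_right_mono)
      have "1 \<le> exp (\<delta> * sqrt n ^ 3)" using d by simp
      then show "1 \<le> 2 * exp (\<delta> * sqrt n ^ 3)" by linarith
      show "0 \<le> P lam {} (K_tri n) (\<lambda>U. U \<in> B)" by (rule gprob_nonneg[OF lam])
    qed
    show ?case using 1 order_trans[OF 2 3[simplified]] unfolding lam_def by auto
  qed
  then show thesis using that[of 1] d z1 by auto
next
  case False
  define f where "f z = (1 - z) * edge_rate c z ^ 3 / 6" for z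
  have z0: "0 < \<zeta>" using zeta_solution_pos[OF c eta(2) sol] .
  have f\<zeta>: "f \<zeta> = \<eta> * c ^ 3 / 6" using sol unfolding zeta_solution_iff[OF c] f_def by simp
  have "\<zeta> \<le> 1" using sol unfolding zeta_solution_def by simp
  moreover have "\<zeta> \<noteq> 1" using f\<zeta> c False unfolding f_def by auto
  ultimately have z1: "\<zeta> < 1" by simp
  \<comment> \<open>The cost, in the exponent and per n^(3/2), of using a penalty z whose typical
    triangle count lies below the threshold; it vanishes at \<zeta>.\<close>
  have cont: "isCont (\<lambda>z. - ln (1 - z) * (f \<zeta> - f z)) \<zeta>"
    using z1 tri_rate_isCont[OF z0, of c] unfolding f_def[symmetric] by (intro continuous_intros) auto
  have "((\<lambda>z. - ln (1 - z) * (f \<zeta> - f z)) \<longlongrightarrow> - ln (1 - \<zeta>) * (f \<zeta> - f \<zeta>)) (at_right \<zeta>)"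
    using isContD[OF cont] filterlim_at_split by blast
  then have e1: "\<forall>\<^sub>F z in at_right \<zeta>. - ln (1 - z) * (f \<zeta> - f z) < \<delta> / 2"
    by (rule order_tendstoD(2)) (use d in simp)
  note id = tendsto_ident_at[of \<zeta> "{\<zeta><..}"]
  have "((\<lambda>z. 2 * z * c\<^sup>2) \<longlongrightarrow> 2 * \<zeta> * c\<^sup>2) (at_right \<zeta>)" by (intro tendsto_intros id)
  then have e2: "\<forall>\<^sub>F z in at_right \<zeta>. 2 * z * c\<^sup>2 < 1" by (rule order_tendstoD(2)[OF _ contr])
  have e3: "\<forall>\<^sub>F z in at_right \<zeta>. z < min 1 (\<zeta> + \<delta>)" by (rule order_tendstoD(2)[OF id]) (use z1 d in simp)
  have e4: "\<forall>\<^sub>F z in at_right \<zeta>. \<zeta> < z" by (rule eventually_at_right_less)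
  from e1 e2 e3 e4 have "\<forall>\<^sub>F z in at_right \<zeta>. - ln (1 - z) * (f \<zeta> - f z) < \<delta> / 2 \<and> 2 * z * c\<^sup>2 < 1 \<and> z < min 1 (\<zeta> + \<delta>) \<and> \<zeta> < z"
    by eventually_elim auto
  then obtain z where z: "- ln (1 - z) * (f \<zeta> - f z) < \<delta> / 2" "2 * z * c\<^sup>2 < 1" "z < 1" "z < \<zeta> + \<delta>" "\<zeta> < z"
    using eventually_happens'[of "at_right \<zeta>"] by auto
  define l where "l = - ln (1 - z)"
  have l: "0 < l" using z z0 unfolding l_def by simp
  have fz: "f z < f \<zeta>" using tri_rate_strict_antimono[of c \<zeta> z] c z0 z unfolding f_def by simp
  \<comment> \<open>The first term keeps the window f z \<plusminus> \<epsilon> below the threshold,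
    which itself is known only up to \<epsilon>. The second keeps the cost of these two errors, in
    the threshold and at the lower end of the window, below \<delta> / 2.\<close>
  define \<epsilon> where "\<epsilon> = min ((f \<zeta> - f z) / 4) (\<delta> / (4 * l))"
  have eps: "0 < \<epsilon>" using fz d l unfolding \<epsilon>_def by simp
  have eps': "\<epsilon> \<le> (f \<zeta> - f z) / 4" "\<epsilon> \<le> \<delta> / (4 * l)"
    unfolding \<epsilon>_def by (rule min.cobounded1, rule min.cobounded2)
  have "l * (2 * \<epsilon>) \<le> l * (2 * (\<delta> / (4 * l)))" using eps' l by (intro mult_left_mono) auto
  also have "\<dots> = \<delta> / 2" using l by simp
  finally have cost: "l * (f \<zeta> - f z + 2 * \<epsilon>) \<le> \<delta>" using z(1) unfolding l_def[symmetric] by (simp add: distrib_left)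
  interpret sz: subcritical c z "edge_rate c z" by (rule subcritical_edge_rate) (use c z z0 in auto)
  obtain \<delta>1 \<kappa> N where tc: "0 < \<delta>1" "0 < \<kappa>"
    "\<And>n lam. n \<ge> N \<Longrightarrow> near c z n \<delta>1 z lam \<Longrightarrow>
       1 - 2 * exp (- \<kappa> * sqrt n ^ 3) \<le> gprob (K_edges n) z lam {} (K_tri n)
         (\<lambda>U. (f z - \<epsilon>) * sqrt n ^ 3 \<le> num_triangles U \<and>
              num_triangles U \<le> (f z + \<epsilon>) * sqrt n ^ 3)"
    using sz.triangle_concentration[OF eps] z z0 unfolding f_def by auto
  have nr: "\<forall>\<^sub>F n in sequentially. near c z n \<delta>1 z (\<lambda>_. p n / (1 - p n))"
    by (rule eventually_near[OF c p]) (use tc z z0 in auto)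
  have "(\<lambda>n. 2 * exp (- \<kappa> * sqrt (real n) ^ 3)) \<longlonglongrightarrow> 0" using tc(2) by real_asymp
  then have sm: "\<forall>\<^sub>F n in sequentially. 2 * exp (- \<kappa> * sqrt (real n) ^ 3) < 1 / 2"
    by (rule order_tendstoD(2)) simp
  have "\<forall>\<^sub>F n in sequentially. 0 < measure_pmf.prob (gnp n (p n)) (lower_tail n (p n) \<eta>) \<and>
      (\<forall>B. measure_pmf.prob (gnp n (p n)) (B \<inter> lower_tail n (p n) \<eta>) / measure_pmf.prob (gnp n (p n)) (lower_tail n (p n) \<eta>)
        \<le> 2 * exp (\<delta> * sqrt n ^ 3) * gprob (K_edges n) z (\<lambda>_. p n / (1 - p n)) {} (K_tri n) (\<lambda>U. U \<in> B))"
    using activity_tendsto(1)[OF c p] nr sm expectation_triangles_asymp[OF c p eps] eventually_ge_at_top[of N]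
  proof eventually_elim
    case (elim n)
    define lam :: "nat set \<Rightarrow> real" where "lam = (\<lambda>_. p n / (1 - p n))"
    define s where "s = sqrt (real n)"
    interpret linear_gibbs "K_edges n" z "K_tri n" "n - 2" by (rule linear_gibbs_K) (use z z0 in auto)
    have lam: "0 \<le> lam v" for v using elim unfolding lam_def by auto
    have s: "0 \<le> s ^ 3" unfolding s_def by simp
    define Ex where "Ex = measure_pmf.expectation (gnp n (p n)) (\<lambda>U. real (num_triangles U))"
    have Ex: "\<bar>Ex - c ^ 3 / 6 * s ^ 3\<bar> \<le> \<epsilon> * s ^ 3" using elim(4) unfolding Ex_def s_def .
    have "\<bar>\<eta> * (Ex - c ^ 3 / 6 * s ^ 3)\<bar> \<le> 1 * (\<epsilon> * s ^ 3)"
      unfolding abs_mult by (rule mult_mono) (use Ex eta in auto)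
    then have x: "\<bar>\<eta> * Ex - f \<zeta> * s ^ 3\<bar> \<le> \<epsilon> * s ^ 3"
      unfolding f\<zeta> by (simp add: algebra_simps)
    define y where "y = (f z - \<epsilon>) * s ^ 3"
    have "(f z + \<epsilon>) * s ^ 3 \<le> (f \<zeta> - \<epsilon>) * s ^ 3" using eps eps' fz s by (intro mult_right_mono) auto
    also have "\<dots> \<le> \<eta> * Ex" using x by (simp add: left_diff_distrib)
    finally have up: "(f z + \<epsilon>) * s ^ 3 \<le> \<eta> * Ex" .
    have "1 / 2 \<le> 1 - 2 * exp (- \<kappa> * s ^ 3)" using elim(3) unfolding s_def by simp
    also have "\<dots> \<le> P lam {} (K_tri n) (\<lambda>U. y \<le> num_triangles U \<and> num_triangles U \<le> (f z + \<epsilon>) * s ^ 3)"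
      unfolding lam_def s_def y_def by (rule tc(3)[OF elim(5,2)])
    also have "\<dots> \<le> P lam {} (K_tri n) (\<lambda>U. y \<le> num_triangles U \<and> num_triangles U \<le> \<eta> * Ex)"
      by (rule gprob_mono[OF lam]) (use up in auto)
    finally have half: "1 / 2 \<le> P lam {} (K_tri n) (\<lambda>U. y \<le> num_triangles U \<and> num_triangles U \<le> \<eta> * Ex)" .
    have L: "U \<in> lower_tail n (p n) \<eta> \<longleftrightarrow> real (num_triangles U) \<le> \<eta> * Ex" for U
      unfolding lower_tail_def Ex_def by simp
    have pp: "0 < p n" "p n < 1" using elim by auto
    have zz: "0 \<le> z" "z \<le> 1" "z = 1 \<Longrightarrow> \<eta> * Ex = 0 \<and> y = 0" using z z0 by auto
    have pos: "0 < P lam {} (K_tri n) (\<lambda>U. y \<le> num_triangles U \<and> num_triangles U \<le> \<eta> * Ex)" using half by linarith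
    have 1: "0 < measure_pmf.prob (gnp n (p n)) (lower_tail n (p n) \<eta>)"
      by (rule cond_gnp_le(1)[OF pp zz L pos[unfolded lam_def]])
    have 2: "measure_pmf.prob (gnp n (p n)) (B \<inter> lower_tail n (p n) \<eta>) / measure_pmf.prob (gnp n (p n)) (lower_tail n (p n) \<eta>)
        \<le> 2 * exp (\<delta> * s ^ 3) * P lam {} (K_tri n) (\<lambda>U. U \<in> B)" for B
    proof -
      have "measure_pmf.prob (gnp n (p n)) (B \<inter> lower_tail n (p n) \<eta>) / measure_pmf.prob (gnp n (p n)) (lower_tail n (p n) \<eta>)
        \<le> exp (l * (\<eta> * Ex - y)) * P lam {} (K_tri n) (\<lambda>U. U \<in> B) / P lam {} (K_tri n) (\<lambda>U. y \<le> num_triangles U \<and> num_triangles U \<le> \<eta> * Ex)"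
        unfolding l_def lam_def by (rule cond_gnp_le(2)[OF pp zz L pos[unfolded lam_def]])
      also have "\<dots> \<le> exp (\<delta> * s ^ 3) * P lam {} (K_tri n) (\<lambda>U. U \<in> B) / (1 / 2)"
      proof (rule frac_le[OF _ _ _ half])
        have "\<eta> * Ex - y \<le> (f \<zeta> - f z + 2 * \<epsilon>) * s ^ 3"
          using x unfolding y_def by (simp add: algebra_simps abs_le_iff)
        then have "l * (\<eta> * Ex - y) \<le> l * ((f \<zeta> - f z + 2 * \<epsilon>) * s ^ 3)" using l by (intro mult_left_mono) auto
        also have "\<dots> = l * (f \<zeta> - f z + 2 * \<epsilon>) * s ^ 3" by simp
        also have "\<dots> \<le> \<delta> * s ^ 3" using cost s by (intro mult_right_mono) auto
        finally show "exp (l * (\<eta> * Ex - y)) * P lam {} (K_tri n) (\<lambda>U. U \<in> B) \<le> exp (\<delta> * s ^ 3) * P lam {} (K_tri n) (\<lambda>U. U \<in> B)"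
          by (intro mult_right_mono gprob_nonneg[OF lam]) simp
      qed (auto intro!: mult_nonneg_nonneg gprob_nonneg[OF lam])
      finally show ?thesis by simp
    qed
    show ?case using 1 2 unfolding lam_def s_def by auto
  qed
  then show thesis using that[of z] z z0 by auto
qed

text \<open>Edge sets that are not contained in \<open>K_edges n\<close> count as deviating, so that
  the complement consists of graphs on the right vertices. This costs nothing, as the models charge
  only subsets of \<open>K_edges n\<close>.\<close>

definition deviating :: "real \<Rightarrow> real \<Rightarrow> nat \<Rightarrow> nat set set set" where
  "deviating a \<epsilon> n = {U. U \<subseteq> K_edges n \<longrightarrow> (\<exists>S\<in>Pow {..<n}. \<exists>T\<in>Pow {..<n}.
     \<epsilon> * sqrt n ^ 3 \<le> \<bar>(\<Sum>e\<in>U. pair_weight S T e) - a / sqrt n * (\<Sum>e\<in>K_edges n. pair_weight S T e)\<bar>)}"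

lemma deviating_prob:
  fixes p :: "nat \<Rightarrow> real"
  assumes c: "0 < c" and eta: "0 \<le> \<eta>" "\<eta> < 1" and sol: "zeta_solution c \<eta> \<zeta>" and contr: "2 * \<zeta> * c\<^sup>2 < 1"
    and p: "p \<sim>[at_top] (\<lambda>n. c / sqrt (real n))" and e: "0 < \<epsilon>"
  obtains \<kappa> where "0 < \<kappa>"
    "\<forall>\<^sub>F n in sequentially. 0 < measure_pmf.prob (gnp n (p n)) (lower_tail n (p n) \<eta>) \<and>
       measure_pmf.prob (gnp n (p n)) (deviating (edge_rate c \<zeta>) \<epsilon> n \<inter> lower_tail n (p n) \<eta>) /
         measure_pmf.prob (gnp n (p n)) (lower_tail n (p n) \<eta>) \<le> 4 * 4 ^ n * exp (- \<kappa> * sqrt n ^ 3)"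
proof -
  have z01: "0 \<le> \<zeta>" "\<zeta> \<le> 1" using sol unfolding zeta_solution_def by auto
  define a where "a = edge_rate c \<zeta>"
  interpret sz: subcritical c \<zeta> a unfolding a_def by (rule subcritical_edge_rate[OF c z01 contr])
  obtain \<delta> \<kappa> N where wc: "0 < \<delta>" "0 < \<kappa>"
    "\<And>n z lam w. n \<ge> N \<Longrightarrow> near c \<zeta> n \<delta> z lam \<Longrightarrow> (\<And>e. e \<in> K_edges n \<Longrightarrow> 0 \<le> w e \<and> w e \<le> (2::real)) \<Longrightarrow>
       gprob (K_edges n) z lam {} (K_tri n) (\<lambda>U. \<epsilon> * sqrt n ^ 3 \<le> \<bar>(\<Sum>e\<in>U. w e) - a / sqrt n * (\<Sum>e\<in>K_edges n. w e)\<bar>)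
         \<le> 2 * exp (- \<kappa> * sqrt n ^ 3)"
    using sz.weighted_size_concentration[OF e] by metis
  \<comment> \<open>The penalty must stay in the window of the concentration bound, and the cost exp
    (\<delta>' n^(3/2)) of the conditioning may consume at most half of its exponent.\<close>
  define \<delta>' where "\<delta>' = min \<delta> (\<kappa> / 2)"
  have d': "0 < \<delta>'" "\<delta>' \<le> \<delta>" "\<delta>' \<le> \<kappa> / 2" using wc unfolding \<delta>'_def by auto
  obtain z where z: "0 \<le> z" "z \<le> 1" "\<bar>z - \<zeta>\<bar> \<le> \<delta>'"
    and ev: "\<forall>\<^sub>F n in sequentially. 0 < measure_pmf.prob (gnp n (p n)) (lower_tail n (p n) \<eta>) \<and>
      (\<forall>B. measure_pmf.prob (gnp n (p n)) (B \<inter> lower_tail n (p n) \<eta>) / measure_pmf.prob (gnp n (p n)) (lower_tail n (p n) \<eta>)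
        \<le> 2 * exp (\<delta>' * sqrt n ^ 3) * gprob (K_edges n) z (\<lambda>_. p n / (1 - p n)) {} (K_tri n) (\<lambda>U. U \<in> B))"
    using lower_tail_le_penalised[OF c eta sol contr p d'(1)] by blast
  have nr: "\<forall>\<^sub>F n in sequentially. near c \<zeta> n \<delta> z (\<lambda>_. p n / (1 - p n))"
    by (rule eventually_near[OF c p wc(1) z(1,2)]) (use z d' in auto)
  show thesis
  proof (rule that[of "\<kappa> / 2"])
    show "0 < \<kappa> / 2" using wc by simp
    show "\<forall>\<^sub>F n in sequentially. 0 < measure_pmf.prob (gnp n (p n)) (lower_tail n (p n) \<eta>) \<and>
       measure_pmf.prob (gnp n (p n)) (deviating (edge_rate c \<zeta>) \<epsilon> n \<inter> lower_tail n (p n) \<eta>) /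
         measure_pmf.prob (gnp n (p n)) (lower_tail n (p n) \<eta>) \<le> 4 * 4 ^ n * exp (- (\<kappa> / 2) * sqrt n ^ 3)"
      using ev nr activity_tendsto(1)[OF c p] eventually_ge_at_top[of N]
    proof eventually_elim
      case (elim n)
      define lam :: "nat set \<Rightarrow> real" where "lam = (\<lambda>_. p n / (1 - p n))"
      define s where "s = sqrt (real n)"
      interpret linear_gibbs "K_edges n" z "K_tri n" "n - 2" by (rule linear_gibbs_K[OF z(1,2)])
      have lam: "0 \<le> lam v" for v using elim unfolding lam_def by auto
      have s: "0 \<le> s ^ 3" unfolding s_def by simp
      let ?Q = "\<lambda>x U. \<epsilon> * s ^ 3 \<le> \<bar>(\<Sum>e\<in>U. pair_weight (fst x) (snd x) e) - a / s * (\<Sum>e\<in>K_edges n. pair_weight (fst x) (snd x) e)\<bar>"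
      have "P lam {} (K_tri n) (\<lambda>U. U \<in> deviating a \<epsilon> n) \<le> P lam {} (K_tri n) (\<lambda>U. \<exists>x\<in>Pow {..<n} \<times> Pow {..<n}. ?Q x U)"
        by (rule gprob_mono[OF lam]) (auto simp: deviating_def s_def)
      also have "\<dots> \<le> (\<Sum>x\<in>Pow {..<n} \<times> Pow {..<n}. P lam {} (K_tri n) (?Q x))"
        by (rule gprob_Bex[OF lam]) simp
      also have "\<dots> \<le> (\<Sum>x\<in>Pow {..<n} \<times> Pow {..<n}. 2 * exp (- \<kappa> * s ^ 3))"
        unfolding s_def lam_def using pair_weight_bounds by (intro sum_mono wc(3)[OF elim(4,2)]) auto
      also have "\<dots> = 4 ^ n * (2 * exp (- \<kappa> * s ^ 3))"
        by (simp add: card_cartesian_product card_Pow flip: power_mult_distrib)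
      finally have g: "P lam {} (K_tri n) (\<lambda>U. U \<in> deviating a \<epsilon> n) \<le> 4 ^ n * (2 * exp (- \<kappa> * s ^ 3))" .
      have "measure_pmf.prob (gnp n (p n)) (deviating a \<epsilon> n \<inter> lower_tail n (p n) \<eta>) /
         measure_pmf.prob (gnp n (p n)) (lower_tail n (p n) \<eta>)
         \<le> 2 * exp (\<delta>' * s ^ 3) * P lam {} (K_tri n) (\<lambda>U. U \<in> deviating a \<epsilon> n)"
        using elim(1) unfolding lam_def s_def by blast
      also have "\<dots> \<le> 2 * exp (\<delta>' * s ^ 3) * (4 ^ n * (2 * exp (- \<kappa> * s ^ 3)))"
        by (intro mult_left_mono g) simp
      also have "\<dots> = 4 * 4 ^ n * exp (\<delta>' * s ^ 3 + - \<kappa> * s ^ 3)" unfolding exp_add by simp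
      also have "\<dots> \<le> 4 * 4 ^ n * exp (- (\<kappa> / 2) * s ^ 3)"
        using mult_right_mono[OF d'(3) s] by (intro mult_left_mono) auto
      finally show ?case using elim(1) unfolding a_def s_def by blast
    qed
  qed
qed

section \<open>Almost sure convergence\<close>

lemma summable_cut_bound:
  fixes \<kappa> :: real
  assumes "0 < \<kappa>" and ev: "\<forall>\<^sub>F n in sequentially. 0 \<le> f n \<and> f n \<le> 4 * 4 ^ n * exp (- \<kappa> * sqrt (real n) ^ 3)"
  shows "summable f"
proof (rule summable_comparison_test_ev)
  have "\<forall>\<^sub>F n in sequentially. 4 * 4 ^ n * exp (- \<kappa> * sqrt (real n) ^ 3) \<le> (1 / 2 :: real) ^ n"
    using assms(1) by real_asymp
  with ev show "\<forall>\<^sub>F n in sequentially. norm (f n) \<le> (1 / 2) ^ n"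
    by eventually_elim auto
qed (simp add: summable_geometric)

lemma measure_cond_pmf:
  assumes "0 < measure_pmf.prob P L"
  shows "measure_pmf.prob (cond_pmf P L) B = measure_pmf.prob P (B \<inter> L) / measure_pmf.prob P L"
proof -
  have "set_pmf P \<inter> L \<noteq> {}"
    using assms by (auto simp: measure_pmf_zero_iff dest!: less_imp_neq)
  then have "measure_pmf (cond_pmf P L) = uniform_measure (measure_pmf P) L" by (rule cond_pmf.rep_eq)
  then show ?thesis using assms
    by (simp add: measure_pmf.emeasure_eq_measure Int_commute)
qed

text \<open>The normalisation q n^2 is a n^(3/2): the deviation contributes \<epsilon> / a and the
  diagonal term 1 / n.\<close>

lemma cut_norm_not_deviating:
  assumes n: "0 < n" and a: "0 < a" and U: "U \<notin> deviating a \<epsilon> n"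
  shows "0 \<le> 1 / (a / sqrt n * (real n)\<^sup>2) * cut_norm (adj_mat n U - (a / sqrt n) \<cdot>\<^sub>m all_ones_mat n)"
    and "1 / (a / sqrt n * (real n)\<^sup>2) * cut_norm (adj_mat n U - (a / sqrt n) \<cdot>\<^sub>m all_ones_mat n) \<le> \<epsilon> / a + 1 / n"
proof -
  define s where "s = sqrt (real n)"
  have s: "0 < s" "real n = s\<^sup>2" using n by (auto simp: s_def)
  have U': "U \<subseteq> K_edges n" and dev: "\<And>S T. S \<subseteq> {..<n} \<Longrightarrow> T \<subseteq> {..<n} \<Longrightarrow>
     \<bar>(\<Sum>e\<in>U. pair_weight S T e) - a / s * (\<Sum>e\<in>K_edges n. pair_weight S T e)\<bar> \<le> \<epsilon> * s ^ 3"
    using U unfolding deviating_def s_def by (auto simp: not_le intro: less_imp_le)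
  have as: "0 \<le> a / s" using a s by simp
  note cn = cut_norm_pair_weight[OF U' as dev]
  have d: "a / s * (real n)\<^sup>2 = a * s ^ 3" using s by (simp add: power2_eq_square power3_eq_cube)
  have c0: "0 \<le> 1 / (a * s ^ 3)" using a s by simp
  show "0 \<le> 1 / (a / sqrt n * (real n)\<^sup>2) * cut_norm (adj_mat n U - (a / sqrt n) \<cdot>\<^sub>m all_ones_mat n)"
    unfolding s_def[symmetric] d by (rule mult_nonneg_nonneg[OF c0 cn(1)])
  have "1 / (a * s ^ 3) * cut_norm (adj_mat n U - (a / s) \<cdot>\<^sub>m all_ones_mat n) \<le> 1 / (a * s ^ 3) * (\<epsilon> * s ^ 3 + a / s * n)"
    by (rule mult_left_mono[OF cn(2) c0])
  also have "\<dots> = \<epsilon> / a + 1 / n"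
    unfolding s(2) using a s(1) by (simp add: field_simps power2_eq_square power3_eq_cube)
  finally show "1 / (a / sqrt n * (real n)\<^sup>2) * cut_norm (adj_mat n U - (a / sqrt n) \<cdot>\<^sub>m all_ones_mat n) \<le> \<epsilon> / a + 1 / n"
    unfolding s_def[symmetric] d .
qed

theorem theorem1p5:
  fixes c \<eta> :: real
    and p :: "nat \<Rightarrow> real"
    and M :: "'a measure"
    and G :: "nat \<Rightarrow> 'a \<Rightarrow> nat set set"
    and q :: "real \<Rightarrow> nat \<Rightarrow> real"
  assumes c_pos: "0 < c"
    and eta: "0 \<le> \<eta>" "\<eta> < 1"
    and c_less: "ereal c < c_bar \<eta>"
    and p_prob: "\<And>n. n \<ge> 1 \<Longrightarrow> 0 \<le> p n \<and> p n \<le> 1"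
    and p_asymp: "p \<sim>[at_top] (\<lambda>n. c / sqrt (real n))"
    and M: "prob_space M"
    and G_measurable: "\<And>n. n \<ge> 1 \<Longrightarrow> G n \<in> measurable M (count_space UNIV)"
    and G_law: "\<And>n. n \<ge> 1 \<Longrightarrow> measure_pmf.prob (gnp n (p n)) (lower_tail n (p n) \<eta>) > 0 \<Longrightarrow>
           distr M (count_space UNIV) (G n) =
             measure_pmf (cond_pmf (gnp n (p n)) (lower_tail n (p n) \<eta>))"
    and q_def: "\<And>\<zeta> n. q \<zeta> n = sqrt (Lambert_W (2 * \<zeta> * c\<^sup>2) / (2 * \<zeta>)) * (1 / sqrt (real n))"
  shows "(\<exists>!\<zeta>. zeta_solution c \<eta> \<zeta>) \<and>
         (\<forall>\<zeta>. zeta_solution c \<eta> \<zeta> \<longrightarrow>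
            (AE \<omega> in M.
               (\<lambda>n. 1 / (q \<zeta> n * (real n)\<^sup>2) *
                      cut_norm (adj_mat n (G n \<omega>) - q \<zeta> n \<cdot>\<^sub>m all_ones_mat n))
               \<longlonglongrightarrow> 0))"
proof (intro conjI allI impI)
  show "\<exists>!\<zeta>. zeta_solution c \<eta> \<zeta>" by (rule zeta_solution_ex1[OF c_pos eta])
next
  fix \<zeta> assume sol: "zeta_solution c \<eta> \<zeta>"
  interpret M: prob_space M by (rule M)
  note contr = zeta_contraction[OF c_pos eta c_less sol]
  define a where "a = edge_rate c \<zeta>"
  have a: "0 < a" unfolding a_def by (rule edge_rate_pos[OF c_pos])
  have q: "q \<zeta> n = a / sqrt n" for n
    unfolding q_def a_def using sqrt_Lambert_W_eq_edge_rate[OF c_pos zeta_solution_pos[OF c_pos eta(2) sol]] by simp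
  have AE1: "AE \<omega> in M. \<forall>\<^sub>F n in sequentially. G n \<omega> \<notin> deviating a \<epsilon> n" if e: "0 < \<epsilon>" for \<epsilon>
  proof -
    obtain \<kappa> where k: "0 < \<kappa>"
      and ev: "\<forall>\<^sub>F n in sequentially. 0 < measure_pmf.prob (gnp n (p n)) (lower_tail n (p n) \<eta>) \<and>
       measure_pmf.prob (gnp n (p n)) (deviating a \<epsilon> n \<inter> lower_tail n (p n) \<eta>) /
         measure_pmf.prob (gnp n (p n)) (lower_tail n (p n) \<eta>) \<le> 4 * 4 ^ n * exp (- \<kappa> * sqrt n ^ 3)"
      using deviating_prob[OF c_pos eta sol contr p_asymp e] unfolding a_def by blast
    \<comment> \<open>Measurability of \<open>G n\<close> is available only from n = 1 on, hence the
      empty event at 0.\<close>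
    define A where "A n = (if n = 0 then {} else G n -` deviating a \<epsilon> n \<inter> space M)" for n
    have sets: "A n \<in> sets M" for n
    proof (cases "n = 0")
      case False
      then have "G n \<in> measurable M (count_space UNIV)" by (intro G_measurable) simp
      then have "G n -` deviating a \<epsilon> n \<inter> space M \<in> sets M" by (rule measurable_sets) simp
      then show ?thesis using False by (simp add: A_def)
    qed (simp add: A_def)
    have "\<forall>\<^sub>F n in sequentially. 0 \<le> measure M (A n) \<and> measure M (A n) \<le> 4 * 4 ^ n * exp (- \<kappa> * sqrt (real n) ^ 3)"
      using ev eventually_ge_at_top[of 1]
    proof eventually_elim
      case (elim n)
      have pos: "0 < measure_pmf.prob (gnp n (p n)) (lower_tail n (p n) \<eta>)" using elim by blast
      have "measure M (A n) = measure (distr M (count_space UNIV) (G n)) (deviating a \<epsilon> n)"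
        using elim by (subst measure_distr[OF G_measurable]) (auto simp: A_def)
      also have "\<dots> = measure_pmf.prob (cond_pmf (gnp n (p n)) (lower_tail n (p n) \<eta>)) (deviating a \<epsilon> n)"
        by (simp only: G_law[OF elim(2) pos])
      finally show ?case using elim measure_cond_pmf[OF pos, of "deviating a \<epsilon> n"] by simp
    qed
    then have "summable (\<lambda>n. measure M (A n))" by (rule summable_cut_bound[OF k])
    then have "AE \<omega> in M. \<forall>\<^sub>F n in sequentially. \<omega> \<in> space M - A n"
      by (intro borel_cantelli_AE1 sets) (simp add: M.emeasure_eq_measure)
    then show ?thesis
    proof eventually_elim
      case (elim \<omega>)
      from elim eventually_gt_at_top[of 0] show ?case
        by eventually_elim (auto simp: A_def)
    qed
  qed
  \<comment> \<open>Countably many deviations suffice, so one null set serves them all; the factor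
    \<open>a\<close> cancels in the normalised cut norm.\<close>
  have "AE \<omega> in M. \<forall>k. \<forall>\<^sub>F n in sequentially. G n \<omega> \<notin> deviating a (a / real (Suc k)) n"
    unfolding AE_all_countable by (intro allI AE1) (use a in simp)
  then show "AE \<omega> in M. (\<lambda>n. 1 / (q \<zeta> n * (real n)\<^sup>2) *
      cut_norm (adj_mat n (G n \<omega>) - q \<zeta> n \<cdot>\<^sub>m all_ones_mat n)) \<longlonglongrightarrow> 0"
  proof eventually_elim
    case (elim \<omega>)
    show ?case
    proof (rule tendstoI)
      fix e :: real assume e: "0 < e"
      then obtain k where k: "1 / real (Suc k) < e / 2"
        using nat_approx_posE[of "e / 2"] by auto
      have "(\<lambda>n. 1 / real n) \<longlonglongrightarrow> 0" by (rule lim_1_over_n)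
      then have "\<forall>\<^sub>F n in sequentially. 1 / real n < e / 2" by (rule order_tendstoD(2)) (use e in simp)
      with spec[OF elim, of k] eventually_gt_at_top[of 0]
      show "\<forall>\<^sub>F n in sequentially. dist (1 / (q \<zeta> n * (real n)\<^sup>2) *
          cut_norm (adj_mat n (G n \<omega>) - q \<zeta> n \<cdot>\<^sub>m all_ones_mat n)) 0 < e"
      proof eventually_elim
        case (elim n)
        have "a / real (Suc k) / a = 1 / real (Suc k)" using a by simp
        then show ?case
          using cut_norm_not_deviating[OF elim(2) a elim(1)] k elim(3) unfolding q by (simp add: dist_real_def)
      qed
    qed
  qed
qed

end
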